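(* Let $(G,\rho,V)$ be a reductive prehomogeneous vector space defined over $\mathbb{R}$ with basic relative invariants $P_1,\dots,P_r$ over $\mathbb{R}$, and let $d_k,c_k,\mu_i,\alpha_i,z_{ij}$ be the data attached to its $b$-functions as described in the context. Assume that every term of each $P_i$ is multilinear in $x$, i.e. each $P_i$ is of the form $$P_i(x)=\sum_{1\le j_1<\cdots<j_{d_i}\le n}a_{j_1\cdots j_{d_i}}x_{j_1}\cdots x_{j_{d_i}}\qquad(i=1,\dots,r).$$ Let $$Z_{\mathbb{R}}(s)=\int_{V_{\mathbb{R}}}|P_1(x)|^{s_1}\cdots|P_r(x)|^{s_r}\exp(-\pi x\,{}^tx)\,dx,$$ which converges and is holomorphic for $\mathrm{Re}(s_1),\dots,\mathrm{Re}(s_r)>0$, where $dx$ is Lebesgue measure on $V_{\mathbb{R}}=\mathbb{R}^n$ (and which continues meromorphically to $\mathbb{C}^r$). Then $$Z_{\mathbb{R}}(s)=\prod_{k=1}^r(\pi^{-d_k}c_k)^{\frac{s_k}{2}}\prod_{i=1}^l\prod_j\left(\frac{\Gamma((\mu_i(s)+\alpha_i+j)/2)}{\Gamma((\alpha_i+j)/2)}\right)^{z_{ij}}.$$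
   Context: $G$ is a connected reductive linear algebraic group over $\mathbb{C}$, $V$ an $n$-dimensional complex vector space, $\rho$ a rational representation such that $V\setminus S$ is a single $G$-orbit for some proper algebraic subset $S$; everything ($G,\rho,V$) is defined over $\mathbb{R}$. $S_0$ is the union of the codimension-one irreducible components of $S$, assumed nonempty; it is defined over $\mathbb{R}$. A basis of $V_{\mathbb{R}}$ (the real points of $V$) is fixed for which the group of $\mathbb{R}$-rational points of $\rho(G)$ is self-adjoint (stable under transpose); by it $V_{\mathbb{R}}=\mathbb{R}^n$. $P_1,\dots,P_r\in\mathbb{R}[x_1,\dots,x_n]$ are irreducible (over $\mathbb{R}$) polynomials defining the $\mathbb{R}$-irreducible components of $S_0$ (the basic relative invariants over $\mathbb{R}$); they are homogeneous, $d_k=\deg P_k$, and $\mathrm{grad}_x=(\partial/\partial x_1,\dots,\partial/\partial x_n)$. The $b$-functions $b_m(s)$, $m=(m_1,\dots,m_r)\in\mathbb{Z}_{\ge0}^r$, are the polynomials in $s=(s_1,\dots,s_r)$ with $$P_1(\mathrm{grad}_x)^{m_1}\cdots P_r(\mathrm{grad}_x)^{m_r}\big(P_1(x)^{s_1+m_1}\cdots P_r(x)^{s_r+m_r}\big)=b_m(s)P_1(x)^{s_1}\cdots P_r(x)^{s_r}.$$ By the Ore–Sato theorem they can be written, for all $0\ne m\in\mathbb{Z}_{\ge0}^r$, as $$b_m(s)=c_1^{m_1}\cdots c_r^{m_r}\prod_{i=1}^l\prod_j\prod_{\nu=0}^{\mu_i(m)-1}(\mu_i(s)+\alpha_i+j+\nu)^{z_{ij}},$$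 where: $c_k\in\mathbb{R}_{>0}$; each $\mu_i(s)=\sum_k\mu_{ik}s_k$ is a nonzero linear form with non-negative integer coefficients whose nonzero coefficients have greatest common divisor $1$; $\alpha_i\in\mathbb{C}$; for each $i$, $z_{ij}\in\mathbb{Z}$ ($j\in\mathbb{Z}$) with only finitely many nonzero, $\sum_jz_{ij}>0$, and $z_{ij}>0$ for the smallest and for the largest $j$ with $z_{ij}\neq0$; the polynomials $\mu_i(s)+\alpha_i$ ($i=1,\dots,l$) are not carried to one another by translations $s\mapsto s+m$, $m\in\mathbb{Z}^r$. Such an expression is fixed. It is known (Kashiwara) that each $\alpha_i+j$ with $z_{ij}>0$ is a positive rational number. *)

theory Defs
  imports
    "HOL-Analysis.Analysis"
    "HOL-Library.Poly_Mapping"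
    "HOL-Computational_Algebra.Factorial_Ring"
begin

section \<open>Polynomials in several variables\<close>

text \<open>Polynomials in variables indexed by \<open>'v\<close>: finitely supported maps from exponent vectors to
  coefficients, with the ring structure (convolution product) of \<open>Poly_Mapping\<close>.\<close>

type_synonym ('v, 'a) mpoly = "('v \<Rightarrow>\<^sub>0 nat) \<Rightarrow>\<^sub>0 'a"

definition peval :: "('v::finite, 'a::comm_semiring_1) mpoly \<Rightarrow> 'a ^ 'v \<Rightarrow> 'a" where
  "peval p x = (\<Sum>m\<in>Poly_Mapping.keys p.
      Poly_Mapping.lookup p m * (\<Prod>j\<in>UNIV. (x $ j) ^ Poly_Mapping.lookup m j))"

definition total_degree :: "('v::finite, 'a::zero) mpoly \<Rightarrow> nat" where
  "total_degree p = Max ((\<lambda>m. \<Sum>j\<in>UNIV. Poly_Mapping.lookup m j) ` Poly_Mapping.keys p)"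

definition cpoly :: "('v, real) mpoly \<Rightarrow> ('v, complex) mpoly" where
  "cpoly p = Poly_Mapping.map complex_of_real p"

text \<open>The squarefree monomial \<open>\<Prod>j\<in>J. x\<^sub>j\<close> with coefficient \<open>a\<close>.\<close>

definition squarefree_monom :: "'v set \<Rightarrow> 'a::zero \<Rightarrow> ('v, 'a) mpoly" where
  "squarefree_monom J a = Poly_Mapping.single (\<Sum>j\<in>J. Poly_Mapping.single j 1) a"

lemma peval_superset:
  assumes "finite A" "Poly_Mapping.keys p \<subseteq> A"
  shows "peval p x = (\<Sum>m\<in>A.
      Poly_Mapping.lookup p m * (\<Prod>j\<in>UNIV. (x $ j) ^ Poly_Mapping.lookup m j))"
  unfolding peval_def using assms
  by (intro sum.mono_neutral_left) (auto simp: in_keys_iff)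

lemma peval_zero [simp]: "peval 0 x = 0"
  by (simp add: peval_def)

lemma peval_add: "peval (p + q) x = peval p x + peval q x"
proof -
  let ?A = "Poly_Mapping.keys p \<union> Poly_Mapping.keys q"
  have "Poly_Mapping.keys (p + q) \<subseteq> ?A"
    by (rule Poly_Mapping.keys_add)
  then show ?thesis
    by (simp add: peval_superset[of ?A] lookup_add distrib_right sum.distrib)
qed

lemma peval_sum: "peval (\<Sum>i\<in>I. f i) x = (\<Sum>i\<in>I. peval (f i) x)"
  by (induction I rule: infinite_finite_induct) (simp_all add: peval_add)

lemma peval_single:
  "peval (Poly_Mapping.single m a) x = a * (\<Prod>j\<in>UNIV. (x $ j) ^ Poly_Mapping.lookup m j)"
  by (subst peval_superset[of "{m}"]) auto

lemma mpoly_eq_sum_singles: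
  fixes p :: "('v, 'a::comm_monoid_add) mpoly"
  shows "p = (\<Sum>m\<in>Poly_Mapping.keys p. Poly_Mapping.single m (Poly_Mapping.lookup p m))"
  by (rule poly_mapping_eqI)
    (auto simp: lookup_sum lookup_single when_def in_keys_iff sum.delta')

lemma peval_one [simp]: "peval 1 x = 1"
  using peval_single[of 0 1 x] by simp

lemma peval_mult: "peval (p * q) x = peval p x * peval q x"
proof -
  let ?s = "\<lambda>r m. Poly_Mapping.single m (Poly_Mapping.lookup r m)"
  have "p * q = (\<Sum>m\<in>Poly_Mapping.keys p. \<Sum>k\<in>Poly_Mapping.keys q. ?s p m * ?s q k)"
    by (subst mpoly_eq_sum_singles[of p], subst mpoly_eq_sum_singles[of q])
      (simp add: sum_product)
  also have "peval \<dots> x =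
      (\<Sum>m\<in>Poly_Mapping.keys p. \<Sum>k\<in>Poly_Mapping.keys q. peval (?s p m) x * peval (?s q k) x)"
    by (simp add: peval_sum peval_single mult_single lookup_add power_add prod.distrib ac_simps)
  also have "\<dots> = peval (\<Sum>m\<in>Poly_Mapping.keys p. ?s p m) x
                * peval (\<Sum>k\<in>Poly_Mapping.keys q. ?s q k) x"
    by (simp add: peval_sum sum_product)
  finally show ?thesis
    by (simp add: mpoly_eq_sum_singles[symmetric])
qed


section \<open>The \<open>K\<close>-Zariski topology on complex affine space\<close>

definition zeros :: "('v::finite, complex) mpoly set \<Rightarrow> (complex ^ 'v) set" where
  "zeros F = {x. \<forall>p\<in>F. peval p x = 0}"

definition polys_over :: "complex set \<Rightarrow> ('v, complex) mpoly set" where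
  "polys_over K = {p. \<forall>m. Poly_Mapping.lookup p m \<in> K}"

text \<open>Closed sets are the sets of \<^emph>\<open>complex\<close> common zeros of polynomials with coefficients in the
  subring \<open>K\<close>; \<open>K = UNIV\<close> is the usual Zariski topology, and \<open>K = \<real>\<close> is the coarser one whose closed
  sets are the algebraic sets defined over the reals.\<close>

definition zariski :: "complex set \<Rightarrow> (complex ^ 'v::finite) topology" where
  "zariski K = topology (\<lambda>U. \<exists>F. F \<subseteq> polys_over K \<and> U = - zeros F)"

lemma polys_over_mult:
  assumes K: "0 \<in> K" "\<And>a b. a \<in> K \<Longrightarrow> b \<in> K \<Longrightarrow> a + b \<in> K" "\<And>a b. a \<in> K \<Longrightarrow> b \<in> K \<Longrightarrow> a * b \<in> K"
    and "p \<in> polys_over K" "q \<in> polys_over K"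
  shows "p * q \<in> polys_over K"
proof -
  have sumK: "(\<Sum>i\<in>I. f i) \<in> K" if "\<And>i. i \<in> I \<Longrightarrow> f i \<in> K" for I and f :: "'b \<Rightarrow> complex"
    using that by (induction I rule: infinite_finite_induct) (auto intro: K)
  have "Poly_Mapping.lookup (p * q) m \<in> K" for m
    using assms(4,5)
    by (auto simp: lookup_mult Sum_any.expand_set when_def polys_over_def intro!: sumK K)
  then show ?thesis
    by (simp add: polys_over_def)
qed

lemma istopology_zariski:
  assumes K: "0 \<in> K" "\<And>a b. a \<in> K \<Longrightarrow> b \<in> K \<Longrightarrow> a + b \<in> K" "\<And>a b. a \<in> K \<Longrightarrow> b \<in> K \<Longrightarrow> a * b \<in> K"
  shows "istopology (\<lambda>U :: (complex ^ 'v::finite) set. \<exists>F. F \<subseteq> polys_over K \<and> U = - zeros F)"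
  unfolding istopology_def
proof (intro conjI allI impI)
  fix S T :: "(complex ^ 'v) set"
  assume "\<exists>F. F \<subseteq> polys_over K \<and> S = - zeros F" "\<exists>F. F \<subseteq> polys_over K \<and> T = - zeros F"
  then obtain F H where FH: "F \<subseteq> polys_over K" "S = - zeros F" "H \<subseteq> polys_over K" "T = - zeros H"
    by blast
  let ?P = "{p * q | p q. p \<in> F \<and> q \<in> H}"
  have "?P \<subseteq> polys_over K"
    using FH polys_over_mult[OF K] by auto
  moreover have "S \<inter> T = - zeros ?P"
    unfolding FH zeros_def by (auto simp: peval_mult; metis peval_mult mult_eq_0_iff)
  ultimately show "\<exists>F. F \<subseteq> polys_over K \<and> S \<inter> T = - zeros F"
    by blast
next
  fix \<K> :: "(complex ^ 'v) set set"
  assume "\<forall>U\<in>\<K>. \<exists>F. F \<subseteq> polys_over K \<and> U = - zeros F"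
  then obtain F where F: "\<And>U. U \<in> \<K> \<Longrightarrow> F U \<subseteq> polys_over K \<and> U = - zeros (F U)"
    by metis
  have "\<Union>\<K> = (\<Union>U\<in>\<K>. - zeros (F U))"
    using F by auto
  also have "\<dots> = - zeros (\<Union>U\<in>\<K>. F U)"
    by (auto simp: zeros_def)
  finally show "\<exists>F. F \<subseteq> polys_over K \<and> \<Union>\<K> = - zeros F"
    using F by (intro exI[of _ "\<Union>U\<in>\<K>. F U"]) auto
qed

lemma openin_zariski:
  fixes U :: "(complex ^ 'v::finite) set"
  assumes "K = UNIV \<or> K = \<real>"
  shows "openin (zariski K) U \<longleftrightarrow> (\<exists>F. F \<subseteq> polys_over K \<and> U = - zeros F)"
proof -
  have "istopology (\<lambda>U :: (complex ^ 'v) set. \<exists>F. F \<subseteq> polys_over K \<and> U = - zeros F)"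
    using assms by (intro istopology_zariski) auto
  then show ?thesis
    by (simp add: zariski_def)
qed

lemma closedin_zariski:
  fixes C :: "(complex ^ 'v::finite) set"
  assumes "K = UNIV \<or> K = \<real>"
  shows "closedin (zariski K) C \<longleftrightarrow> (\<exists>F. F \<subseteq> polys_over K \<and> C = zeros F)"
proof -
  have "openin (zariski K) (UNIV :: (complex ^ 'v) set)"
    unfolding openin_zariski[OF assms]
    using assms by (intro exI[of _ "{1}"])
      (auto simp: zeros_def polys_over_def lookup_one when_def)
  then have "topspace (zariski K) = (UNIV :: (complex ^ 'v) set)"
    by (metis openin_subset top.extremum_uniqueI)
  then show ?thesis
    by (simp add: closedin_def openin_zariski[OF assms] Compl_eq_Diff_UNIV[symmetric])
qed

text \<open>Irreducible subsets and components of a subset \<open>A\<close> (in its subspace topology).\<close>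

definition irreducible_in :: "'a topology \<Rightarrow> 'a set \<Rightarrow> bool" where
  "irreducible_in T A \<longleftrightarrow> A \<subseteq> topspace T \<and> A \<noteq> {} \<and>
    (\<forall>C D. closedin T C \<and> closedin T D \<and> A \<subseteq> C \<union> D \<longrightarrow> A \<subseteq> C \<or> A \<subseteq> D)"

definition irreducible_components :: "'a topology \<Rightarrow> 'a set \<Rightarrow> 'a set set" where
  "irreducible_components T A = {C. C \<subseteq> A \<and> irreducible_in T C \<and>
    (\<forall>D. irreducible_in T D \<and> C \<subseteq> D \<and> D \<subseteq> A \<longrightarrow> D = C)}"

text \<open>Codimension of an irreducible closed set: the supremum of the lengths of strictly increasing
  chains of irreducible closed sets starting from it.\<close>

definition codimension :: "'a topology \<Rightarrow> 'a set \<Rightarrow> enat" where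
  "codimension T C = Sup {enat m | m. \<exists>Z. Z 0 = C \<and>
    (\<forall>i\<le>m. closedin T (Z i) \<and> irreducible_in T (Z i)) \<and> (\<forall>i<m. Z i \<subset> Z (Suc i))}"

definition codim_one_part :: "(complex ^ 'v::finite) set \<Rightarrow> (complex ^ 'v) set" where
  "codim_one_part S =
    \<Union>{C \<in> irreducible_components (zariski UNIV) S. codimension (zariski UNIV) C = 1}"


section \<open>Linear algebraic groups and rational representations\<close>

definition mat_entries :: "'a ^ 'm ^ 'm \<Rightarrow> 'a ^ ('m \<times> 'm)" where
  "mat_entries g = (\<chi> p. g $ fst p $ snd p)"

definition GL :: "(complex ^ 'm ^ 'm::finite) set" where
  "GL = {g. invertible g}"

definition closed_in_GL :: "complex set \<Rightarrow> (complex ^ 'm ^ 'm::finite) set \<Rightarrow> bool" where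
  "closed_in_GL K G \<longleftrightarrow> (\<exists>A. closedin (zariski K) A \<and> G = {g \<in> GL. mat_entries g \<in> A})"

definition linear_algebraic_group :: "(complex ^ 'm ^ 'm::finite) set \<Rightarrow> bool" where
  "linear_algebraic_group G \<longleftrightarrow> closed_in_GL UNIV G \<and> mat 1 \<in> G \<and>
    (\<forall>g\<in>G. \<forall>h\<in>G. g ** h \<in> G) \<and> (\<forall>g\<in>G. matrix_inv g \<in> G)"

definition zariski_connected :: "(complex ^ 'm ^ 'm::finite) set \<Rightarrow> bool" where
  "zariski_connected G \<longleftrightarrow> connectedin (zariski UNIV) (mat_entries ` G)"

definition unipotent :: "complex ^ 'm ^ 'm::finite \<Rightarrow> bool" where
  "unipotent g \<longleftrightarrow> (\<exists>k. (((**) (g - mat 1)) ^^ k) (mat 1) = 0)"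

text \<open>Reductive: the unipotent radical (the largest closed connected normal unipotent subgroup) is
  trivial.\<close>

definition reductive :: "(complex ^ 'm ^ 'm::finite) set \<Rightarrow> bool" where
  "reductive G \<longleftrightarrow> linear_algebraic_group G \<and>
    (\<forall>U. linear_algebraic_group U \<and> U \<subseteq> G \<and> zariski_connected U \<and> (\<forall>u\<in>U. unipotent u) \<and>
        (\<forall>g\<in>G. \<forall>u\<in>U. g ** u ** matrix_inv g \<in> U) \<longrightarrow> U = {mat 1})"

text \<open>A rational representation of \<open>G\<close> on complex column vectors whose matrix entries are
  regular functions on \<open>G\<close> defined over \<open>K\<close>, i.e. given by polynomials over \<open>K\<close> in the entries of
  \<open>g\<close> divided by powers of \<open>det g\<close>.\<close>

definition rational_representation ::
  "complex set \<Rightarrow> (complex ^ 'm ^ 'm::finite) set \<Rightarrow> (complex ^ 'm ^ 'm \<Rightarrow> complex ^ 'n ^ 'n::finite) \<Rightarrow> bool"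
  where
  "rational_representation K G \<rho> \<longleftrightarrow> \<rho> (mat 1) = mat 1 \<and>
    (\<forall>g\<in>G. \<forall>h\<in>G. \<rho> (g ** h) = \<rho> g ** \<rho> h) \<and>
    (\<forall>i j. \<exists>q\<in>polys_over K. \<exists>k. \<forall>g\<in>G. \<rho> g $ i $ j = peval q (mat_entries g) / det g ^ k)"


section \<open>Reductive prehomogeneous vector spaces over the reals\<close>

text \<open>Here \<open>V\<close> is \<open>complex ^ 'n\<close> with real structure \<open>real ^ 'n\<close> given by the chosen basis, and the
  algebraic group is realised as a closed subgroup of some \<open>GL\<close>. In characteristic zero a closed
  subgroup of \<open>GL\<close> is defined over the reals iff it is cut out by real polynomials.
  The last conjunct says that the group of real points of \<open>\<rho>(G)\<close> is self-adjoint.\<close>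

definition reductive_pv_over_R ::
  "(complex ^ 'm ^ 'm::finite) set \<Rightarrow> (complex ^ 'm ^ 'm \<Rightarrow> complex ^ 'n ^ 'n::finite)
    \<Rightarrow> (complex ^ 'n) set \<Rightarrow> bool" where
  "reductive_pv_over_R G \<rho> S \<longleftrightarrow>
    reductive G \<and> zariski_connected G \<and> closed_in_GL \<real> G \<and>
    rational_representation \<real> G \<rho> \<and>
    closedin (zariski UNIV) S \<and> S \<noteq> UNIV \<and>
    (\<exists>x0. - S = (\<lambda>g. \<rho> g *v x0) ` G) \<and>
    codim_one_part S \<noteq> {} \<and>
    (\<forall>h \<in> \<rho> ` G. (\<forall>i j. h $ i $ j \<in> \<real>) \<longrightarrow> transpose h \<in> \<rho> ` G)"

definition basic_relative_invariants ::
  "(complex ^ 'n::finite) set \<Rightarrow> ('r::finite \<Rightarrow> ('n, real) mpoly) \<Rightarrow> bool" where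
  "basic_relative_invariants S P \<longleftrightarrow> (\<forall>k. irreducible (P k)) \<and>
    bij_betw (\<lambda>k. zeros {cpoly (P k)}) UNIV
      (irreducible_components (zariski \<real>) (codim_one_part S))"


section \<open>\<open>b\<close>-functions\<close>

definition pderivative :: "'n \<Rightarrow> (real ^ 'n::finite \<Rightarrow> complex) \<Rightarrow> real ^ 'n \<Rightarrow> complex" where
  "pderivative i f = (\<lambda>x. vector_derivative (\<lambda>t. f (x + t *\<^sub>R axis i 1)) (at 0))"

definition monom_grad ::
  "('n \<Rightarrow>\<^sub>0 nat) \<Rightarrow> (real ^ 'n::{finite,linorder} \<Rightarrow> complex) \<Rightarrow> real ^ 'n::{finite,linorder} \<Rightarrow> complex" where
  "monom_grad m = foldr (\<lambda>i. pderivative i ^^ Poly_Mapping.lookup m i) (sorted_list_of_set UNIV)"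

text \<open>\<open>p(grad\<^sub>x) f\<close>. The order of differentiation chosen in \<open>monom_grad\<close> is immaterial where \<open>f\<close> is
  smooth.\<close>

definition poly_grad ::
  "('n, real) mpoly \<Rightarrow> (real ^ 'n::{finite,linorder} \<Rightarrow> complex) \<Rightarrow> real ^ 'n::{finite,linorder} \<Rightarrow> complex" where
  "poly_grad p f = (\<lambda>x. \<Sum>m\<in>Poly_Mapping.keys p.
      of_real (Poly_Mapping.lookup p m) * monom_grad m f x)"

text \<open>\<open>P\<^sub>1(x)\<^bsup>s\<^sub>1\<^esup> \<dots> P\<^sub>r(x)\<^bsup>s\<^sub>r\<^esup>\<close> at real \<open>x\<close>, with principal powers. Since each \<open>P\<^sub>k\<close> is real-valued and
  hence of locally constant sign where it does not vanish, this is smooth on the set of real \<open>x\<close>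
  with all \<open>P\<^sub>k(x) \<noteq> 0\<close>. Another branch of the logarithms multiplies both sides of the defining
  identity of the \<open>b\<close>-functions by the same constant.\<close>

definition complex_power ::
  "('r::finite \<Rightarrow> ('n::finite, real) mpoly) \<Rightarrow> complex ^ 'r \<Rightarrow> real ^ 'n \<Rightarrow> complex" where
  "complex_power P s x = (\<Prod>k\<in>UNIV. complex_of_real (peval (P k) x) powr (s $ k))"

definition b_functions ::
  "('r::finite \<Rightarrow> ('n::{finite,linorder}, real) mpoly)
    \<Rightarrow> (('r \<Rightarrow> nat) \<Rightarrow> ('r, complex) mpoly) \<Rightarrow> bool" where
  "b_functions P b \<longleftrightarrow> (\<forall>m s x. (\<forall>k. peval (P k) x \<noteq> 0) \<longrightarrow>
    poly_grad (\<Prod>k\<in>UNIV. P k ^ m k) (complex_power P (\<chi> k. s $ k + of_nat (m k))) x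
      = peval (b m) s * complex_power P s x)"

definition linform :: "('r::finite \<Rightarrow> nat) \<Rightarrow> complex ^ 'r \<Rightarrow> complex" where
  "linform \<mu> s = (\<Sum>k\<in>UNIV. of_nat (\<mu> k) * s $ k)"

text \<open>A fixed Ore--Sato expression of the \<open>b\<close>-functions, with the linear forms indexed by \<open>i < l\<close>.
  As the expression is an identity of rational functions in \<open>s\<close> (some exponents \<open>z i j\<close> may be
  negative), it is stated at those \<open>s\<close> where no factor with negative exponent vanishes.
  The last conjunct is Kashiwara's theorem.\<close>

definition ore_sato_data ::
  "(('r::finite \<Rightarrow> nat) \<Rightarrow> ('r, complex) mpoly) \<Rightarrow> ('r \<Rightarrow> real) \<Rightarrow> nat \<Rightarrow> (nat \<Rightarrow> 'r \<Rightarrow> nat)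
    \<Rightarrow> (nat \<Rightarrow> complex) \<Rightarrow> (nat \<Rightarrow> int \<Rightarrow> int) \<Rightarrow> bool" where
  "ore_sato_data b c l \<mu> \<alpha> z \<longleftrightarrow>
    (\<forall>k. c k > 0) \<and>
    (\<forall>i<l. (\<exists>k. \<mu> i k \<noteq> 0) \<and> Gcd {\<mu> i k | k. \<mu> i k \<noteq> 0} = 1) \<and>
    (\<forall>i<l. finite {j. z i j \<noteq> 0} \<and> (\<Sum>j | z i j \<noteq> 0. z i j) > 0 \<and>
        z i (Min {j. z i j \<noteq> 0}) > 0 \<and> z i (Max {j. z i j \<noteq> 0}) > 0) \<and>
    (\<forall>i<l. \<forall>i'<l. i \<noteq> i' \<longrightarrow>
        \<not> (\<exists>m :: int ^ 'r. \<forall>s. linform (\<mu> i) (\<chi> k. s $ k + of_int (m $ k)) + \<alpha> i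
                             = linform (\<mu> i') s + \<alpha> i')) \<and>
    (\<forall>m s. m \<noteq> (\<lambda>k. 0) \<and>
        (\<forall>i<l. \<forall>j. \<forall>\<nu> < (\<Sum>k\<in>UNIV. \<mu> i k * m k).
            z i j < 0 \<longrightarrow> linform (\<mu> i) s + \<alpha> i + of_int j + of_nat \<nu> \<noteq> 0) \<longrightarrow>
        peval (b m) s = (\<Prod>k\<in>UNIV. of_real (c k) ^ m k) *
          (\<Prod>i<l. \<Prod>j | z i j \<noteq> 0. \<Prod>\<nu> < (\<Sum>k\<in>UNIV. \<mu> i k * m k).
            (linform (\<mu> i) s + \<alpha> i + of_int j + of_nat \<nu>) powi z i j)) \<and>
    (\<forall>i<l. \<forall>j. z i j > 0 \<longrightarrow> (\<exists>q::rat. q > 0 \<and> \<alpha> i + of_int j = of_rat q))"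


section \<open>The zeta integral\<close>

definition zeta_integrand ::
  "('r::finite \<Rightarrow> ('n::finite, real) mpoly) \<Rightarrow> complex ^ 'r \<Rightarrow> real ^ 'n \<Rightarrow> complex" where
  "zeta_integrand P s x =
    (\<Prod>k\<in>UNIV. complex_of_real \<bar>peval (P k) x\<bar> powr (s $ k)) * of_real (exp (- pi * (x \<bullet> x)))"

definition zeta_R ::
  "('r::finite \<Rightarrow> ('n::finite, real) mpoly) \<Rightarrow> complex ^ 'r \<Rightarrow> complex" where
  "zeta_R P s = (LINT x|lborel. zeta_integrand P s x)"

definition right_domain :: "(complex ^ 'r::finite) set" where
  "right_domain = {s. \<forall>k. Re (s $ k) > 0}"

text \<open>Holomorphic functions of several complex variables on an open set: the Frechet derivative
  exists and is complex linear.\<close>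

definition mv_holomorphic_on ::
  "(complex ^ 'r::finite \<Rightarrow> complex) \<Rightarrow> (complex ^ 'r) set \<Rightarrow> bool" where
  "mv_holomorphic_on f D \<longleftrightarrow> (\<forall>s\<in>D. \<exists>f'. (f has_derivative f') (at s) \<and>
    (\<forall>a v. f' (a *s v) = a * f' v))"

text \<open>Meromorphic on all of \<open>complex ^ 'r\<close>: locally a quotient \<open>g / h\<close> of holomorphic functions with
  \<open>h\<close> not vanishing identically on any nonempty open set. The value of \<open>f\<close> at zeros of \<open>h\<close> is
  arbitrary.\<close>

definition mv_meromorphic :: "(complex ^ 'r::finite \<Rightarrow> complex) \<Rightarrow> bool" where
  "mv_meromorphic f \<longleftrightarrow> (\<forall>a. \<exists>W g h. open W \<and> a \<in> W \<and>
    mv_holomorphic_on g W \<and> mv_holomorphic_on h W \<and>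
    (\<forall>U. open U \<and> U \<noteq> {} \<and> U \<subseteq> W \<longrightarrow> (\<exists>s\<in>U. h s \<noteq> 0)) \<and>
    (\<forall>s\<in>W. h s \<noteq> 0 \<longrightarrow> f s = g s / h s))"

end

theory Submission
  imports Defs "HOL-Probability.Distributions" "HOL-Complex_Analysis.Complex_Analysis" "HOL-Real_Asymp.Real_Asymp"
begin

text \<open>Write \<open>Z\<close> for the integral and \<open>\<Gamma>\<close>-side for the claimed product. The formula is an analogue of the
  Bohr--Mollerup theorem: both sides satisfy the same functional equation under \<open>s\<^sub>k \<mapsto> s\<^sub>k + 2\<close>,
  \<open>Z\<close> is logarithmically convex on the real points, and both sides tend to \<open>1\<close> at \<open>s = 0\<close>.

  The functional equation is where multilinearity enters. A squarefree monomial differentiates the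
  Gaussian at most once in each variable, so \<open>P\<^sub>k(grad)\<close> maps \<open>exp (-\<pi>|x|\<^sup>2)\<close> to
  \<open>(-2\<pi>)\<^bsup>d\<^sub>k\<^esup> P\<^sub>k(x) exp (-\<pi>|x|\<^sup>2)\<close>. Integrating \<open>|P|\<^sup>s P\<^sub>k \<cdot> P\<^sub>k exp (-\<pi>|x|\<^sup>2)\<close> by parts therefore gives
  \<open>Z(s + 2e\<^sub>k) = (2\<pi>)\<^bsup>-d\<^sub>k\<^esup> b\<^sub>k(s) Z(s)\<close>, where \<open>b\<^sub>k\<close> is the \<open>b\<close>-function of the unit vector \<open>e\<^sub>k\<close>
  (\<open>zeta_functional_equation\<close>).

  For the \<open>\<Gamma>\<close>-side to satisfy this equation, two facts about the Ore--Sato expression are needed.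
  First, every coefficient of every \<open>\<mu>\<^sub>i\<close> is \<open>0\<close> or \<open>1\<close> (\<open>\<mu>_le_1\<close>): shifting by \<open>2e\<^sub>k\<close> and by
  \<open>2e\<^sub>k\<^sub>'\<close> in both orders gives \<open>b\<^sub>k(s + 2e\<^sub>k\<^sub>') b\<^sub>k\<^sub>'(s) = b\<^sub>k\<^sub>'(s + 2e\<^sub>k) b\<^sub>k(s)\<close>, and comparing the first zero
  that does not cancel shows that two nonzero coefficients of \<open>\<mu>\<^sub>i\<close> are equal; since their greatest
  common divisor is \<open>1\<close>, they are \<open>1\<close>. Second, the degree of \<open>b\<^sub>k\<close> in \<open>s\<^sub>k\<close> is \<open>d\<^sub>k\<close>
  (\<open>gamma_degree_eq_degree\<close>): by homogeneity of \<open>P\<^sub>k\<close>, \<open>Z(s + 2N e\<^sub>k)\<close> is \<open>N!\<^bsup>d\<^sub>k\<^esup>\<close> up to geometric factors,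
  whereas the functional equation makes it \<open>N!\<close> to the power \<open>deg b\<^sub>k\<close>.

  Hence the quotient \<open>Z / \<Gamma>\<close>-side is \<open>2\<close>-periodic in each real variable. Far out the \<open>\<Gamma>\<close>-side is
  asymptotically an exponential function of the increment, so the quotient inherits logarithmic
  convexity from \<open>Z\<close>; a periodic convex function is constant (\<open>real_zeta_eq_const_R\<close>). The identity
  theorem along complex lines extends this to the domain \<open>Re s\<^sub>k > 0\<close>, and \<open>s \<rightarrow> 0\<close> shows that the
  constant is \<open>1\<close> (\<open>zeta_R_eq_rhs\<close>). The \<open>\<Gamma>\<close>-side is visibly meromorphic on the whole space.\<close>

section \<open>Gaussian integrals and functions of polynomial growth\<close>

lemma gaussian_nn_integral_1:
  assumes "a > 0"
  shows "(\<integral>\<^sup>+(x::real). ennreal (exp (- (a * x\<^sup>2))) \<partial>lborel) = ennreal (sqrt (pi / a))"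
proof -
  let ?\<sigma> = "sqrt (1 / (2 * a))"
  have \<sigma>: "?\<sigma>\<^sup>2 = 1 / (2 * a)" "0 < ?\<sigma>" using assms by simp_all
  have "exp (- (a * x\<^sup>2)) = sqrt (pi / a) * normal_density 0 ?\<sigma> x" for x
    using assms unfolding normal_density_def \<sigma>(1) by (simp add: field_simps real_sqrt_divide)
  then have "(\<integral>\<^sup>+(x::real). ennreal (exp (- (a * x\<^sup>2))) \<partial>lborel) =
      (\<integral>\<^sup>+x. ennreal (sqrt (pi / a)) * ennreal (normal_density 0 ?\<sigma> x) \<partial>lborel)"
    using assms by (simp add: ennreal_mult' )
  also have "\<dots> = ennreal (sqrt (pi / a)) * ennreal 1"
    by (subst nn_integral_cmult) (use \<sigma> in \<open>auto simp: nn_integral_eq_integral\<close>)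
  finally show ?thesis by simp
qed

lemma exp_norm_sq_eq_prod:
  "exp (- (a * (x \<bullet> x))) = (\<Prod>b\<in>Basis. exp (- (a * (x \<bullet> b)\<^sup>2)))" for x :: "'a::euclidean_space"
  by (subst euclidean_inner)
     (simp add: exp_sum[symmetric] sum_distrib_left sum_negf power2_eq_square)

lemma
  fixes a :: real
  assumes "a > 0"
  shows integrable_gaussian: "integrable lborel (\<lambda>x::'a::euclidean_space. exp (- (a * (x \<bullet> x))))"
    and integral_gaussian:
      "(LINT (x::'a)|lborel. exp (- (a * (x \<bullet> x)))) = sqrt (pi / a) ^ DIM('a)"
proof -
  have "(\<integral>\<^sup>+(x::'a). ennreal (exp (- (a * (x \<bullet> x)))) \<partial>lborel)
      = (\<integral>\<^sup>+(x::'a). (\<Prod>b\<in>Basis. ennreal (exp (- (a * (x \<bullet> b)\<^sup>2)))) \<partial>lborel)"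
    by (subst exp_norm_sq_eq_prod) (simp add: prod_ennreal)
  also have "\<dots> = (\<Prod>b\<in>(Basis :: 'a set). (\<integral>\<^sup>+y. ennreal (exp (- (a * y\<^sup>2))) \<partial>lborel))"
    by (rule nn_integral_lborel_prod) auto
  also have "\<dots> = ennreal (sqrt (pi / a) ^ DIM('a))"
    using assms by (simp add: gaussian_nn_integral_1 ennreal_power)
  finally have *: "(\<integral>\<^sup>+(x::'a). ennreal (exp (- (a * (x \<bullet> x)))) \<partial>lborel)
      = ennreal (sqrt (pi / a) ^ DIM('a))" .
  show "integrable lborel (\<lambda>x::'a. exp (- (a * (x \<bullet> x))))"
    by (rule integrableI_nonneg) (use * in \<open>auto\<close>)
  show "(LINT (x::'a)|lborel. exp (- (a * (x \<bullet> x)))) = sqrt (pi / a) ^ DIM('a)"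
    by (rule integral_eq_nn_integral[THEN trans]) (use * assms in auto)
qed

definition gauss :: "'a::real_inner \<Rightarrow> real" where
  "gauss x = exp (- pi * (x \<bullet> x))"

lemma gauss_pos [simp]: "gauss x > 0"
  by (simp add: gauss_def)

lemma gauss_measurable [measurable]: "gauss \<in> borel_measurable (borel :: 'a::euclidean_space measure)"
  unfolding gauss_def by measurable

lemma power_times_exp_bounded:
  fixes c :: real
  assumes "c > 0"
  shows "\<exists>C. \<forall>y\<ge>0. (1 + y) ^ N * exp (- (c * y\<^sup>2)) \<le> C"
proof -
  have "((\<lambda>y::real. (1 + y) ^ N * exp (- (c * y\<^sup>2))) \<longlongrightarrow> 0) at_top"
    using assms by real_asymp
  then have "\<forall>\<^sub>F y::real in at_top. (1 + y) ^ N * exp (- (c * y\<^sup>2)) < 1"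
    by (rule order_tendstoD) simp
  then obtain R where R: "\<And>y::real. y \<ge> R \<Longrightarrow> (1 + y) ^ N * exp (- (c * y\<^sup>2)) < 1"
    unfolding eventually_at_top_linorder by blast
  have "(1 + y) ^ N * exp (- (c * y\<^sup>2)) \<le> max 1 ((1 + R) ^ N)" if "y \<ge> 0" for y
  proof (cases "y \<ge> R")
    case False
    have "(1 + y) ^ N * exp (- (c * y\<^sup>2)) \<le> (1 + R) ^ N * 1"
      using that False assms by (intro mult_mono power_mono) auto
    then show ?thesis by simp
  qed (use R[of y] in auto)
  then show ?thesis by blast
qed

text \<open>All dominating functions below come from this class: after multiplication by the Gaussian its
  measurable members are integrable, and it is closed under the operations that build the integrands.\<close>

definition poly_growth :: "('a::real_normed_vector \<Rightarrow> real) \<Rightarrow> bool" where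
  "poly_growth f \<longleftrightarrow> (\<exists>C N. \<forall>x. \<bar>f x\<bar> \<le> C * (1 + norm x) ^ N)"

lemma poly_growthE:
  assumes "poly_growth f"
  obtains C N where "C > 0" "\<And>x. \<bar>f x\<bar> \<le> C * (1 + norm x) ^ N"
proof -
  from assms obtain C N where *: "\<And>x. \<bar>f x\<bar> \<le> C * (1 + norm x) ^ N"
    unfolding poly_growth_def by blast
  have "\<bar>f x\<bar> \<le> (\<bar>C\<bar> + 1) * (1 + norm x) ^ N" for x
    by (rule order_trans[OF *]) (intro mult_right_mono, auto)
  then show ?thesis using that[of "\<bar>C\<bar> + 1" N] by auto
qed

lemma poly_growth_mono:
  assumes "poly_growth g" "\<And>x. \<bar>f x\<bar> \<le> \<bar>g x\<bar>"
  shows "poly_growth f"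
  using assms unfolding poly_growth_def by (meson order_trans)

lemma poly_growth_const [intro]: "poly_growth (\<lambda>x. c)"
  unfolding poly_growth_def by (intro exI[of _ "\<bar>c\<bar>"] exI[of _ 0]) auto

lemma poly_growth_mult [intro]:
  assumes "poly_growth f" "poly_growth g"
  shows "poly_growth (\<lambda>x. f x * g x)"
proof -
  obtain C N where f: "C > 0" "\<And>x. \<bar>f x\<bar> \<le> C * (1 + norm x) ^ N"
    using poly_growthE[OF assms(1)] by blast
  obtain D M where g: "D > 0" "\<And>x. \<bar>g x\<bar> \<le> D * (1 + norm x) ^ M"
    using poly_growthE[OF assms(2)] by blast
  have "\<bar>f x * g x\<bar> \<le> (C * D) * (1 + norm x) ^ (N + M)" for x
    using mult_mono[OF f(2)[of x] g(2)[of x]] f(1)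
    by (simp add: abs_mult power_add mult_ac)
  then show ?thesis unfolding poly_growth_def by blast
qed

lemma poly_growth_add [intro]:
  assumes "poly_growth f" "poly_growth g"
  shows "poly_growth (\<lambda>x. f x + g x)"
proof -
  obtain C N where f: "C > 0" "\<And>x. \<bar>f x\<bar> \<le> C * (1 + norm x) ^ N"
    using poly_growthE[OF assms(1)] by blast
  obtain D M where g: "D > 0" "\<And>x. \<bar>g x\<bar> \<le> D * (1 + norm x) ^ M"
    using poly_growthE[OF assms(2)] by blast
  have "\<bar>f x + g x\<bar> \<le> (C + D) * (1 + norm x) ^ (N + M)" for x
  proof -
    have "C * (1 + norm x) ^ N \<le> C * (1 + norm x) ^ (N + M)"
      "D * (1 + norm x) ^ M \<le> D * (1 + norm x) ^ (N + M)"
      using f(1) g(1) by (intro mult_left_mono power_increasing; simp)+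
    then show ?thesis using f(2)[of x] g(2)[of x] by (simp add: distrib_right)
  qed
  then show ?thesis unfolding poly_growth_def by blast
qed

lemma poly_growth_prod [intro]:
  assumes "\<And>i. i \<in> I \<Longrightarrow> poly_growth (f i)"
  shows "poly_growth (\<lambda>x. \<Prod>i\<in>I. f i x)"
  using assms by (induction I rule: infinite_finite_induct) auto

lemma poly_growth_power [intro]:
  assumes "poly_growth f"
  shows "poly_growth (\<lambda>x. f x ^ n)"
  using assms by (induction n) auto

lemma poly_growth_abs [intro]: "poly_growth f \<Longrightarrow> poly_growth (\<lambda>x. \<bar>f x\<bar>)"
  by (erule poly_growth_mono) auto

lemma poly_growth_polynomial:
  assumes "real_polynomial_function p"
  shows "poly_growth p"
  using assms
proof induction
  case (linear f)
  then obtain K where "\<And>x. norm (f x) \<le> norm x * K"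
    using bounded_linear.bounded by blast
  moreover have "norm x * K \<le> \<bar>K\<bar> * (1 + norm x) ^ 1" for x :: 'a
    by (simp add: distrib_left) (metis abs_ge_self add.commute add_increasing2 abs_ge_zero mult.commute mult_left_mono norm_ge_zero)
  ultimately have "\<bar>f x\<bar> \<le> \<bar>K\<bar> * (1 + norm x) ^ 1" for x
    by (metis order_trans real_norm_def)
  then show ?case unfolding poly_growth_def by blast
qed auto

text \<open>Part of the Gaussian decay absorbs the polynomial factor. Keeping \<open>exp (-x \<bullet> x)\<close> in reserve
  gives a bound of one fixed integrable shape.\<close>

lemma poly_growth_gauss_bound:
  fixes f :: "'a::real_inner \<Rightarrow> real"
  assumes "poly_growth f" "a > 1"
  obtains C where "C > 0" "\<And>x. \<bar>f x\<bar> * exp (- (a * (x \<bullet> x))) \<le> C * exp (- (x \<bullet> x))"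
proof -
  obtain C N where C: "C > 0" "\<And>x. \<bar>f x\<bar> \<le> C * (1 + norm x) ^ N"
    using poly_growthE[OF assms(1)] by blast
  obtain D where D: "\<And>y. y \<ge> 0 \<Longrightarrow> (1 + y) ^ N * exp (- ((a - 1) * y\<^sup>2)) \<le> D"
    using power_times_exp_bounded[of "a - 1" N] assms(2) by auto
  have "\<bar>f x\<bar> * exp (- (a * (x \<bullet> x))) \<le> (C * \<bar>D\<bar> + 1) * exp (- (x \<bullet> x))" for x
  proof -
    have "\<bar>f x\<bar> * exp (- (a * (x \<bullet> x))) \<le> C * (1 + norm x) ^ N * exp (- (a * (x \<bullet> x)))"
      using C by (intro mult_right_mono) auto
    also have "\<dots> = C * ((1 + norm x) ^ N * exp (- ((a - 1) * (norm x)\<^sup>2))) * exp (- (x \<bullet> x))"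
      by (simp add: power2_norm_eq_inner exp_add[symmetric] algebra_simps)
    also have "\<dots> \<le> C * \<bar>D\<bar> * exp (- (x \<bullet> x))"
      using C(1) D[of "norm x"] by (intro mult_right_mono mult_left_mono) auto
    also have "\<dots> \<le> (C * \<bar>D\<bar> + 1) * exp (- (x \<bullet> x))"
      by (intro mult_right_mono) auto
    finally show ?thesis .
  qed
  moreover have "C * \<bar>D\<bar> + 1 > 0" using C(1) by (simp add: add_nonneg_pos)
  ultimately show ?thesis using that by blast
qed

lemma integrable_poly_growth_exp:
  fixes f :: "'a::euclidean_space \<Rightarrow> real"
  assumes "poly_growth f" "f \<in> borel_measurable borel" "a > 1"
  shows "integrable lborel (\<lambda>x. f x * exp (- (a * (x \<bullet> x))))"
proof -
  obtain C where C: "C > 0" "\<And>x. \<bar>f x\<bar> * exp (- (a * (x \<bullet> x))) \<le> C * exp (- (x \<bullet> x))"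
    using assms(1,3) by (rule poly_growth_gauss_bound) blast
  show ?thesis
  proof (rule Bochner_Integration.integrable_bound)
    show "integrable lborel (\<lambda>x::'a. C * exp (- (x \<bullet> x)))"
      using integrable_gaussian[of 1, where 'a='a] by simp
    show "(\<lambda>x. f x * exp (- (a * (x \<bullet> x)))) \<in> borel_measurable lborel"
      using assms(2) by simp
    show "AE x in lborel. norm (f x * exp (- (a * (x \<bullet> x)))) \<le> norm (C * exp (- (x \<bullet> x)))"
      using C by (auto simp: abs_mult)
  qed
qed

lemma integrable_poly_growth:
  fixes f :: "'a::euclidean_space \<Rightarrow> real"
  assumes "poly_growth f" "f \<in> borel_measurable borel"
  shows "integrable lborel (\<lambda>x. f x * gauss x)"
  using integrable_poly_growth_exp[OF assms, of pi] pi_gt3 by (simp add: gauss_def)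

lemma integral_gauss: "(LINT (x::'a::euclidean_space)|lborel. gauss x) = 1"
  using integral_gaussian[of pi, where 'a='a] by (simp add: gauss_def)

section \<open>Integration by parts against the Gaussian\<close>

lemma real_polynomial_dir_derivative:
  fixes p :: "'a::real_normed_vector \<Rightarrow> real"
  assumes "real_polynomial_function p"
  shows "\<exists>p'. real_polynomial_function p' \<and>
    (\<forall>x. ((\<lambda>\<tau>. p (x + \<tau> *\<^sub>R v)) has_real_derivative p' x) (at 0))"
  using assms
proof induction
  case (linear f)
  interpret bounded_linear f by fact
  have "((\<lambda>\<tau>. f (x + \<tau> *\<^sub>R v)) has_real_derivative f v) (at 0)" for x
    unfolding add scaleR by (auto intro!: derivative_eq_intros)
  then show ?case by blast
next
  case (const c)
  show ?case by (intro exI[of _ "\<lambda>x. 0"]) auto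
next
  case (add f g)
  then obtain f' g' where *: "real_polynomial_function f'" "real_polynomial_function g'"
    "\<And>x. ((\<lambda>\<tau>. f (x + \<tau> *\<^sub>R v)) has_real_derivative f' x) (at 0)"
    "\<And>x. ((\<lambda>\<tau>. g (x + \<tau> *\<^sub>R v)) has_real_derivative g' x) (at 0)" by blast
  then show ?case
    by (intro exI[of _ "\<lambda>x. f' x + g' x"]) (auto intro!: derivative_eq_intros)
next
  case (mult f g)
  then obtain f' g' where *: "real_polynomial_function f'" "real_polynomial_function g'"
    "\<And>x. ((\<lambda>\<tau>. f (x + \<tau> *\<^sub>R v)) has_real_derivative f' x) (at 0)"
    "\<And>x. ((\<lambda>\<tau>. g (x + \<tau> *\<^sub>R v)) has_real_derivative g' x) (at 0)" by blast
  have "((\<lambda>\<tau>. f (x + \<tau> *\<^sub>R v) * g (x + \<tau> *\<^sub>R v)) has_real_derivative f' x * g x + g' x * f x) (at 0)" for x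
    using DERIV_mult[OF *(3,4)] by simp
  then show ?case
    using mult.hyps * by (intro exI[of _ "\<lambda>x. f' x * g x + g' x * f x"]) auto
qed

lemma DERIV_line_at:
  fixes f :: "'a::real_vector \<Rightarrow> real"
  assumes "\<And>x. ((\<lambda>\<tau>. f (x + \<tau> *\<^sub>R v)) has_real_derivative f' x) (at 0)"
  shows "((\<lambda>\<tau>. f (x + \<tau> *\<^sub>R v)) has_real_derivative f' (x + t *\<^sub>R v)) (at t)"
proof -
  have "((\<lambda>\<tau>. f ((x + t *\<^sub>R v) + \<tau> *\<^sub>R v)) has_real_derivative f' (x + t *\<^sub>R v)) (at 0)"
    by (rule assms)
  also have "(\<lambda>\<tau>. f ((x + t *\<^sub>R v) + \<tau> *\<^sub>R v)) = (\<lambda>\<tau>. f (x + (\<tau> + t) *\<^sub>R v))"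
    by (simp add: scaleR_left_distrib add_ac)
  finally show ?thesis
    using DERIV_shift[of "\<lambda>\<tau>. f (x + \<tau> *\<^sub>R v)" "f' (x + t *\<^sub>R v)" 0 t] by (simp add: add.commute)
qed

text \<open>The derivative is written with \<open>u \<cdot> |u|\<^bsup>t-2\<^esup>\<close> instead of \<open>sgn u \<cdot> |u|\<^bsup>t-1\<^esup>\<close>, so that no sign function
  appears and the formula makes sense at \<open>u = 0\<close>.\<close>

lemma DERIV_abs_powr:
  fixes u :: real
  assumes "t > 2"
  shows "((\<lambda>u. \<bar>u\<bar> powr t) has_real_derivative t * u * \<bar>u\<bar> powr (t - 2)) (at u)"
proof (cases "u = 0")
  case True
  have "((\<lambda>h. \<bar>h\<bar> powr t / h) \<longlongrightarrow> 0) (at (0::real))"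
  proof (rule Lim_null_comparison)
    show "\<forall>\<^sub>F h in at 0. norm (\<bar>h\<bar> powr t / h) \<le> \<bar>h\<bar> powr (t - 1)"
      by (auto simp: eventually_at powr_diff intro!: exI[of _ 1])
    have "((\<lambda>h::real. \<bar>h\<bar> powr (t - 1)) \<longlongrightarrow> \<bar>0\<bar> powr (t - 1)) (at 0)"
      using assms by (intro tendsto_intros) (auto simp: eventually_at intro!: exI[of _ 1])
    then show "((\<lambda>h::real. \<bar>h\<bar> powr (t - 1)) \<longlongrightarrow> 0) (at 0)" by simp
  qed
  then show ?thesis
    using True by (simp add: has_field_derivative_iff)
next
  case False
  have "((\<lambda>u. \<bar>u\<bar> powr t) has_real_derivative t * \<bar>u\<bar> powr (t - 1) * sgn u) (at u)"
  proof (cases "u > 0")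
    case True
    have "((\<lambda>u. u powr t) has_real_derivative t * \<bar>u\<bar> powr (t - 1) * sgn u) (at u)"
      using has_real_derivative_powr[OF True, of t] True by simp
    then show ?thesis
      by (rule DERIV_cong_ev[THEN iffD1, rotated 3])
         (use True eventually_nhds_in_open[of "{0<..}" u] in \<open>auto elim: eventually_mono\<close>)
  next
    case nonpos: False
    have "((\<lambda>u. (- u) powr t) has_real_derivative t * \<bar>u\<bar> powr (t - 1) * sgn u) (at u)"
      using DERIV_chain2[OF has_real_derivative_powr[of "- u" t] DERIV_minus[OF DERIV_ident]] nonpos False
      by (simp add: sgn_if)
    then show ?thesis
      by (rule DERIV_cong_ev[THEN iffD1, rotated 3])
         (use nonpos False eventually_nhds_in_open[of "{..<0}" u] in \<open>auto elim: eventually_mono\<close>)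
  qed
  also have "t * \<bar>u\<bar> powr (t - 1) * sgn u = t * u * \<bar>u\<bar> powr (t - 2)"
  proof -
    have "\<bar>u\<bar> powr (t - 1) = \<bar>u\<bar> powr (t - 2) * \<bar>u\<bar>"
      using powr_add[of "\<bar>u\<bar>" "t - 2" 1] False by simp
    then show ?thesis by (simp add: abs_mult_sgn mult_ac)
  qed
  finally show ?thesis .
qed

text \<open>Also true at \<open>u = 0\<close>, where both sides vanish. This is what keeps powers of \<open>|P|\<close> within one
  class of functions under differentiation.\<close>

lemma abs_powr_split_square:
  fixes u :: real
  shows "\<bar>u\<bar> powr t = u\<^sup>2 * \<bar>u\<bar> powr (t - 2)"
proof (cases "u = 0")
  case False
  then show ?thesis
    using powr_add[of "\<bar>u\<bar>" "t - 2" 2] by (simp add: mult.commute powr_numeral)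
qed simp

lemma gauss_line_derivative:
  fixes x v :: "'a::real_inner"
  shows "((\<lambda>\<tau>. gauss (x + \<tau> *\<^sub>R v)) has_real_derivative - 2 * pi * (x \<bullet> v) * gauss x) (at 0)"
  unfolding gauss_def inner_add_left inner_add_right inner_scaleR_left inner_scaleR_right
  by (auto intro!: derivative_eq_intros simp: inner_commute algebra_simps)

text \<open>Lebesgue measure is translation invariant, so the difference quotients of \<open>u\<close> in the direction
  \<open>v\<close> have integral zero, and by dominated convergence so does their limit.\<close>

lemma integral_line_derivative_eq_0:
  fixes u :: "'a::euclidean_space \<Rightarrow> real"
  assumes meas [measurable]: "u \<in> borel_measurable borel" "u' \<in> borel_measurable borel"
    and int: "integrable lborel u" "integrable lborel w"
    and deriv: "\<And>x. ((\<lambda>\<tau>. u (x + \<tau> *\<^sub>R v)) has_real_derivative u' x) (at 0)"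
    and bound: "\<And>x \<tau>. \<bar>\<tau>\<bar> \<le> 1 \<Longrightarrow> \<bar>u' (x + \<tau> *\<^sub>R v)\<bar> \<le> w x"
  shows "(LINT x|lborel. u' x) = 0"
proof -
  \<comment> \<open>difference quotients with step \<open>1 / (n + 1)\<close>\<close>
  define q where "q n x = (u (x + (1 / Suc n) *\<^sub>R v) - u x) * Suc n" for n :: nat and x
  have trans: "(LINT x|lborel. u (a + x)) = (LINT x|lborel. u x)"
    and transi: "integrable lborel (\<lambda>x. u (a + x))" for a
  proof -
    have "(LINT x|distr lborel borel ((+) a). u x) = (LINT x|lborel. u (a + x))"
      by (subst integral_distr) auto
    then show "(LINT x|lborel. u (a + x)) = (LINT x|lborel. u x)"
      by (simp add: lborel_distr_plus)
    have "integrable (distr lborel borel ((+) a)) u \<longleftrightarrow> integrable lborel (\<lambda>x. u (a + x))"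
      by (subst integrable_distr_eq) auto
    then show "integrable lborel (\<lambda>x. u (a + x))"
      using int(1) by (simp add: lborel_distr_plus)
  qed
  have q0: "(LINT x|lborel. q n x) = 0" for n
    using trans[of "(1 / Suc n) *\<^sub>R v"] transi[of "(1 / Suc n) *\<^sub>R v"] int(1)
    by (simp add: q_def add.commute)
  have "(\<lambda>n. LINT x|lborel. q n x) \<longlonglongrightarrow> (LINT x|lborel. u' x)"
  proof (rule integral_dominated_convergence)
    show "u' \<in> borel_measurable lborel" "q n \<in> borel_measurable lborel" for n
      unfolding q_def by measurable
    show "AE x in lborel. (\<lambda>n. q n x) \<longlonglongrightarrow> u' x"
    proof (rule AE_I2)
      fix x
      have "((\<lambda>h. (u (x + h *\<^sub>R v) - u x) / h) \<longlongrightarrow> u' x) (at 0)"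
        using deriv[of x] by (simp add: has_field_derivative_iff)
      moreover have "filterlim (\<lambda>n. 1 / real (Suc n)) (at 0) sequentially"
        unfolding filterlim_at
        using LIMSEQ_Suc[OF lim_1_over_n] by auto
      ultimately have "(\<lambda>n. (u (x + (1 / real (Suc n)) *\<^sub>R v) - u x) / (1 / real (Suc n))) \<longlonglongrightarrow> u' x"
        by (rule filterlim_compose)
      then show "(\<lambda>n. q n x) \<longlonglongrightarrow> u' x"
        by (simp add: q_def)
    qed
    show "AE x in lborel. norm (q n x) \<le> w x" for n
    proof (rule AE_I2)
      fix x
      let ?h = "1 / real (Suc n)"
      have "\<exists>z. 0 < z \<and> z < ?h \<and> u (x + ?h *\<^sub>R v) - u (x + 0 *\<^sub>R v) = (?h - 0) * u' (x + z *\<^sub>R v)"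
        by (rule MVT2) (auto intro: DERIV_line_at[OF deriv])
      then obtain z where z: "0 < z" "z < ?h" "u (x + ?h *\<^sub>R v) - u x = ?h * u' (x + z *\<^sub>R v)"
        by auto
      have "?h \<le> 1" by simp
      then have "\<bar>u' (x + z *\<^sub>R v)\<bar> \<le> w x"
        using z by (intro bound) linarith
      moreover have "q n x = u' (x + z *\<^sub>R v)"
        unfolding q_def z(3) by simp
      ultimately show "norm (q n x) \<le> w x" by simp
    qed
  qed (use int in auto)
  then show ?thesis
    using q0 LIMSEQ_const_iff[of 0 "LINT x|lborel. u' x"] by simp
qed

text \<open>This is the vanishing of the integral of the derivative of \<open>u \<cdot> gauss\<close>. Since differentiating
  the Gaussian brings down the factor \<open>-2\<pi> (x \<bullet> v)\<close>, a linear factor can be traded for a derivative.\<close>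

lemma gaussian_integration_by_parts:
  fixes u :: "'a::euclidean_space \<Rightarrow> real"
  assumes [measurable]: "u \<in> borel_measurable borel" "u' \<in> borel_measurable borel"
    and growth: "poly_growth u" "poly_growth u'"
    and deriv: "\<And>x. ((\<lambda>\<tau>. u (x + \<tau> *\<^sub>R v)) has_real_derivative u' x) (at 0)"
  shows "(LINT x|lborel. u x * (x \<bullet> v) * gauss x) = (LINT x|lborel. u' x * gauss x) / (2 * pi)"
proof -
  have pgv: "poly_growth (\<lambda>x. x \<bullet> v)"
    by (rule poly_growth_polynomial[OF real_polynomial_function.intros(1)[OF bounded_linear_inner_left]])
  have pg: "poly_growth (\<lambda>x. u' x - 2 * pi * (u x * (x \<bullet> v)))"
    using poly_growth_add[OF growth(2) poly_growth_mult[OF poly_growth_const[of "- 2 * pi"]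
          poly_growth_mult[OF growth(1) pgv]]] by simp
  obtain C where C: "C > 0" "\<And>x. \<bar>u' x - 2 * pi * (u x * (x \<bullet> v))\<bar> * exp (- (2 * (x \<bullet> x))) \<le> C * exp (- (x \<bullet> x))"
    by (rule poly_growth_gauss_bound[OF pg, of 2, simplified]) blast
  have C': "\<bar>(u' x - 2 * pi * (u x * (x \<bullet> v))) * gauss x\<bar> \<le> C * exp (- 2 * (x \<bullet> x))" for x
  proof -
    have "gauss x = exp (- (2 * (x \<bullet> x))) * exp (- ((pi - 2) * (x \<bullet> x)))"
      by (simp add: gauss_def exp_add[symmetric] algebra_simps)
    then have "\<bar>(u' x - 2 * pi * (u x * (x \<bullet> v))) * gauss x\<bar> =
      \<bar>u' x - 2 * pi * (u x * (x \<bullet> v))\<bar> * exp (- (2 * (x \<bullet> x))) * exp (- ((pi - 2) * (x \<bullet> x)))"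
      by (simp add: abs_mult)
    also have "\<dots> \<le> (C * exp (- (x \<bullet> x))) * exp (- (x \<bullet> x))"
    proof (rule mult_mono[OF C(2)])
      have "1 * (x \<bullet> x) \<le> (pi - 2) * (x \<bullet> x)"
        using pi_gt3 by (intro mult_right_mono) auto
      then show "exp (- ((pi - 2) * (x \<bullet> x))) \<le> exp (- (x \<bullet> x))" by simp
    qed (use C in auto)
    also have "\<dots> = C * exp (- 2 * (x \<bullet> x))" by (simp add: exp_add[symmetric])
    finally show ?thesis .
  qed
  have "(LINT x|lborel. u' x * gauss x - 2 * pi * (u x * (x \<bullet> v) * gauss x)) = 0"
  proof (rule integral_line_derivative_eq_0[where u = "\<lambda>x. u x * gauss x" and v = v
        and w = "\<lambda>x::'a. C * exp (2 * (v \<bullet> v)) * exp (- (x \<bullet> x))"])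
    show "integrable lborel (\<lambda>x. u x * gauss x)"
      by (rule integrable_poly_growth) (use growth in auto)
    show "integrable lborel (\<lambda>x::'a. C * exp (2 * (v \<bullet> v)) * exp (- (x \<bullet> x)))"
      using integrable_gaussian[of 1, where 'a='a] by simp
    fix x
    show "((\<lambda>\<tau>. u (x + \<tau> *\<^sub>R v) * gauss (x + \<tau> *\<^sub>R v)) has_real_derivative
           u' x * gauss x - 2 * pi * (u x * (x \<bullet> v) * gauss x)) (at 0)"
      using DERIV_mult[OF deriv[of x] gauss_line_derivative[of x v]] by (simp add: algebra_simps)
    fix \<tau> :: real assume \<tau>: "\<bar>\<tau>\<bar> \<le> 1"
    let ?y = "x + \<tau> *\<^sub>R v"
    have "\<bar>u' ?y * gauss ?y - 2 * pi * (u ?y * (?y \<bullet> v) * gauss ?y)\<bar> \<le> C * exp (- 2 * (?y \<bullet> ?y))"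
      using C'[of ?y] by (simp add: algebra_simps)
    also have "\<dots> \<le> C * (exp (2 * (v \<bullet> v)) * exp (- (x \<bullet> x)))"
    proof -
      \<comment> \<open>\<open>|x|\<^sup>2 \<le> 2 |x + \<tau>v|\<^sup>2 + 2 |\<tau>v|\<^sup>2\<close>, so the bound at the shifted point is controlled at \<open>x\<close>\<close>
      have "0 \<le> (x + (2 * \<tau>) *\<^sub>R v) \<bullet> (x + (2 * \<tau>) *\<^sub>R v)" by simp
      then have "x \<bullet> x + 4 * \<tau> * (x \<bullet> v) + 4 * \<tau>\<^sup>2 * (v \<bullet> v) \<ge> 0"
        by (simp add: inner_add inner_commute algebra_simps power2_eq_square)
      moreover have "\<tau>\<^sup>2 * (v \<bullet> v) \<le> 1 * (v \<bullet> v)"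
        using \<tau> by (intro mult_right_mono) (auto simp: abs_square_le_1)
      ultimately have "- 2 * (?y \<bullet> ?y) \<le> 2 * (v \<bullet> v) - x \<bullet> x"
        by (simp add: inner_add inner_commute algebra_simps power2_eq_square)
      then have "exp (- 2 * (?y \<bullet> ?y)) \<le> exp (2 * (v \<bullet> v) + - (x \<bullet> x))" by simp
      then show ?thesis using C(1) by (simp add: exp_add[symmetric])
    qed
    finally show "\<bar>u' ?y * gauss ?y - 2 * pi * (u ?y * (?y \<bullet> v) * gauss ?y)\<bar>
      \<le> C * exp (2 * (v \<bullet> v)) * exp (- (x \<bullet> x))" by (simp add: mult_ac)
  qed auto
  moreover have "integrable lborel (\<lambda>x. u' x * gauss x)"
    by (rule integrable_poly_growth) (use growth in auto)
  moreover have "integrable lborel (\<lambda>x. u x * (x \<bullet> v) * gauss x)"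
    by (rule integrable_poly_growth) (use growth pgv in auto)
  ultimately have "(LINT x|lborel. u' x * gauss x) - 2 * pi * (LINT x|lborel. u x * (x \<bullet> v) * gauss x) = 0"
    by (subst (asm) Bochner_Integration.integral_diff) auto
  then show ?thesis
    by (simp add: field_simps)
qed

section \<open>Polynomials times powers of absolute values of polynomials\<close>

(* These introduction rules apply to every function, so classical search with them diverges. *)
declare real_polynomial_function.intros [rule del]

lemma real_polynomial_dir_derivativeE:
  fixes p :: "'a::real_normed_vector \<Rightarrow> real"
  assumes "real_polynomial_function p"
  obtains p' where "real_polynomial_function p'"
    "\<And>x. ((\<lambda>\<tau>. p (x + \<tau> *\<^sub>R v)) has_real_derivative p' x) (at 0)"
  using real_polynomial_dir_derivative[OF assms, of v]
  by (elim exE conjE) (erule that, erule spec)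

lemma real_polynomial_nth: "real_polynomial_function (\<lambda>x::real^'n. x $ i)"
  by (intro real_polynomial_function.intros(1) bounded_linear_vec_nth)

lemma real_polynomial_peval: "real_polynomial_function (peval p)"
  unfolding peval_def[abs_def]
  by (intro real_polynomial_function_sum real_polynomial_function_prod real_polynomial_function.intros(2,4)
      real_polynomial_function_power real_polynomial_nth) simp_all

lemma continuous_real_polynomial:
  "real_polynomial_function f \<Longrightarrow> continuous_on S f"
  by (intro continuous_at_imp_continuous_on ballI continuous_real_polymonial_function)

lemma borel_measurable_real_polynomial:
  fixes f :: "'a::euclidean_space \<Rightarrow> real"
  shows "real_polynomial_function f \<Longrightarrow> f \<in> borel_measurable borel"
  by (intro borel_measurable_continuous_onI continuous_real_polynomial)

lemmas peval_measurable [measurable] = borel_measurable_real_polynomial[OF real_polynomial_peval]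

lemma continuous_peval: "continuous_on S (peval (p :: ('n::finite, real) mpoly))"
  by (intro continuous_real_polynomial real_polynomial_peval)

definition abs_power :: "('r::finite \<Rightarrow> ('n::finite, real) mpoly) \<Rightarrow> ('r \<Rightarrow> real) \<Rightarrow> real ^ 'n \<Rightarrow> real" where
  "abs_power P t x = (\<Prod>k\<in>UNIV. \<bar>peval (P k) x\<bar> powr t k)"

lemma abs_power_nonneg [simp]: "abs_power P t x \<ge> 0"
  unfolding abs_power_def by (intro prod_nonneg) auto

lemma abs_power_pos: "(\<And>k. peval (P k) x \<noteq> 0) \<Longrightarrow> abs_power P t x > 0"
  unfolding abs_power_def by (intro prod_pos) auto

lemma abs_power_measurable [measurable]: "abs_power P t \<in> borel_measurable borel"
  unfolding abs_power_def by measurable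

lemma powr_le_one_plus_power:
  fixes u :: real
  assumes "0 \<le> u" "0 \<le> t" "t \<le> real N"
  shows "u powr t \<le> (1 + u) ^ N"
proof -
  have "u powr t \<le> (1 + u) powr t" using assms by (intro powr_mono2) auto
  also have "\<dots> \<le> (1 + u) powr real N" using assms by (intro powr_mono) auto
  also have "\<dots> = (1 + u) ^ N" using assms by (simp add: powr_realpow)
  finally show ?thesis .
qed

lemma abs_power_bound:
  assumes "\<And>k. 0 \<le> t k" "\<And>k. t k \<le> real N"
  shows "abs_power P t x \<le> (\<Prod>k\<in>UNIV. (1 + \<bar>peval (P k) x\<bar>) ^ N)"
  unfolding abs_power_def
  by (intro prod_mono conjI powr_le_one_plus_power assms) auto

lemma poly_growth_power_bound: "poly_growth (\<lambda>x. \<Prod>k\<in>UNIV. (1 + \<bar>peval (P k) x\<bar>) ^ N)"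
  by (intro poly_growth_prod poly_growth_power poly_growth_add poly_growth_abs
      poly_growth_polynomial real_polynomial_peval poly_growth_const)

lemma poly_growth_abs_power:
  assumes "\<And>k. 0 \<le> t k"
  shows "poly_growth (abs_power P t)"
proof -
  obtain N :: nat where N: "\<And>k. t k \<le> real N"
  proof -
    have "t k \<le> real (nat \<lceil>Max (range t)\<rceil>)" for k
    proof -
      have "t k \<le> Max (range t)" by (intro Max_ge) auto
      then show ?thesis by linarith
    qed
    then show ?thesis using that by blast
  qed
  show ?thesis
  proof (rule poly_growth_mono[OF poly_growth_power_bound[of P N]])
    fix x
    show "\<bar>abs_power P t x\<bar> \<le> \<bar>\<Prod>k\<in>UNIV. (1 + \<bar>peval (P k) x\<bar>) ^ N\<bar>"
      using abs_power_bound[of t N P x, OF assms N] by (intro order_trans[OF _ abs_ge_self]) simp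
  qed
qed

text \<open>Functions \<open>q \<cdot> |P|\<^sup>t\<close> with a polynomial \<open>q\<close>. A partial derivative stays in the class at the price of
  lowering every exponent by \<open>2\<close>, so for large exponents one may differentiate repeatedly.\<close>

definition tame :: "('r::finite \<Rightarrow> ('n::finite, real) mpoly) \<Rightarrow> ('r \<Rightarrow> real) \<Rightarrow> (real ^ 'n \<Rightarrow> real) \<Rightarrow> bool" where
  "tame P t f \<longleftrightarrow> (\<exists>q. real_polynomial_function q \<and> f = (\<lambda>x. q x * abs_power P t x))"

lemma tameE:
  assumes "tame P t f"
  obtains q where "real_polynomial_function q" "f = (\<lambda>x. q x * abs_power P t x)"
  using assms by (auto simp: tame_def)

lemma tame_measurable:
  assumes "tame P t f"
  shows "f \<in> borel_measurable borel"
  using assms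
proof (rule tameE)
  fix q assume q: "real_polynomial_function q" "f = (\<lambda>x. q x * abs_power P t x)"
  show ?thesis
    unfolding q(2) by (intro borel_measurable_times borel_measurable_real_polynomial q(1) abs_power_measurable)
qed

lemma tame_poly_growth:
  assumes "tame P t f" "\<And>k. 0 \<le> t k"
  shows "poly_growth f"
  using assms(1)
proof (rule tameE)
  fix q assume q: "real_polynomial_function q" "f = (\<lambda>x. q x * abs_power P t x)"
  show ?thesis
    unfolding q(2) by (intro poly_growth_mult poly_growth_polynomial[OF q(1)] poly_growth_abs_power assms(2))
qed

lemma abs_power_split_squares:
  "abs_power P t x = (\<Prod>k\<in>UNIV. (peval (P k) x)\<^sup>2) * abs_power P (\<lambda>k. t k - 2) x"
  unfolding abs_power_def by (simp only: prod.distrib[symmetric] abs_powr_split_square[symmetric])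

text \<open>Differentiating \<open>|P\<^sub>k|\<^bsup>t\<^sub>k\<^esup>\<close> leaves \<open>|P\<^sub>k|\<^bsup>t\<^sub>k - 2\<^esup>\<close> times a polynomial. In every other factor \<open>P\<^sub>i\<^sup>2\<close> is split
  off, so that all terms have the same powers and the polynomial parts can be added.\<close>

lemma tame_derivative:
  fixes P :: "'r::finite \<Rightarrow> ('n::finite, real) mpoly"
  assumes "tame P t f" "\<And>k. t k > 2"
  shows "\<exists>f'. tame P (\<lambda>k. t k - 2) f' \<and>
    (\<forall>x. ((\<lambda>\<tau>. f (x + \<tau> *\<^sub>R v)) has_real_derivative f' x) (at 0))"
proof -
  obtain q where q: "real_polynomial_function q" "f = (\<lambda>x. q x * abs_power P t x)"
    using assms(1) by (rule tameE)
  obtain q' where q': "real_polynomial_function q'"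
    "\<And>x. ((\<lambda>\<tau>. q (x + \<tau> *\<^sub>R v)) has_real_derivative q' x) (at 0)"
    using q(1) by (rule real_polynomial_dir_derivativeE[where v=v]) (rule that)
  obtain D where D: "\<And>k. real_polynomial_function (D k)"
    "\<And>k x. ((\<lambda>\<tau>. peval (P k) (x + \<tau> *\<^sub>R v)) has_real_derivative D k x) (at 0)"
  proof -
    define D where "D k = (SOME p'. real_polynomial_function p' \<and>
      (\<forall>x. ((\<lambda>\<tau>. peval (P k) (x + \<tau> *\<^sub>R v)) has_real_derivative p' x) (at 0)))" for k
    have "real_polynomial_function (D k) \<and>
      (\<forall>x. ((\<lambda>\<tau>. peval (P k) (x + \<tau> *\<^sub>R v)) has_real_derivative D k x) (at 0))" for k
      unfolding D_def by (rule someI_ex[OF real_polynomial_dir_derivative[OF real_polynomial_peval]])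
    then show ?thesis using that[of D] by simp
  qed
  let ?h = "abs_power P (\<lambda>k. t k - 2)"
  define E where "E x = (\<Sum>k\<in>UNIV. t k * peval (P k) x * D k x * (\<Prod>j\<in>UNIV - {k}. (peval (P j) x)\<^sup>2))" for x
  have rE: "real_polynomial_function E"
    unfolding E_def
    by (intro real_polynomial_function_sum real_polynomial_function_prod real_polynomial_function.intros(2,4)
        real_polynomial_function_power real_polynomial_peval D) simp_all
  have dh: "((\<lambda>\<tau>. abs_power P t (x + \<tau> *\<^sub>R v)) has_real_derivative E x * ?h x) (at 0)" for x
  proof -
    have "((\<lambda>\<tau>. \<bar>peval (P k) (x + \<tau> *\<^sub>R v)\<bar> powr t k) has_real_derivative
        t k * peval (P k) x * \<bar>peval (P k) x\<bar> powr (t k - 2) * D k x) (at 0)" for k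
      using DERIV_chain2[where f = "\<lambda>u. \<bar>u\<bar> powr t k", OF DERIV_abs_powr[OF assms(2)] D(2)[of k x]] by simp
    then have "((\<lambda>\<tau>. \<Prod>k\<in>UNIV. \<bar>peval (P k) (x + \<tau> *\<^sub>R v)\<bar> powr t k) has_real_derivative
        (\<Sum>k\<in>UNIV. t k * peval (P k) x * \<bar>peval (P k) x\<bar> powr (t k - 2) * D k x *
          (\<Prod>j\<in>UNIV - {k}. \<bar>peval (P j) (x + 0 *\<^sub>R v)\<bar> powr t j))) (at 0)"
      by (intro has_field_derivative_prod) auto
    also have "(\<Sum>k\<in>UNIV. t k * peval (P k) x * \<bar>peval (P k) x\<bar> powr (t k - 2) * D k x *
          (\<Prod>j\<in>UNIV - {k}. \<bar>peval (P j) (x + 0 *\<^sub>R v)\<bar> powr t j)) = E x * ?h x"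
      unfolding E_def sum_distrib_right
    proof (intro sum.cong refl)
      fix k :: 'r
      have "(\<Prod>j\<in>UNIV - {k}. \<bar>peval (P j) (x + 0 *\<^sub>R v)\<bar> powr t j) =
         (\<Prod>j\<in>UNIV - {k}. (peval (P j) x)\<^sup>2) * (\<Prod>j\<in>UNIV - {k}. \<bar>peval (P j) x\<bar> powr (t j - 2))"
        by (simp only: prod.distrib[symmetric] abs_powr_split_square[symmetric]) simp
      moreover have "?h x = \<bar>peval (P k) x\<bar> powr (t k - 2) * (\<Prod>j\<in>UNIV - {k}. \<bar>peval (P j) x\<bar> powr (t j - 2))"
        unfolding abs_power_def by (subst prod.remove[of UNIV k]) auto
      ultimately show "t k * peval (P k) x * \<bar>peval (P k) x\<bar> powr (t k - 2) * D k x *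
          (\<Prod>j\<in>UNIV - {k}. \<bar>peval (P j) (x + 0 *\<^sub>R v)\<bar> powr t j) =
         t k * peval (P k) x * D k x * (\<Prod>j\<in>UNIV - {k}. (peval (P j) x)\<^sup>2) * ?h x"
        by (simp add: mult_ac)
    qed
    finally show ?thesis unfolding abs_power_def .
  qed
  define f' where "f' x = (q' x * (\<Prod>k\<in>UNIV. (peval (P k) x)\<^sup>2) + E x * q x) * ?h x" for x
  have "((\<lambda>\<tau>. f (x + \<tau> *\<^sub>R v)) has_real_derivative f' x) (at 0)" for x
  proof -
    have "((\<lambda>\<tau>. f (x + \<tau> *\<^sub>R v)) has_real_derivative (q' x * abs_power P t x + E x * ?h x * q x)) (at 0)"
      unfolding q(2) using DERIV_mult[OF q'(2)[of x] dh[of x]] by simp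
    also have "q' x * abs_power P t x + E x * ?h x * q x = f' x"
      unfolding f'_def by (subst abs_power_split_squares) (simp add: algebra_simps)
    finally show ?thesis .
  qed
  moreover have "tame P (\<lambda>k. t k - 2) f'"
    unfolding tame_def
    by (intro exI[of _ "\<lambda>x. q' x * (\<Prod>k\<in>UNIV. (peval (P k) x)\<^sup>2) + E x * q x"] conjI
        real_polynomial_function.intros(3,4) real_polynomial_function_prod real_polynomial_function_power
        real_polynomial_peval q q' rE) (auto simp: f'_def)
  ultimately show ?thesis by blast
qed

lemma pderivative_of_real:
  assumes "\<And>x. ((\<lambda>\<tau>. f (x + \<tau> *\<^sub>R axis i 1)) has_real_derivative f' x) (at 0)"
  shows "pderivative i (\<lambda>x. C * complex_of_real (f x)) = (\<lambda>x. C * complex_of_real (f' x))"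
proof
  fix x
  have "((\<lambda>\<tau>. C * complex_of_real (f (x + \<tau> *\<^sub>R axis i 1))) has_vector_derivative C * complex_of_real (f' x)) (at 0)"
    using assms[of x] by (intro has_vector_derivative_mult_right has_vector_derivative_of_real)
      (simp add: has_real_derivative_iff_has_vector_derivative)
  then show "pderivative i (\<lambda>x. C * complex_of_real (f x)) x = C * complex_of_real (f' x)"
    unfolding pderivative_def by (rule vector_derivative_at)
qed

lemma pderivative_cong_open:
  assumes "open U" "\<And>y. y \<in> U \<Longrightarrow> F y = G y" "x \<in> U"
  shows "pderivative i F x = pderivative i G x"
proof -
  have "((\<lambda>\<tau>::real. x + \<tau> *\<^sub>R axis i 1) \<longlongrightarrow> x + 0 *\<^sub>R axis i 1) (at 0)"
    by (intro tendsto_intros)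
  then have "\<forall>\<^sub>F \<tau>::real in at 0. x + \<tau> *\<^sub>R axis i 1 \<in> U"
    using assms(1,3) by (simp add: tendsto_def)
  then have "\<forall>\<^sub>F \<tau>::real in nhds 0. x + \<tau> *\<^sub>R axis i 1 \<in> U"
    using assms(3) by (simp add: eventually_nhds_conv_at)
  then show ?thesis
    unfolding pderivative_def using assms(2)
    by (intro vector_derivative_cong_eq) (auto elim!: eventually_mono)
qed

text \<open>Differentiation by the squarefree monomial \<open>\<Prod>j\<in>J. x\<^sub>j\<close>, processed along a list of variables. The
  list makes induction possible; \<open>monom_grad\<close> is the case of all variables in increasing order.\<close>

definition grad_along :: "'n set \<Rightarrow> 'n list \<Rightarrow> (real ^ 'n::finite \<Rightarrow> complex) \<Rightarrow> real ^ 'n \<Rightarrow> complex" where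
  "grad_along J = foldr (\<lambda>i. if i \<in> J then pderivative i else id)"

lemma grad_along_simps:
  "grad_along J [] F = F"
  "grad_along J (i # xs) F = (if i \<in> J then pderivative i (grad_along J xs F) else grad_along J xs F)"
  by (simp_all add: grad_along_def)

lemma grad_along_cong_open:
  assumes "open U" "\<And>y. y \<in> U \<Longrightarrow> F y = G y" "x \<in> U"
  shows "grad_along J xs F x = grad_along J xs G x"
  using assms(3)
  by (induction xs arbitrary: x)
     (auto simp: grad_along_simps assms intro!: pderivative_cong_open[OF assms(1)])

lemma lookup_indicator_sum:
  fixes J :: "'v::finite set"
  shows "Poly_Mapping.lookup (\<Sum>j\<in>J. Poly_Mapping.single j (1::nat)) i = (if i \<in> J then 1 else 0)"
  by (simp add: lookup_sum lookup_single when_def sum.delta')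

lemma monom_grad_indicator:
  "monom_grad (\<Sum>j\<in>J. Poly_Mapping.single j 1) = grad_along J (sorted_list_of_set UNIV)"
proof -
  have "(\<lambda>i. pderivative i ^^ (if i \<in> J then 1 else 0)) = (\<lambda>i. if i \<in> J then pderivative i else id)"
    by (auto simp: fun_eq_iff)
  then show ?thesis
    unfolding monom_grad_def grad_along_def lookup_indicator_sum by simp
qed

lemma inner_axis_1: "x \<bullet> axis i (1::real) = x $ i"
  by (simp add: inner_axis)

text \<open>Integration by parts, once for each variable of \<open>J\<close>. As \<open>J\<close> contributes each variable only once,
  the remaining monomial does not depend on the variable being treated; the polynomial \<open>q\<close> in the
  statement collects the factors in variables outside the list. The same function \<open>f'\<close> serves all complex
  constants \<open>C\<close>, because later the constant depends on the point.\<close>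

lemma tame_grad_along:
  fixes P :: "'r::finite \<Rightarrow> ('n::finite, real) mpoly"
  assumes "tame P t f" "\<And>k. t k > 2 * real (length xs)" "distinct xs"
  shows "\<exists>f' t'. tame P t' f' \<and> (\<forall>k. t' k \<ge> t k - 2 * real (length xs)) \<and>
    (\<forall>C. grad_along J xs (\<lambda>x. C * complex_of_real (f x)) = (\<lambda>x. C * complex_of_real (f' x))) \<and>
    (\<forall>q. real_polynomial_function q \<longrightarrow> (\<forall>i\<in>set xs. \<forall>x \<tau>. q (x + \<tau> *\<^sub>R axis i 1) = q x) \<longrightarrow>
      (LINT x|lborel. f x * (\<Prod>i\<in>J \<inter> set xs. x $ i) * q x * gauss x) =
      (LINT x|lborel. f' x * q x * gauss x) / (2 * pi) ^ card (J \<inter> set xs))"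
  using assms(2,3)
proof (induction xs)
  case Nil
  show ?case
    by (intro exI[of _ f] exI[of _ t]) (auto simp: grad_along_simps assms)
next
  case (Cons i xs)
  have pre: "t k > 2 * real (length xs)" for k using Cons.prems(1)[of k] by simp
  obtain f1 t1 where f1: "tame P t1 f1" "\<And>k. t1 k \<ge> t k - 2 * real (length xs)"
    "\<And>C. grad_along J xs (\<lambda>x. C * complex_of_real (f x)) = (\<lambda>x. C * complex_of_real (f1 x))"
    "\<And>q. real_polynomial_function q \<Longrightarrow> (\<And>i x \<tau>. i\<in>set xs \<Longrightarrow> q (x + \<tau> *\<^sub>R axis i 1) = q x) \<Longrightarrow>
      (LINT x|lborel. f x * (\<Prod>i\<in>J \<inter> set xs. x $ i) * q x * gauss x) =
      (LINT x|lborel. f1 x * q x * gauss x) / (2 * pi) ^ card (J \<inter> set xs)"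
    using Cons.IH[OF pre] Cons.prems(2) by (auto; blast)
  show ?case
  proof (cases "i \<in> J")
    case False
    then have "J \<inter> set (i # xs) = J \<inter> set xs" by auto
    moreover have "t1 k \<ge> t k - 2 * real (length (i # xs))" for k
      using f1(2)[of k] by simp
    ultimately show ?thesis
      using f1 False by (intro exI[of _ f1] exI[of _ t1]) (simp add: grad_along_simps)
  next
    case True
    have t1: "t1 k > 2" for k using f1(2)[of k] Cons.prems(1)[of k] by simp
    obtain f' where f': "tame P (\<lambda>k. t1 k - 2) f'"
      "\<And>x. ((\<lambda>\<tau>. f1 (x + \<tau> *\<^sub>R axis i 1)) has_real_derivative f' x) (at 0)"
      using tame_derivative[OF f1(1) t1] by blast
    have grow: "poly_growth f1" "poly_growth f'"
      using tame_poly_growth[OF f1(1)] tame_poly_growth[OF f'(1)] t1 less_imp_le[OF t1]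
      by (metis less_eq_real_def zero_less_numeral order_trans, simp)
    have ibp: "(LINT x|lborel. f x * (\<Prod>i\<in>J \<inter> set (i # xs). x $ i) * q x * gauss x) =
      (LINT x|lborel. f' x * q x * gauss x) / (2 * pi) ^ card (J \<inter> set (i # xs))"
      if q: "real_polynomial_function q" "\<And>j x \<tau>. j\<in>set (i # xs) \<Longrightarrow> q (x + \<tau> *\<^sub>R axis j 1) = q x" for q
    proof -
      have set: "J \<inter> set (i # xs) = insert i (J \<inter> set xs)" using True by auto
      have i: "i \<notin> J \<inter> set xs" using Cons.prems(2) by auto
      have "(LINT x|lborel. f x * (\<Prod>i\<in>J \<inter> set (i # xs). x $ i) * q x * gauss x) =
        (LINT x|lborel. f x * (\<Prod>i\<in>J \<inter> set xs. x $ i) * (x $ i * q x) * gauss x)"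
        unfolding set using i by (simp add: mult_ac)
      also have "\<dots> = (LINT x|lborel. f1 x * (x $ i * q x) * gauss x) / (2 * pi) ^ card (J \<inter> set xs)"
      proof (rule f1(4))
        show "real_polynomial_function (\<lambda>x. x $ i * q x)"
          by (intro real_polynomial_function.intros(4) real_polynomial_nth q)
        fix j x \<tau> assume "j \<in> set xs"
        then have "j \<noteq> i" using Cons.prems(2) by auto
        then show "(x + \<tau> *\<^sub>R axis j 1) $ i * q (x + \<tau> *\<^sub>R axis j 1) = x $ i * q x"
          using q(2)[of j] \<open>j \<in> set xs\<close> by (simp add: axis_def)
      qed
      also have "(LINT x|lborel. f1 x * (x $ i * q x) * gauss x) =
        (LINT x|lborel. (f1 x * q x) * (x \<bullet> axis i 1) * gauss x)"
        by (simp add: inner_axis_1 mult_ac)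
      also have "\<dots> = (LINT x|lborel. (f' x * q x) * gauss x) / (2 * pi)"
      proof (rule gaussian_integration_by_parts)
        fix x
        have "((\<lambda>\<tau>. f1 (x + \<tau> *\<^sub>R axis i 1) * q x) has_real_derivative f' x * q x) (at 0)"
          by (intro DERIV_cmult_right f')
        then show "((\<lambda>\<tau>. f1 (x + \<tau> *\<^sub>R axis i 1) * q (x + \<tau> *\<^sub>R axis i 1)) has_real_derivative f' x * q x) (at 0)"
          using q(2)[of i] by simp
      qed (intro borel_measurable_times poly_growth_mult grow tame_measurable[OF f1(1)]
          tame_measurable[OF f'(1)] borel_measurable_real_polynomial[OF q(1)] poly_growth_polynomial[OF q(1)])+
      finally show ?thesis unfolding set using i by (simp add: field_simps)
    qed
    have grad: "grad_along J (i # xs) (\<lambda>x. C * complex_of_real (f x)) = (\<lambda>x. C * complex_of_real (f' x))" for C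
      using True pderivative_of_real[OF f'(2)] by (simp add: grad_along_simps f1)
    have "t1 k - 2 \<ge> t k - 2 * real (length (i # xs))" for k
      using f1(2)[of k] by simp
    then show ?thesis
      by (intro exI[of _ f'] exI[of _ "\<lambda>k. t1 k - 2"] conjI allI impI f'(1) grad ibp) (assumption | blast)+
  qed
qed

section \<open>The functional equation of the zeta integral\<close>

lemma AE_lborel_ex:
  assumes "AE x in (lborel :: 'a::euclidean_space measure). Q x"
  shows "\<exists>x. Q x"
proof (rule ccontr)
  assume "\<nexists>x. Q x"
  with assms have "AE x in (lborel :: 'a measure). False" by simp
  then show False by (auto elim!: AE_E simp: top.extremum_unique)
qed

lemma finite_zeros_real_polynomial:
  fixes f :: "real \<Rightarrow> real"
  assumes "real_polynomial_function f" "f t \<noteq> 0"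
  shows "finite {t. f t = 0}"
proof -
  obtain a n where f: "f = (\<lambda>x. \<Sum>i\<le>n. a i * x ^ i)"
    using assms(1) real_polynomial_function_iff_sum by blast
  show ?thesis
  proof (cases "\<forall>i\<le>n. a i = 0")
    case True
    then show ?thesis using assms(2) f by simp
  next
    case False
    then show ?thesis using polyfun_finite_roots[of a n] by (simp add: f)
  qed
qed

lemma real_polynomial_line:
  fixes f :: "'a::real_normed_vector \<Rightarrow> real"
  assumes "real_polynomial_function f"
  shows "real_polynomial_function (\<lambda>\<tau>. f (x + \<tau> *\<^sub>R v))"
proof -
  have "polynomial_function (\<lambda>\<tau>. x + \<tau> *\<^sub>R v)"
    by (intro polynomial_function_add polynomial_function_const polynomial_function_bounded_linear
        bounded_linear_scaleR_left)
  from real_polynomial_function_compose[OF this assms] show ?thesis by (simp add: o_def)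
qed

text \<open>The zero set is null because on every line in a direction \<open>v\<close> with \<open>f v \<noteq> 0\<close> the polynomial is not
  identically zero (look at infinity, by homogeneity), hence has finitely many zeros there. Fubini
  then produces a translate of the zero set that is null.\<close>

lemma AE_homogeneous_nonzero:
  fixes f :: "'a::euclidean_space \<Rightarrow> real"
  assumes f: "real_polynomial_function f" and hom: "\<And>\<tau> x. f (\<tau> *\<^sub>R x) = \<tau> ^ d * f x" and v: "f v \<noteq> 0"
  shows "AE x in lborel. f x \<noteq> 0"
proof -
  have cont: "continuous_on UNIV f" using f by (rule continuous_real_polynomial)
  have line: "\<exists>\<tau>. f (x + \<tau> *\<^sub>R v) \<noteq> 0" for x
  proof -
    have "((\<lambda>\<epsilon>. f (\<epsilon> *\<^sub>R x + v)) \<longlongrightarrow> f (0 *\<^sub>R x + v)) (at_right 0)"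
      by (rule continuous_on_tendsto_compose[OF cont]) (intro tendsto_intros, auto)
    then have "\<forall>\<^sub>F \<epsilon> in at_right 0. f (\<epsilon> *\<^sub>R x + v) \<noteq> 0"
      using v by (intro tendsto_imp_eventually_ne) auto
    then have "\<forall>\<^sub>F \<epsilon> in at_right 0. f (\<epsilon> *\<^sub>R x + v) \<noteq> 0 \<and> 0 < \<epsilon>"
      using eventually_at_right_less[of 0] by (rule eventually_conj)
    then obtain \<epsilon> where \<epsilon>: "\<epsilon> > 0" "f (\<epsilon> *\<^sub>R x + v) \<noteq> 0"
      using eventually_happens'[OF trivial_limit_at_right_real] by blast
    have "\<epsilon> *\<^sub>R x + v = \<epsilon> *\<^sub>R (x + (1 / \<epsilon>) *\<^sub>R v)"
      using \<epsilon> by (simp add: scaleR_add_right)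
    then show ?thesis using \<epsilon> hom[of \<epsilon> "x + (1 / \<epsilon>) *\<^sub>R v"] by auto
  qed
  have "AE \<tau> in lborel. f (x + \<tau> *\<^sub>R v) \<noteq> 0" for x
  proof -
    obtain \<tau> where "f (x + \<tau> *\<^sub>R v) \<noteq> 0" using line by blast
    then have "finite {\<tau>. f (x + \<tau> *\<^sub>R v) = 0}"
      by (rule finite_zeros_real_polynomial[OF real_polynomial_line[OF f]])
    then show ?thesis
      by (intro AE_I'[OF finite_imp_null_set_lborel]) auto
  qed
  then have "AE x in (lborel :: 'a measure). AE \<tau> in lborel. f (x + \<tau> *\<^sub>R v) \<noteq> 0" by simp
  moreover have "Measurable.pred (lborel \<Otimes>\<^sub>M lborel) (\<lambda>p :: 'a \<times> real. f (fst p + snd p *\<^sub>R v) \<noteq> 0)"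
    using borel_measurable_real_polynomial[OF f] by measurable
  ultimately have "AE \<tau> in lborel. AE x in (lborel :: 'a measure). f (x + \<tau> *\<^sub>R v) \<noteq> 0"
    by (subst lborel_pair.AE_commute[symmetric]) (auto simp: pred_def space_pair_measure)
  then have "\<exists>\<tau>::real. AE x in (lborel :: 'a measure). f (x + \<tau> *\<^sub>R v) \<noteq> 0"
    by (rule AE_lborel_ex)
  then obtain \<tau> :: real where "AE x in (lborel :: 'a measure). f (\<tau> *\<^sub>R v + x) \<noteq> 0"
    by (auto simp: add.commute)
  then have "AE x in distr lborel borel ((+) (\<tau> *\<^sub>R v)). f x \<noteq> 0"
    using borel_measurable_real_polynomial[OF f]
    by (subst AE_distr_iff) (auto)
  then show ?thesis unfolding lborel_distr_plus .
qed

lemma indicator_exponent_inj: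
  fixes J J' :: "'v::finite set"
  assumes "(\<Sum>j\<in>J. Poly_Mapping.single j (1::nat)) = (\<Sum>j\<in>J'. Poly_Mapping.single j 1)"
  shows "J = J'"
proof -
  have "(if i \<in> J then 1 else 0) = (if i \<in> J' then 1 else (0::nat))" for i
    using assms lookup_indicator_sum[of J i] lookup_indicator_sum[of J' i] by simp
  then have "i \<in> J \<longleftrightarrow> i \<in> J'" for i by (metis zero_neq_one)
  then show ?thesis by blast
qed

locale multilinear_family =
  fixes P :: "'r::finite \<Rightarrow> ('n::{finite,linorder}, real) mpoly" and d :: "'r \<Rightarrow> nat"
    and a :: "'r \<Rightarrow> 'n set \<Rightarrow> real"
  assumes P_eq: "P k = (\<Sum>J | card J = d k. squarefree_monom J (a k J))"
    and P_nonzero: "P k \<noteq> 0"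
begin

lemma peval_P: "peval (P k) x = (\<Sum>J | card J = d k. a k J * (\<Prod>j\<in>J. x $ j))"
proof -
  have "(\<Prod>j\<in>UNIV. x $ j ^ (if j \<in> J then 1 else 0 :: nat)) = (\<Prod>j\<in>J. x $ j)" for J :: "'n set" and x :: "real ^ 'n::{finite,linorder}"
    by (rule prod.mono_neutral_cong_right) auto
  then show ?thesis
    by (simp add: P_eq peval_sum squarefree_monom_def peval_single lookup_indicator_sum[simplified])
qed

lemma peval_P_scaleR: "peval (P k) (\<tau> *\<^sub>R x) = \<tau> ^ d k * peval (P k) x"
  unfolding peval_P sum_distrib_left by (intro sum.cong) (auto simp: prod.distrib)

text \<open>Distinct sets \<open>J\<close> give distinct monomials, so a sum over the monomials that occur in \<open>P\<^sub>k\<close> may be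
  taken over all \<open>J\<close> of the right size instead.\<close>

lemma sum_keys_P:
  fixes \<phi> :: "('n \<Rightarrow>\<^sub>0 nat) \<Rightarrow> complex"
  shows "(\<Sum>m\<in>Poly_Mapping.keys (P k). of_real (Poly_Mapping.lookup (P k) m) * \<phi> m) =
    (\<Sum>J | card J = d k. of_real (a k J) * \<phi> (\<Sum>j\<in>J. Poly_Mapping.single j 1))"
proof -
  let ?m = "\<lambda>J::'n set. \<Sum>j\<in>J. Poly_Mapping.single j (1::nat)"
  let ?A = "?m ` {J. card J = d k}"
  have inj: "inj_on ?m {J. card J = d k}" using indicator_exponent_inj by (auto intro!: inj_onI)
  have m_eq_iff: "?m J = ?m J' \<longleftrightarrow> J = J'" for J J' :: "'n set"
    using indicator_exponent_inj[of J J'] by auto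
  have lk: "Poly_Mapping.lookup (P k) m = (\<Sum>J | card J = d k. if ?m J = m then a k J else 0)" for m
    by (simp add: P_eq lookup_sum squarefree_monom_def lookup_single when_def)
  have "Poly_Mapping.keys (P k) \<subseteq> ?A"
  proof
    fix m assume "m \<in> Poly_Mapping.keys (P k)"
    then have "Poly_Mapping.lookup (P k) m \<noteq> 0" by (simp add: in_keys_iff)
    moreover have "Poly_Mapping.lookup (P k) m = 0" if "m \<notin> ?A"
      unfolding lk using that by (intro sum.neutral) auto
    ultimately show "m \<in> ?A" by blast
  qed
  then have "(\<Sum>m\<in>Poly_Mapping.keys (P k). of_real (Poly_Mapping.lookup (P k) m) * \<phi> m) =
     (\<Sum>m\<in>?A. of_real (Poly_Mapping.lookup (P k) m) * \<phi> m)"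
    by (intro sum.mono_neutral_left) (auto simp: in_keys_iff)
  also have "\<dots> = (\<Sum>J | card J = d k. of_real (Poly_Mapping.lookup (P k) (?m J)) * \<phi> (?m J))"
    by (rule sum.reindex[OF inj, unfolded o_def])
  also have "\<dots> = (\<Sum>J | card J = d k. of_real (a k J) * \<phi> (?m J))"
  proof (intro sum.cong refl)
    fix J :: "'n set" assume J: "J \<in> {J. card J = d k}"
    have "Poly_Mapping.lookup (P k) (?m J) = (\<Sum>J' | card J' = d k. if J' = J then a k J' else 0)"
      unfolding lk m_eq_iff ..
    also have "\<dots> = a k J" using J by simp
    finally show "of_real (Poly_Mapping.lookup (P k) (?m J)) * \<phi> (?m J) = of_real (a k J) * \<phi> (?m J)" by simp
  qed
  finally show ?thesis .
qed

text \<open>At the indicator vector of a set \<open>J\<close> with \<open>a\<^sub>J \<noteq> 0\<close> only the monomial of \<open>J\<close> survives, since no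
  other set of the same size is contained in \<open>J\<close>.\<close>

lemma P_nonzero_value: "\<exists>v. peval (P k) v \<noteq> 0"
proof -
  have "\<exists>J. card J = d k \<and> a k J \<noteq> 0"
  proof (rule ccontr)
    assume "\<not> ?thesis"
    then have "P k = 0" by (auto simp: P_eq squarefree_monom_def)
    then show False using P_nonzero by simp
  qed
  then obtain J where J: "card J = d k" "a k J \<noteq> 0" by blast
  let ?v = "vec_lambda (\<lambda>i. if i \<in> J then 1 else 0 :: real)"
  have "(\<Prod>j\<in>J'. ?v $ j) = (if J' = J then 1 else 0)"
    if "card J' = d k" for J' :: "'n set"
  proof (cases "J' \<subseteq> J")
    case True
    then have "J' = J" using card_subset_eq[of J J'] J(1) that by simp
    then show ?thesis by simp
  next
    case False
    then show ?thesis by auto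
  qed
  then have "peval (P k) ?v = (\<Sum>J' | card J' = d k. a k J' * (if J' = J then 1 else 0))"
    unfolding peval_P by (intro sum.cong) auto
  also have "\<dots> = a k J" using J by (simp add: if_distrib cong: if_cong)
  finally show ?thesis using J(2) by metis
qed

lemma AE_P_nonzero: "AE x in lborel. \<forall>k. peval (P k) x \<noteq> 0"
proof -
  have "AE x in lborel. peval (P k) x \<noteq> 0" for k
    using P_nonzero_value[of k] AE_homogeneous_nonzero[OF real_polynomial_peval peval_P_scaleR] by blast
  then show ?thesis by (simp add: AE_all_countable)
qed

lemma ex_P_nonzero: "\<exists>x. \<forall>k. peval (P k) x \<noteq> 0"
  using AE_P_nonzero by (rule AE_lborel_ex)

definition real_zeta :: "('r \<Rightarrow> real) \<Rightarrow> real" where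
  "real_zeta t = (LINT x|lborel. abs_power P t x * gauss x)"

lemma real_zeta_integrable:
  "(\<And>k. 0 \<le> t k) \<Longrightarrow> integrable lborel (\<lambda>x. abs_power P t x * gauss x)"
  by (intro integrable_poly_growth poly_growth_abs_power abs_power_measurable)

lemma real_zeta_pos:
  assumes "\<And>k. 0 \<le> t k"
  shows "real_zeta t > 0"
proof -
  have pos: "AE x in lborel. 0 < abs_power P t x * gauss x"
    using AE_P_nonzero by eventually_elim (simp add: abs_power_pos)
  have "real_zeta t \<noteq> 0"
  proof
    assume "real_zeta t = 0"
    then have "AE x in lborel. abs_power P t x * gauss x = 0"
      unfolding real_zeta_def
      by (subst (asm) integral_nonneg_eq_0_iff_AE) (auto intro: real_zeta_integrable assms simp: less_imp_le)
    then have "AE x in (lborel :: (real ^ 'n::{finite,linorder}) measure). False" using pos by eventually_elim linarith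
    then show False using AE_lborel_ex by blast
  qed
  moreover have "real_zeta t \<ge> 0"
    unfolding real_zeta_def by (intro integral_nonneg_AE) (auto simp: less_imp_le)
  ultimately show ?thesis by simp
qed

text \<open>Near a point where no \<open>P\<^sub>k\<close> vanishes all signs are constant, so the principal complex power is a
  constant multiple of the real power. The constant is the same after raising one exponent by \<open>1\<close>,
  when \<open>P\<^sub>k\<close> itself is split off instead of \<open>|P\<^sub>k|\<close>; so it cancels in the defining identity of the
  \<open>b\<close>-functions.\<close>

lemma complex_power_local:
  fixes t :: "'r \<Rightarrow> real" and x :: "real ^ 'n::{finite,linorder}"
  assumes "\<And>i. peval (P i) x \<noteq> 0"
  obtains U C where "open U" "x \<in> U" "C \<noteq> 0" 
    "\<And>y. y \<in> U \<Longrightarrow> complex_power P (\<chi> i. of_real (t i)) y = C * of_real (abs_power P t y)"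
    "\<And>y k. y \<in> U \<Longrightarrow> complex_power P (\<chi> i. of_real (t i) + of_nat (if i = k then 1 else 0)) y
        = C * of_real (peval (P k) y * abs_power P t y)"
proof -
  define U where "U = (\<Inter>i. {y. 0 < peval (P i) y * peval (P i) x})"
  define C where "C = (\<Prod>i\<in>UNIV. if peval (P i) x < 0 then exp (\<i> * pi * t i) else 1)"
  have "open U"
    unfolding U_def
    by (intro open_INT open_Collect_less continuous_intros continuous_peval ballI) auto
  moreover have "x \<in> U" using assms by (auto simp: U_def zero_less_mult_iff linorder_neq_iff)
  moreover have "C \<noteq> 0" by (auto simp: C_def)
  moreover have cp: "complex_power P (\<chi> i. of_real (t i)) y = C * of_real (abs_power P t y)" if "y \<in> U" for y
  proof -
    have "complex_of_real (peval (P i) y) powr (complex_of_real (t i)) =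
       (if peval (P i) x < 0 then exp (\<i> * pi * t i) else 1) * of_real (\<bar>peval (P i) y\<bar> powr t i)" for i
    proof -
      have "peval (P i) y * peval (P i) x > 0" using that by (auto simp: U_def)
      then show ?thesis by (auto simp: powr_of_real_if zero_less_mult_iff)
    qed
    then show ?thesis unfolding complex_power_def C_def abs_power_def
      by (simp add: prod.distrib)
  qed
  moreover have "complex_power P (\<chi> i. of_real (t i) + of_nat (if i = k then 1 else 0)) y
        = C * of_real (peval (P k) y * abs_power P t y)" if "y \<in> U" for y k
  proof -
    have nz: "peval (P i) y \<noteq> 0" for i
    proof -
      have "0 < peval (P i) y * peval (P i) x" using that by (auto simp: U_def)
      then show ?thesis by auto
    qed
    have "complex_power P (\<chi> i. of_real (t i) + of_nat (if i = k then 1 else 0)) y =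
      (\<Prod>i\<in>UNIV. complex_of_real (peval (P i) y) powr (of_real (t i)) * (if i = k then of_real (peval (P i) y) else 1))"
      unfolding complex_power_def using nz by (intro prod.cong) (auto simp: powr_add)
    also have "\<dots> = complex_power P (\<chi> i. of_real (t i)) y * of_real (peval (P k) y)"
      unfolding complex_power_def by (simp add: prod.distrib)
    finally show ?thesis using cp[OF that] by simp
  qed
  ultimately show ?thesis using that by blast
qed

text \<open>Apply integration by parts to \<open>f = |P|\<^sup>t P\<^sub>k\<close> and the second factor \<open>P\<^sub>k\<close>, monomial by monomial. The
  resulting derivative \<open>P\<^sub>k(grad) f\<close> is \<open>b\<^sub>k(t) |P|\<^sup>t\<close> wherever no \<open>P\<^sub>i\<close> vanishes. The
  lower bound on \<open>t\<close> leaves room for one differentiation in each of the \<open>n\<close> variables, each of which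
  costs \<open>2\<close>.\<close>

lemma zeta_functional_equation:
  fixes k :: 'r
  assumes b: "b_functions P b" and t: "\<And>i. t i > 2 * real CARD('n)"
  shows "\<exists>\<beta>. peval (b (\<lambda>i. if i = k then 1 else 0)) (\<chi> i. of_real (t i)) = of_real \<beta> \<and>
    real_zeta (t(k := t k + 2)) = \<beta> / (2 * pi) ^ d k * real_zeta t"
proof -
  let ?s = "\<chi> i. complex_of_real (t i)" and ?m = "\<lambda>i. if i = k then 1 else (0::nat)"
  let ?xs = "sorted_list_of_set (UNIV :: 'n set)"
  define f where "f x = peval (P k) x * abs_power P t x" for x
  have tame: "tame P t f"
    unfolding tame_def f_def by (intro exI[of _ "peval (P k)"]) (auto intro: real_polynomial_peval)
  have len: "length ?xs = CARD('n)" by simp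
  define Q where "Q J f' t' \<longleftrightarrow> tame P t' f' \<and> (\<forall>k. t' k \<ge> t k - 2 * real CARD('n)) \<and>
    (\<forall>C. grad_along J ?xs (\<lambda>x. C * complex_of_real (f x)) = (\<lambda>x. C * complex_of_real (f' x))) \<and>
    (LINT x|lborel. f x * (\<Prod>i\<in>J. x $ i) * gauss x) = (LINT x|lborel. f' x * gauss x) / (2 * pi) ^ card J"
    for J f' t'
  have "\<exists>f' t'. Q J f' t'" for J
  proof -
    have "t k > 2 * real (length ?xs)" for k using t len by simp
    note tame_grad_along[OF tame this distinct_sorted_list_of_set, of J]
    then obtain f' t' where f': "tame P t' f'" "\<forall>k. t' k \<ge> t k - 2 * real (length ?xs)"
      "\<forall>C. grad_along J ?xs (\<lambda>x. C * complex_of_real (f x)) = (\<lambda>x. C * complex_of_real (f' x))"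
      and ibp: "\<forall>q. real_polynomial_function q \<longrightarrow> (\<forall>i\<in>set ?xs. \<forall>x \<tau>. q (x + \<tau> *\<^sub>R axis i 1) = q x) \<longrightarrow>
        (LINT x|lborel. f x * (\<Prod>i\<in>J \<inter> set ?xs. x $ i) * q x * gauss x) =
        (LINT x|lborel. f' x * q x * gauss x) / (2 * pi) ^ card (J \<inter> set ?xs)"
      by (elim exE conjE) (rule that)
    show ?thesis
      using f' ibp[rule_format, OF real_polynomial_function.intros(2)[of 1]]
      by (intro exI[of _ f'] exI[of _ t']) (simp add: Q_def)
  qed
  then obtain g t' where Q: "\<And>J. Q J (g J) (t' J)" by metis
  have g0: "tame P (t' J) (g J)" "t' J i \<ge> t i - 2 * real CARD('n)"
    "grad_along J ?xs (\<lambda>x. C * complex_of_real (f x)) = (\<lambda>x. C * complex_of_real (g J x))"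
    and g_int: "(LINT x|lborel. f x * (\<Prod>i\<in>J. x $ i) * gauss x) = (LINT x|lborel. g J x * gauss x) / (2 * pi) ^ card J"
    for J C i
    using Q[of J] unfolding Q_def by blast+
  have g_integrable: "integrable lborel (\<lambda>x. g J x * gauss x)" for J
  proof (intro integrable_poly_growth tame_poly_growth[OF g0(1)] tame_measurable[OF g0(1)])
    fix i show "0 \<le> t' J i" using g0(2)[of i J] t[of i] by linarith
  qed
  define H where "H x = (\<Sum>J | card J = d k. a k J * g J x)" for x
  have H: "complex_of_real (H x) = peval (b ?m) ?s * of_real (abs_power P t x)"
    if nz: "\<And>i. peval (P i) x \<noteq> 0" for x
  proof -
    obtain U C where UC: "open U" "x \<in> U" "C \<noteq> 0" 
      "\<And>y. y \<in> U \<Longrightarrow> complex_power P ?s y = C * of_real (abs_power P t y)"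
      "\<And>y k. y \<in> U \<Longrightarrow> complex_power P (\<chi> i. of_real (t i) + of_nat (if i = k then 1 else 0)) y
          = C * of_real (peval (P k) y * abs_power P t y)"
      by (rule complex_power_local[OF nz, of t]) (rule that)
    let ?F = "complex_power P (\<chi> i. ?s $ i + of_nat (?m i))"
    have F: "?F y = C * of_real (f y)" if "y \<in> U" for y
      using UC(5)[OF that, of k] by (simp add: f_def)
    have prodP: "(\<Prod>i\<in>UNIV. P i ^ ?m i) = P k"
    proof -
      have "(\<Prod>i\<in>UNIV. P i ^ ?m i) = (\<Prod>i\<in>UNIV. if i = k then P i else 1)"
        by (intro prod.cong) auto
      then show ?thesis by simp
    qed
    have "peval (b ?m) ?s * complex_power P ?s x = poly_grad (\<Prod>i\<in>UNIV. P i ^ ?m i) ?F x"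
      by (rule b[unfolded b_functions_def, rule_format, OF nz, symmetric])
    also have "\<dots> = (\<Sum>J | card J = d k. of_real (a k J) * monom_grad (\<Sum>j\<in>J. Poly_Mapping.single j 1) ?F x)"
      unfolding prodP poly_grad_def by (rule sum_keys_P)
    also have "\<dots> = (\<Sum>J | card J = d k. of_real (a k J) * (C * of_real (g J x)))"
    proof (intro sum.cong refl)
      fix J :: "'n set"
      have "monom_grad (\<Sum>j\<in>J. Poly_Mapping.single j 1) ?F x = grad_along J ?xs (\<lambda>y. C * of_real (f y)) x"
        unfolding monom_grad_indicator by (rule grad_along_cong_open[OF UC(1) F UC(2)])
      then show "of_real (a k J) * monom_grad (\<Sum>j\<in>J. Poly_Mapping.single j 1) ?F x = of_real (a k J) * (C * of_real (g J x))"
        by (simp add: g0(3))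
    qed
    also have "\<dots> = C * of_real (H x)" by (simp add: H_def sum_distrib_left mult_ac)
    finally show ?thesis using UC(2,3,4) by (simp add: mult_ac)
  qed
  obtain x0 where x0: "\<And>i. peval (P i) x0 \<noteq> 0" using ex_P_nonzero by blast
  \<comment> \<open>evaluating at one good point shows that the value of the \<open>b\<close>-function is real\<close>
  define \<beta> where "\<beta> = H x0 / abs_power P t x0"
  have \<beta>: "peval (b ?m) ?s = of_real \<beta>"
  proof -
    have "abs_power P t x0 > 0" by (rule abs_power_pos) (rule x0)
    then show ?thesis using H[OF x0] by (simp add: \<beta>_def field_simps)
  qed
  have "AE x in lborel. H x * gauss x = \<beta> * (abs_power P t x * gauss x)"
    using AE_P_nonzero
  proof eventually_elim
    case (elim x)
    then have "complex_of_real (H x) = of_real (\<beta> * abs_power P t x)"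
      using H[of x] \<beta> by simp
    then have "H x = \<beta> * abs_power P t x" using of_real_eq_iff by blast
    then show ?case by simp
  qed
  moreover have "(\<lambda>x. H x * gauss x) \<in> borel_measurable lborel"
    unfolding H_def using tame_measurable[OF g0(1)] by measurable
  ultimately have IH: "(LINT x|lborel. H x * gauss x) = \<beta> * real_zeta t"
    unfolding real_zeta_def
    by (subst integral_mult_right_zero[symmetric]) (intro integral_cong_AE, auto)
  have "real_zeta (t(k := t k + 2)) = (LINT x|lborel. peval (P k) x * f x * gauss x)"
    unfolding real_zeta_def
  proof (intro Bochner_Integration.integral_cong refl)
    fix x
    have "\<bar>peval (P k) x\<bar> powr (t k + 2) = (peval (P k) x)\<^sup>2 * \<bar>peval (P k) x\<bar> powr t k"
      using abs_powr_split_square[of "peval (P k) x" "t k + 2"] by simp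
    then have "abs_power P (t(k := t k + 2)) x = (peval (P k) x)\<^sup>2 * abs_power P t x"
      unfolding abs_power_def by (subst (1 2) prod.remove[of UNIV k]) auto
    then show "abs_power P (t(k := t k + 2)) x * gauss x = peval (P k) x * f x * gauss x"
      by (simp add: f_def power2_eq_square)
  qed
  also have "\<dots> = (LINT x|lborel. (\<Sum>J | card J = d k. a k J * (f x * (\<Prod>i\<in>J. x $ i) * gauss x)))"
    unfolding peval_P by (intro Bochner_Integration.integral_cong refl)
      (simp add: sum_distrib_right sum_distrib_left mult_ac)
  also have "\<dots> = (\<Sum>J | card J = d k. a k J * (LINT x|lborel. f x * (\<Prod>i\<in>J. x $ i) * gauss x))"
  proof (subst Bochner_Integration.integral_sum)
    fix J :: "'n set"
    have "integrable lborel (\<lambda>x. f x * (\<Prod>i\<in>J. x $ i) * gauss x)"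
    proof (intro integrable_poly_growth poly_growth_mult poly_growth_prod)
      show "poly_growth f"
      proof (rule tame_poly_growth[OF tame])
        fix i show "0 \<le> t i" using t[of i] by linarith
      qed
      show "(\<lambda>x. f x * (\<Prod>i\<in>J. x $ i)) \<in> borel_measurable borel"
        using tame_measurable[OF tame] borel_measurable_real_polynomial[OF real_polynomial_nth]
        by (intro borel_measurable_times borel_measurable_prod)
    qed (intro poly_growth_polynomial real_polynomial_nth)
    then show "integrable lborel (\<lambda>x. a k J * (f x * (\<Prod>i\<in>J. x $ i) * gauss x))" by simp
  qed simp
  also have "\<dots> = (\<Sum>J | card J = d k. a k J * (LINT x|lborel. g J x * gauss x)) / (2 * pi) ^ d k"
    by (simp add: g_int sum_divide_distrib)
  also have "(\<Sum>J | card J = d k. a k J * (LINT x|lborel. g J x * gauss x)) = (LINT x|lborel. H x * gauss x)"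
    unfolding H_def using g_integrable
    by (simp add: sum_distrib_right mult.assoc)
  finally have "real_zeta (t(k := t k + 2)) = \<beta> / (2 * pi) ^ d k * real_zeta t"
    unfolding IH times_divide_eq_left .
  then show ?thesis using \<beta> by blast
qed

end

section \<open>The linear forms of the Ore--Sato expression have coefficients 0 and 1\<close>

text \<open>Multiplying by the common denominator gives a polynomial with infinitely many zeros; its value
  at \<open>-r\<close> is the total residue there times a nonzero product.\<close>

lemma sum_simple_poles_eq_0_imp:
  fixes \<rho> n :: "'e \<Rightarrow> real"
  assumes E: "finite E" and zero: "\<And>w. w > W \<Longrightarrow> (\<Sum>e\<in>E. n e / (w + \<rho> e)) = 0"
  shows "(\<Sum>e | e \<in> E \<and> \<rho> e = r. n e) = 0"
proof (cases "r \<in> \<rho> ` E")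
  case False
  then have empty: "{e. e \<in> E \<and> \<rho> e = r} = {}" by auto
  show ?thesis unfolding empty by simp
next
  case True
  define N where "N r = (\<Sum>e | e \<in> E \<and> \<rho> e = r. n e)" for r
  define R where "R = \<rho> ` E"
  have R: "finite R" using E by (simp add: R_def)
  define p where "p = (\<Sum>r\<in>R. smult (N r) (\<Prod>r'\<in>R - {r}. [:r', 1:]))"
  have "poly p w = 0" if w: "w > Max (insert W ((\<lambda>r. - r) ` R))" for w
  proof -
    have wW: "w > W" and wr: "\<And>r. r \<in> R \<Longrightarrow> w + r \<noteq> 0"
      using w R by auto
    have "(\<Sum>r\<in>R. N r / (w + r)) = (\<Sum>r\<in>R. \<Sum>e | e \<in> E \<and> \<rho> e = r. n e / (w + \<rho> e))"
      unfolding N_def sum_divide_distrib by (intro sum.cong refl) auto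
    also have "\<dots> = (\<Sum>e\<in>E. n e / (w + \<rho> e))"
      using E unfolding R_def by (rule sum.image_gen[symmetric])
    finally have S: "(\<Sum>r\<in>R. N r / (w + r)) = 0" using zero[OF wW] by simp
    have "poly p w = (\<Sum>r\<in>R. N r / (w + r) * (\<Prod>r'\<in>R. w + r'))"
      unfolding p_def poly_sum poly_smult poly_prod
    proof (intro sum.cong refl)
      fix r assume r: "r \<in> R"
      have "(\<Prod>r'\<in>R. w + r') = (w + r) * (\<Prod>r'\<in>R - {r}. w + r')"
        using R r by (rule prod.remove)
      then show "N r * (\<Prod>r'\<in>R - {r}. poly [:r', 1:] w) = N r / (w + r) * (\<Prod>r'\<in>R. w + r')"
        using wr[OF r] by (simp add: add.commute)
    qed
    also have "\<dots> = 0" unfolding sum_distrib_right[symmetric] S by simp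
    finally show ?thesis .
  qed
  then have "{Max (insert W ((\<lambda>r. - r) ` R))<..} \<subseteq> {w. poly p w = 0}" by auto
  then have "infinite {w. poly p w = 0}" using infinite_Ioi infinite_super by blast
  then have "p = 0" using poly_roots_finite by blast
  then have "0 = poly p (- r)" by simp
  also have "\<dots> = (\<Sum>r'\<in>R. if r' = r then N r * (\<Prod>r'\<in>R - {r}. r' - r) else 0)"
    unfolding p_def poly_sum poly_smult poly_prod
  proof (intro sum.cong refl)
    fix r' assume r': "r' \<in> R"
    show "N r' * (\<Prod>r''\<in>R - {r'}. poly [:r'', 1:] (- r)) = (if r' = r then N r * (\<Prod>r'\<in>R - {r}. r' - r) else 0)"
    proof (cases "r' = r")
      case False
      then have "(\<Prod>r''\<in>R - {r'}. poly [:r'', 1:] (- r)) = 0"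
        using True R by (intro prod_zero) (auto simp: R_def)
      then show ?thesis using False by simp
    qed simp
  qed
  also have "\<dots> = N r * (\<Prod>r'\<in>R - {r}. r' - r)"
    using True R by (simp add: R_def)
  finally show ?thesis using R by (simp add: N_def)
qed

lemma sum_lessThan_shift:
  fixes f :: "nat \<Rightarrow> 'a::comm_monoid_add"
  assumes "s + p \<le> M"
  shows "(\<Sum>\<nu><p. f (s + \<nu>)) = (\<Sum>m<M. if s \<le> m \<and> m < s + p then f m else 0)"
proof -
  have "(\<Sum>m<M. if s \<le> m \<and> m < s + p then f m else 0) = (\<Sum>m\<in>{s..<s+p}. f m)"
    using assms by (intro sum.mono_neutral_cong_right) auto
  also have "\<dots> = (\<Sum>\<nu><p. f (s + \<nu>))"
    by (rule sum.reindex_bij_witness[of _ "\<lambda>\<nu>. s + \<nu>" "\<lambda>m. m - s"]) auto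
  finally show ?thesis by simp
qed

text \<open>Let \<open>p\<close> and \<open>q\<close> be the coefficients of \<open>s\<^sub>k\<close> and \<open>s\<^sub>k\<^sub>'\<close> in \<open>\<mu>\<^sub>i\<close>. In the commutation relation
  \<open>b\<^sub>k(s + 2e\<^sub>k\<^sub>') b\<^sub>k\<^sub>'(s) / (b\<^sub>k\<^sub>'(s + 2e\<^sub>k) b\<^sub>k(s)) = 1\<close> the factor \<open>\<mu>\<^sub>i(s) + \<alpha>\<^sub>i + j + m\<close> that stems from \<open>j\<close>
  occurs with exponent \<open>z\<^sub>i\<^sub>j\<close> times this number. For \<open>0 < p < q\<close> the first nonzero value is at
  \<open>m = p\<close>, and it is positive.\<close>

definition \<kappa> :: "nat \<Rightarrow> nat \<Rightarrow> nat \<Rightarrow> int" where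
  "\<kappa> p q m = (if 2 * q \<le> m \<and> m < 2 * q + p then 1 else 0) + (if m < q then 1 else 0)
    - (if 2 * p \<le> m \<and> m < 2 * p + q then 1 else 0) - (if m < p then 1 else 0)"

lemma \<kappa>_low: "p < q \<Longrightarrow> m < p \<Longrightarrow> \<kappa> p q m = 0"
  by (auto simp: \<kappa>_def)

lemma \<kappa>_zero: "\<kappa> 0 q m = 0" "\<kappa> p 0 m = 0"
  by (auto simp: \<kappa>_def)

lemma \<kappa>_first: "0 < p \<Longrightarrow> p < q \<Longrightarrow> \<kappa> p q p = 1"
  by (auto simp: \<kappa>_def)

lemma sum_\<kappa>:
  fixes f :: "nat \<Rightarrow> real"
  assumes "2 * p + 2 * q \<le> M"
  shows "(\<Sum>m<M. of_int (\<kappa> p q m) * f m) =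
    (\<Sum>\<nu><p. f (2 * q + \<nu>)) + (\<Sum>\<nu><q. f \<nu>) - (\<Sum>\<nu><q. f (2 * p + \<nu>)) - (\<Sum>\<nu><p. f \<nu>)"
proof -
  have *: "(\<Sum>\<nu><p. f (2 * q + \<nu>)) = (\<Sum>m<M. if 2 * q \<le> m \<and> m < 2 * q + p then f m else 0)"
    "(\<Sum>\<nu><q. f (0 + \<nu>)) = (\<Sum>m<M. if 0 \<le> m \<and> m < 0 + q then f m else 0)"
    "(\<Sum>\<nu><q. f (2 * p + \<nu>)) = (\<Sum>m<M. if 2 * p \<le> m \<and> m < 2 * p + q then f m else 0)"
    "(\<Sum>\<nu><p. f (0 + \<nu>)) = (\<Sum>m<M. if 0 \<le> m \<and> m < 0 + p then f m else 0)"
    using assms by (intro sum_lessThan_shift; simp)+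
  show ?thesis
    using * unfolding add_0 by (simp only: sum.distrib[symmetric] sum_subtractf[symmetric])
      (auto intro!: sum.cong simp: \<kappa>_def)
qed


lemma ln_powi:
  fixes x :: real
  assumes "x > 0"
  shows "ln (x powi n) = of_int n * ln x"
  using assms ln_powr[of x "of_int n"] powr_real_of_int'[of x n] by simp

locale ore_sato_family = multilinear_family P d a
  for P :: "'r::finite \<Rightarrow> ('n::{finite,linorder}, real) mpoly" and d a +
  fixes b :: "('r \<Rightarrow> nat) \<Rightarrow> ('r, complex) mpoly" and c :: "'r \<Rightarrow> real" and l :: nat
    and \<mu> :: "nat \<Rightarrow> 'r \<Rightarrow> nat" and \<alpha> :: "nat \<Rightarrow> complex" and z :: "nat \<Rightarrow> int \<Rightarrow> int"
  assumes b_fun: "b_functions P b" and ore_sato: "ore_sato_data b c l \<mu> \<alpha> z"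
begin

abbreviation supp :: "nat \<Rightarrow> int set" where "supp i \<equiv> {j. z i j \<noteq> 0}"

text \<open>The real number \<open>\<alpha>\<^sub>i + j\<close>; see \<open>shift_props\<close>.\<close>

definition shift :: "nat \<Rightarrow> int \<Rightarrow> real" where "shift i j = Re (\<alpha> i) + of_int j"

definition lin :: "nat \<Rightarrow> ('r \<Rightarrow> real) \<Rightarrow> real" where "lin i t = (\<Sum>k\<in>UNIV. real (\<mu> i k) * t k)"

lemma c_pos: "c k > 0"
  using ore_sato by (auto simp: ore_sato_data_def)

lemma supp_props:
  assumes "i < l"
  shows "finite (supp i)" "(\<Sum>j\<in>supp i. z i j) > 0" "z i (Min (supp i)) > 0" "supp i \<noteq> {}"
  using ore_sato assms by (auto simp: ore_sato_data_def) (metis less_irrefl sum.empty)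

text \<open>Kashiwara's theorem is available at the smallest index \<open>j\<close> of the support, which has \<open>z\<^sub>i\<^sub>j > 0\<close>; all other shifts
  differ from that one by an integer, and those with \<open>z\<^sub>i\<^sub>j \<noteq> 0\<close> are larger. So no factor of the
  Ore--Sato expression vanishes on the closed positive orthant, whatever the sign of its exponent.\<close>

lemma shift_props:
  assumes i: "i < l"
  shows "\<alpha> i + of_int j = of_real (shift i j)" "shift i j \<in> \<rat>" "j \<in> supp i \<Longrightarrow> shift i j > 0"
proof -
  let ?j = "Min (supp i)"
  have "\<exists>q::rat. q > 0 \<and> \<alpha> i + of_int ?j = of_rat q"
    using ore_sato i supp_props(3)[OF i] unfolding ore_sato_data_def by blast
  then obtain q :: rat where q: "q > 0" "\<alpha> i + of_int ?j = of_rat q" by blast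
  have "complex_of_real (of_rat q) = of_rat q"
    by (cases q rule: Rat_cases) (simp add: of_rat_rat)
  then have \<alpha>: "\<alpha> i = of_real (of_rat q - of_int ?j)"
    using q(2) by (simp add: algebra_simps)
  show "\<alpha> i + of_int j = of_real (shift i j)"
    by (simp add: \<alpha> shift_def)
  show "shift i j \<in> \<rat>" by (simp add: \<alpha> shift_def)
  show "shift i j > 0" if "j \<in> supp i"
  proof -
    have "?j \<le> j" using supp_props(1)[OF i] that by (intro Min_le) auto
    moreover have "real_of_rat q > 0" using q(1) by simp
    moreover have "shift i j = real_of_rat q + (of_int j - of_int ?j)" by (simp add: \<alpha> shift_def)
    ultimately show ?thesis by linarith
  qed
qed

lemma shift_mono: "j \<le> j' \<Longrightarrow> shift i j \<le> shift i j'" by (simp add: shift_def)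

lemma linform_of_real: "linform (\<mu> i) (\<chi> k. of_real (t k)) = of_real (lin i t)"
  by (simp add: linform_def lin_def)

lemma lin_nonneg: "(\<And>k. 0 \<le> t k) \<Longrightarrow> 0 \<le> lin i t"
  unfolding lin_def by (intro sum_nonneg) auto

lemma lin_update: "lin i (t(k := t k + x)) = lin i t + real (\<mu> i k) * x"
proof -
  have "lin i (t(k := t k + x)) = (\<Sum>k'\<in>UNIV. real (\<mu> i k') * t k' + (if k' = k then real (\<mu> i k) * x else 0))"
    unfolding lin_def by (intro sum.cong) (auto simp: algebra_simps)
  then show ?thesis by (simp add: sum.distrib lin_def)
qed

text \<open>The \<open>b\<close>-function of the \<open>k\<close>-th unit vector at real arguments, in its Ore--Sato form.\<close>

definition \<beta> :: "'r \<Rightarrow> ('r \<Rightarrow> real) \<Rightarrow> real" where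
  "\<beta> k t = c k * (\<Prod>i<l. \<Prod>j\<in>supp i. \<Prod>\<nu><\<mu> i k. (lin i t + shift i j + real \<nu>) powi z i j)"

lemma \<beta>_pos:
  assumes "\<And>k. 0 \<le> t k"
  shows "\<beta> k t > 0"
  unfolding \<beta>_def
  by (intro mult_pos_pos c_pos prod_pos zero_less_power_int ballI)
     (use lin_nonneg[OF assms] shift_props(3) in \<open>force intro: add_nonneg_pos add_pos_nonneg\<close>)

lemma peval_b_unit:
  assumes t: "\<And>k. 0 \<le> t k"
  shows "peval (b (\<lambda>i. if i = k then 1 else 0)) (\<chi> i. of_real (t i)) = of_real (\<beta> k t)"
proof -
  let ?m = "\<lambda>i. if i = k then 1 else (0::nat)" and ?s = "\<chi> i. complex_of_real (t i)"
  have m: "(\<Sum>k'\<in>UNIV. \<mu> i k' * ?m k') = \<mu> i k" for i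
    by (simp add: if_distrib cong: if_cong)
  have ck: "(\<Prod>k'\<in>UNIV. complex_of_real (c k') ^ ?m k') = of_real (c k)"
  proof -
    have "(\<Prod>k'\<in>UNIV. complex_of_real (c k') ^ ?m k') = (\<Prod>k'\<in>UNIV. if k' = k then of_real (c k) else 1)"
      by (intro prod.cong) auto
    then show ?thesis by simp
  qed
  have fac: "linform (\<mu> i) ?s + \<alpha> i + of_int j + of_nat \<nu> = of_real (lin i t + shift i j + real \<nu>)" if "i < l" for i j \<nu>
    using shift_props(1)[OF that, of j] by (simp add: linform_of_real add.assoc)
  have m0: "?m \<noteq> (\<lambda>k. 0)" by (auto simp: fun_eq_iff)
  have "\<forall>i<l. \<forall>j. \<forall>\<nu> < (\<Sum>k'\<in>UNIV. \<mu> i k' * ?m k').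
            z i j < 0 \<longrightarrow> linform (\<mu> i) ?s + \<alpha> i + of_int j + of_nat \<nu> \<noteq> 0"
  proof (intro allI impI)
    fix i j \<nu> assume "i < l" "z i j < 0"
    then have "lin i t + shift i j + real \<nu> > 0"
      using lin_nonneg[of t i, OF t] shift_props(3)[of i j] by simp
    then show "linform (\<mu> i) ?s + \<alpha> i + of_int j + of_nat \<nu> \<noteq> 0"
      unfolding fac[OF \<open>i < l\<close>] of_real_eq_0_iff by simp
  qed
  then have "peval (b ?m) ?s = (\<Prod>k'\<in>UNIV. of_real (c k') ^ ?m k') *
          (\<Prod>i<l. \<Prod>j\<in>supp i. \<Prod>\<nu> < (\<Sum>k'\<in>UNIV. \<mu> i k' * ?m k').
            (linform (\<mu> i) ?s + \<alpha> i + of_int j + of_nat \<nu>) powi z i j)"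
    using ore_sato m0 unfolding ore_sato_data_def by blast
  also have "\<dots> = of_real (c k) * (\<Prod>i<l. \<Prod>j\<in>supp i. \<Prod>\<nu><\<mu> i k.
      of_real ((lin i t + shift i j + real \<nu>) powi z i j))"
    unfolding m ck by (intro arg_cong2[where f="(*)"] prod.cong refl) (simp only: lessThan_iff fac of_real_power_int)
  also have "\<dots> = of_real (\<beta> k t)"
    by (simp add: \<beta>_def)
  finally show ?thesis .
qed

text \<open>The range of exponents in which the functional equation has been established. Restricting to it
  loses nothing in the end, because of analytic continuation.\<close>

definition large :: "('r \<Rightarrow> real) \<Rightarrow> bool" where
  "large t \<longleftrightarrow> (\<forall>k. t k > 2 * real CARD('n))"

lemma large_nonneg: "large t \<Longrightarrow> 0 \<le> t k"
  unfolding large_def by (metis less_le_not_le order_trans of_nat_0_le_iff zero_le_mult_iff zero_le_numeral linorder_linear)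

lemma large_update:
  assumes "large t" "x \<ge> 0"
  shows "large (t(k := t k + x))"
  unfolding large_def
proof
  fix j
  have "t j > 2 * real CARD('n)" using assms by (simp add: large_def)
  then show "(t(k := t k + x)) j > 2 * real CARD('n)" using assms(2) by (cases "j = k") auto
qed

lemma functional_equation:
  assumes "large t"
  shows "real_zeta (t(k := t k + 2)) = \<beta> k t / (2 * pi) ^ d k * real_zeta t"
proof -
  obtain \<beta>' where *: "peval (b (\<lambda>i. if i = k then 1 else 0)) (\<chi> i. of_real (t i)) = of_real \<beta>'"
    "real_zeta (t(k := t k + 2)) = \<beta>' / (2 * pi) ^ d k * real_zeta t"
    using zeta_functional_equation[OF b_fun, of t k] assms unfolding large_def by blast
  have "\<beta>' = \<beta> k t"
    using * peval_b_unit[of t k, OF large_nonneg[OF assms]] by (metis of_real_eq_iff)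
  then show ?thesis using * by simp
qed

text \<open>The value \<open>Z(t + 2e\<^sub>k + 2e\<^sub>k\<^sub>')\<close> can be computed by applying the functional equation in either order,
  and \<open>Z(t) > 0\<close> may be cancelled.\<close>

lemma \<beta>_commute:
  assumes t: "large t" and k: "k \<noteq> k'"
  shows "\<beta> k (t(k' := t k' + 2)) * \<beta> k' t = \<beta> k' (t(k := t k + 2)) * \<beta> k t"
proof -
  let ?t = "t(k := t k + 2, k' := t k' + 2)"
  have "real_zeta ?t = \<beta> k (t(k' := t k' + 2)) / (2 * pi) ^ d k * (\<beta> k' t / (2 * pi) ^ d k' * real_zeta t)"
    using functional_equation[OF large_update[OF t, of 2 k'], of k] functional_equation[OF t, of k'] k
    by (simp add: fun_upd_twist[OF k])
  moreover have "real_zeta ?t = \<beta> k' (t(k := t k + 2)) / (2 * pi) ^ d k' * (\<beta> k t / (2 * pi) ^ d k * real_zeta t)"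
    using functional_equation[OF large_update[OF t, of 2 k], of k'] functional_equation[OF t, of k] k
    by simp
  moreover have "real_zeta t > 0" using large_nonneg[OF t] by (rule real_zeta_pos)
  ultimately show ?thesis by (simp add: field_simps)
qed

lemma ln_\<beta>:
  assumes "\<And>k. 0 \<le> t k"
  shows "ln (\<beta> k t) = ln (c k) + (\<Sum>i<l. \<Sum>j\<in>supp i. \<Sum>\<nu><\<mu> i k. of_int (z i j) * ln (lin i t + shift i j + real \<nu>))"
proof -
  have pos: "lin i t + shift i j + real \<nu> > 0" if "i < l" "j \<in> supp i" for i j \<nu>
    using lin_nonneg[of t i, OF assms] shift_props(3)[OF that] by simp
  have pos1: "(\<Prod>\<nu><\<mu> i k. (lin i t + shift i j + real \<nu>) powi z i j) > 0" if "i < l" "j \<in> supp i" for i j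
    using pos[OF that] by (intro prod_pos zero_less_power_int)
  have pos2: "(\<Prod>j\<in>supp i. \<Prod>\<nu><\<mu> i k. (lin i t + shift i j + real \<nu>) powi z i j) > 0" if "i < l" for i
    by (rule prod_pos) (rule pos1[OF that])
  have "ln (\<beta> k t) = ln (c k) + ln (\<Prod>i<l. \<Prod>j\<in>supp i. \<Prod>\<nu><\<mu> i k. (lin i t + shift i j + real \<nu>) powi z i j)"
    unfolding \<beta>_def using c_pos
    by (intro ln_mult_pos prod_pos pos2) auto
  also have "ln (\<Prod>i<l. \<Prod>j\<in>supp i. \<Prod>\<nu><\<mu> i k. (lin i t + shift i j + real \<nu>) powi z i j) =
      (\<Sum>i<l. ln (\<Prod>j\<in>supp i. \<Prod>\<nu><\<mu> i k. (lin i t + shift i j + real \<nu>) powi z i j))"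
    by (rule ln_prod) (simp, rule pos2[THEN less_imp_neq, THEN not_sym], simp)
  also have "\<dots> = (\<Sum>i<l. \<Sum>j\<in>supp i. \<Sum>\<nu><\<mu> i k. of_int (z i j) * ln (lin i t + shift i j + real \<nu>))"
  proof (intro sum.cong refl)
    fix i assume i: "i \<in> {..<l}"
    have "ln (\<Prod>j\<in>supp i. \<Prod>\<nu><\<mu> i k. (lin i t + shift i j + real \<nu>) powi z i j) =
      (\<Sum>j\<in>supp i. ln (\<Prod>\<nu><\<mu> i k. (lin i t + shift i j + real \<nu>) powi z i j))"
      by (rule ln_prod) (use i supp_props(1)[of i] in simp, rule pos1[THEN less_imp_neq, THEN not_sym], use i in simp_all)
    also have "\<dots> = (\<Sum>j\<in>supp i. \<Sum>\<nu><\<mu> i k. ln ((lin i t + shift i j + real \<nu>) powi z i j))"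
      by (intro sum.cong refl ln_prod zero_less_power_int[THEN less_imp_neq, THEN not_sym] pos)
        (use i in simp_all)
    also have "\<dots> = (\<Sum>j\<in>supp i. \<Sum>\<nu><\<mu> i k. of_int (z i j) * ln (lin i t + shift i j + real \<nu>))"
      using i pos by (intro sum.cong refl ln_powi) auto
    finally show "ln (\<Prod>j\<in>supp i. \<Prod>\<nu><\<mu> i k. (lin i t + shift i j + real \<nu>) powi z i j) =
      (\<Sum>j\<in>supp i. \<Sum>\<nu><\<mu> i k. of_int (z i j) * ln (lin i t + shift i j + real \<nu>))" .
  qed
  finally show ?thesis .
qed

text \<open>The logarithmic derivative of the commutation relation in the variable \<open>s\<^sub>k\<^sub>'\<close> turns the product of
  linear factors into a sum of simple poles.\<close>

lemma commutation_poles: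
  fixes k k' :: 'r and T :: "'r \<Rightarrow> real"
  assumes k: "k \<noteq> k'" and T: "large T" and w: "w > 0"
    and M: "\<And>i. i < l \<Longrightarrow> 2 * \<mu> i k + 2 * \<mu> i k' \<le> M"
  shows "(\<Sum>i<l. \<Sum>j\<in>supp i. \<Sum>m<M. of_int (z i j) * of_int (\<kappa> (\<mu> i k) (\<mu> i k') m) *
    (real (\<mu> i k') / (lin i T + shift i j + real m + real (\<mu> i k') * w))) = 0"
proof -
  let ?s = "\<lambda>k t i j. \<Sum>\<nu><\<mu> i k. of_int (z i j) * ln (lin i t + shift i j + real \<nu>)"
  let ?S = "\<lambda>k t. \<Sum>i<l. \<Sum>j\<in>supp i. ?s k t i j"
  define F where "F w = (\<Sum>i<l. \<Sum>j\<in>supp i. \<Sum>m<M. of_int (z i j) * of_int (\<kappa> (\<mu> i k) (\<mu> i k') m) *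
    ln (lin i T + shift i j + real m + real (\<mu> i k') * w))" for w
  have pos: "lin i T + shift i j + real m + real (\<mu> i k') * w > 0" if "i < l" "j \<in> supp i" "w > 0" for i j m w
    using lin_nonneg[of T i, OF large_nonneg[OF T]] shift_props(3)[OF that(1,2)] that(3)
    by (intro add_pos_nonneg add_nonneg_pos) auto
  have F0: "F w = 0" if w: "w > 0" for w
  proof -
    define t where "t = T(k' := T k' + w)"
    define t1 where "t1 = t(k' := t k' + 2)"
    define t2 where "t2 = t(k := t k + 2)"
    have t: "large t" unfolding t_def by (rule large_update[OF T]) (use w in simp)
    have t1: "large t1" and t2: "large t2" unfolding t1_def t2_def by (rule large_update[OF t], simp)+
    note nn = large_nonneg[OF t] large_nonneg[OF t2] large_nonneg[OF t1]
    have "ln (\<beta> k t1) + ln (\<beta> k' t) = ln (\<beta> k' t2) + ln (\<beta> k t)"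
      using arg_cong[OF \<beta>_commute[OF t k, folded t1_def t2_def], of ln]
      by (simp only: ln_mult_pos[OF \<beta>_pos[OF nn(3)] \<beta>_pos[OF nn(1)]] ln_mult_pos[OF \<beta>_pos[OF nn(2)] \<beta>_pos[OF nn(1)]])
    then have "?S k t1 +
       ?S k' t -
       ?S k' t2 -
       ?S k t = 0"
      unfolding ln_\<beta>[OF nn(1)] ln_\<beta>[OF nn(2)] ln_\<beta>[OF nn(3)] by simp
    also have "?S k t1 +
       ?S k' t -
       ?S k' t2 -
       ?S k t = F w"
      unfolding F_def sum.distrib[symmetric] sum_subtractf[symmetric]
    proof (intro sum.cong refl)
      fix i j assume ij: "i \<in> {..<l}" "j \<in> supp i"
      define f where "f m = of_int (z i j) * ln (lin i T + shift i j + real m + real (\<mu> i k') * w)" for m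
      have "(\<Sum>m<M. of_int (z i j) * of_int (\<kappa> (\<mu> i k) (\<mu> i k') m) * ln (lin i T + shift i j + real m + real (\<mu> i k') * w))
        = (\<Sum>m<M. of_int (\<kappa> (\<mu> i k) (\<mu> i k') m) * f m)"
        by (simp add: f_def mult_ac)
      also have "\<dots> = (\<Sum>\<nu><\<mu> i k. f (2 * \<mu> i k' + \<nu>)) + (\<Sum>\<nu><\<mu> i k'. f \<nu>) -
          (\<Sum>\<nu><\<mu> i k'. f (2 * \<mu> i k + \<nu>)) - (\<Sum>\<nu><\<mu> i k. f \<nu>)"
        by (rule sum_\<kappa>) (use M[of i] ij in auto)
      finally show "?s k t1 i j +
         ?s k' t i j -
         ?s k' t2 i j -
         ?s k t i j =
         (\<Sum>m<M. of_int (z i j) * of_int (\<kappa> (\<mu> i k) (\<mu> i k') m) * ln (lin i T + shift i j + real m + real (\<mu> i k') * w))"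
        unfolding f_def t1_def t2_def t_def lin_update by (simp add: algebra_simps)
    qed
    finally show ?thesis .
  qed
  have "(F has_real_derivative (\<Sum>i<l. \<Sum>j\<in>supp i. \<Sum>m<M. of_int (z i j) * of_int (\<kappa> (\<mu> i k) (\<mu> i k') m) *
    (real (\<mu> i k') / (lin i T + shift i j + real m + real (\<mu> i k') * w)))) (at w)"
    unfolding F_def
  proof (intro DERIV_sum DERIV_cmult)
    fix i j m assume ij: "i \<in> {..<l}" "j \<in> supp i"
    show "((\<lambda>w. ln (lin i T + shift i j + real m + real (\<mu> i k') * w)) has_real_derivative
      real (\<mu> i k') / (lin i T + shift i j + real m + real (\<mu> i k') * w)) (at w)"
      using pos[of i j w m] ij w by (auto intro!: derivative_eq_intros simp: field_simps)
  qed
  moreover have "(F has_real_derivative 0) (at w)"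
  proof (rule DERIV_cong_ev[THEN iffD1, rotated 3])
    show "((\<lambda>w. 0) has_real_derivative 0) (at w)" by simp
    show "\<forall>\<^sub>F x in nhds w. 0 = F x"
      using eventually_nhds_in_open[of "{0<..}" w] w by (auto elim!: eventually_mono simp: F0)
  qed auto
  ultimately show ?thesis using DERIV_unique by blast
qed

text \<open>Restrict the commutation relation to the line on which \<open>s\<^sub>k = x\<close> is a fixed irrational number,
  \<open>s\<^sub>k\<^sub>' = w\<close> varies and the other coordinates are rational. The poles are at
  \<open>w = - (p/q) x - (rational)\<close>, where \<open>p\<close> and \<open>q\<close> are the coefficients of \<open>s\<^sub>k\<close> and \<open>s\<^sub>k\<^sub>'\<close> in the form, so poles of two forms coincide only if the ratios \<open>p/q\<close> agree. Among
  the forms with the ratio of a form with \<open>p < q\<close>, consider the rightmost pole that does not cancel within its form.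
  It comes from the smallest \<open>j\<close> and from \<open>m = p\<close>, so all its contributions have the positive
  multiplicity \<open>z\<^sub>i\<^sub>j\<close>: they cannot add up to zero.\<close>

lemma no_increase_of_\<mu>:
  assumes k: "k \<noteq> k'" and i0: "i0 < l" "0 < \<mu> i0 k"
  shows "\<not> \<mu> i0 k < \<mu> i0 k'"
proof
  assume less: "\<mu> i0 k < \<mu> i0 k'"
  let ?K = "2 * real CARD('n) + 1"
  obtain x where x: "x \<notin> \<rat>" "x > ?K"
  proof -
    have "uncountable ({?K<..<?K + 1} - \<rat>)"
      using uncountable_minus_countable[OF uncountable_open_interval[THEN iffD2] countable_rat, of ?K "?K + 1"] by simp
    then obtain x where "x \<in> {?K<..<?K + 1} - \<rat>" by (metis countable_empty ex_in_conv)
    then show ?thesis by (intro that[of x]) simp_all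
  qed
  define T where "T = (\<lambda>_. ?K)(k := x)"
  define B where "B i = (\<Sum>k''\<in>UNIV - {k}. real (\<mu> i k'') * ?K)" for i
  have T: "large T" using x by (auto simp: large_def T_def)
  have LT: "lin i T = real (\<mu> i k) * x + B i" for i
    unfolding lin_def B_def by (subst sum.remove[of UNIV k]) (auto simp: T_def intro!: sum.cong)
  have B: "B i \<in> \<rat>" for i unfolding B_def by (intro Rats_sum Rats_mult) auto
  define M where "M = (\<Sum>i<l. 2 * \<mu> i k + 2 * \<mu> i k')"
  have M: "2 * \<mu> i k + 2 * \<mu> i k' \<le> M" if "i < l" for i
    unfolding M_def using that by (intro member_le_sum) auto
  define I where "I = {i. i < l \<and> 0 < \<mu> i k \<and> 0 < \<mu> i k'}"
  define E where "E = (SIGMA i:I. supp i \<times> {..<M})"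
  define n where "n = (\<lambda>(i,j,m). real_of_int (z i j * \<kappa> (\<mu> i k) (\<mu> i k') m))"
  define \<rho> where "\<rho> = (\<lambda>(i,j,m). (real (\<mu> i k) * x + B i + shift i j + real m) / real (\<mu> i k'))"
  have finI: "finite I" by (simp add: I_def)
  have finE: "finite E" unfolding E_def using finI supp_props(1) by (auto simp: I_def)
  have zero: "(\<Sum>e\<in>E. n e / (w + \<rho> e)) = 0" if w: "w > 0" for w
  proof -
    have "(\<Sum>e\<in>E. n e / (w + \<rho> e)) = (\<Sum>i\<in>I. \<Sum>(j,m)\<in>supp i \<times> {..<M}. n (i,j,m) / (w + \<rho> (i,j,m)))"
      unfolding E_def by (subst sum.Sigma) (auto simp: finI I_def supp_props(1) intro!: sum.cong)
    also have "\<dots> = (\<Sum>i\<in>I. \<Sum>j\<in>supp i. \<Sum>m<M. n (i,j,m) / (w + \<rho> (i,j,m)))"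
      by (simp add: sum.cartesian_product)
    also have "\<dots> = (\<Sum>i<l. \<Sum>j\<in>supp i. \<Sum>m<M. of_int (z i j) * of_int (\<kappa> (\<mu> i k) (\<mu> i k') m) *
        (real (\<mu> i k') / (lin i T + shift i j + real m + real (\<mu> i k') * w)))"
    proof (rule sum.mono_neutral_cong_left)
      show "I \<subseteq> {..<l}" by (auto simp: I_def)
      show "\<forall>i\<in>{..<l} - I. (\<Sum>j\<in>supp i. \<Sum>m<M. of_int (z i j) * of_int (\<kappa> (\<mu> i k) (\<mu> i k') m) *
        (real (\<mu> i k') / (lin i T + shift i j + real m + real (\<mu> i k') * w))) = 0"
      proof
        fix i assume "i \<in> {..<l} - I"
        then have "\<mu> i k = 0 \<or> \<mu> i k' = 0" by (auto simp: I_def)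
        then have "\<kappa> (\<mu> i k) (\<mu> i k') m = 0" for m by (metis \<kappa>_zero)
        then show "(\<Sum>j\<in>supp i. \<Sum>m<M. of_int (z i j) * of_int (\<kappa> (\<mu> i k) (\<mu> i k') m) *
          (real (\<mu> i k') / (lin i T + shift i j + real m + real (\<mu> i k') * w))) = 0" by simp
      qed
      fix i assume i: "i \<in> I"
      show "(\<Sum>j\<in>supp i. \<Sum>m<M. n (i,j,m) / (w + \<rho> (i,j,m))) =
        (\<Sum>j\<in>supp i. \<Sum>m<M. of_int (z i j) * of_int (\<kappa> (\<mu> i k) (\<mu> i k') m) *
        (real (\<mu> i k') / (lin i T + shift i j + real m + real (\<mu> i k') * w)))"
      proof (intro sum.cong refl)
        fix j m
        have q: "real (\<mu> i k') \<noteq> 0" using i by (auto simp: I_def)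
        have "w + \<rho> (i,j,m) = (lin i T + shift i j + real m + real (\<mu> i k') * w) / real (\<mu> i k')"
          using q by (simp add: \<rho>_def LT field_simps)
        then show "n (i,j,m) / (w + \<rho> (i,j,m)) = of_int (z i j) * of_int (\<kappa> (\<mu> i k) (\<mu> i k') m) *
        (real (\<mu> i k') / (lin i T + shift i j + real m + real (\<mu> i k') * w))"
          by (simp add: n_def)
      qed
    qed simp
    also have "\<dots> = 0" by (rule commutation_poles[OF k T w M])
    finally show ?thesis .
  qed
  \<comment> \<open>forms with the same ratio of coefficients as form \<open>i0\<close>; \<open>r i\<close> locates their first pole\<close>
  define I' where "I' = {i \<in> I. \<mu> i k * \<mu> i0 k' = \<mu> i0 k * \<mu> i k'}"
  define r where "r i = (B i + shift i (Min (supp i)) + real (\<mu> i k)) / real (\<mu> i k')" for i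
  have I'p: "\<mu> i k < \<mu> i k'" if "i \<in> I'" for i
  proof (rule ccontr)
    assume "\<not> \<mu> i k < \<mu> i k'"
    then have "\<mu> i0 k * \<mu> i k' \<le> \<mu> i0 k * \<mu> i k" by simp
    also have "\<dots> < \<mu> i0 k' * \<mu> i k" using less that by (auto simp: I'_def I_def)
    finally show False using that by (simp add: I'_def mult.commute)
  qed
  have i0I: "i0 \<in> I'" using i0 less by (auto simp: I'_def I_def)
  have finI': "finite I'" using finI by (simp add: I'_def)
  obtain i1 where i1: "i1 \<in> I'" "\<And>i. i \<in> I' \<Longrightarrow> r i1 \<le> r i"
    using finI' i0I by (metis arg_min_if_finite(1) arg_min_least empty_iff)
  have i1l: "i1 < l" and q1: "\<mu> i1 k' > 0" and p1: "\<mu> i1 k > 0" using i1(1) by (auto simp: I'_def I_def)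
  let ?e1 = "(i1, Min (supp i1), \<mu> i1 k)"
  let ?S = "{e \<in> E. \<rho> e = \<rho> ?e1}"
  have Min_in: "Min (supp i1) \<in> supp i1" using supp_props[OF i1l] by (intro Min_in) auto
  have e1: "?e1 \<in> ?S"
    using Min_in M[OF i1l] q1 i1(1) by (auto simp: E_def I'_def)
  have n1: "n ?e1 > 0"
    using supp_props(3)[OF i1l] \<kappa>_first[OF p1 I'p[OF i1(1)]] by (simp add: n_def)
  have nonneg: "n e \<ge> 0" if "e \<in> ?S" for e
  proof -
    obtain i j m where e: "e = (i,j,m)" by (cases e) auto
    have i: "i \<in> I" "j \<in> supp i" and eq: "\<rho> (i,j,m) = \<rho> ?e1" using that by (auto simp: e E_def)
    have il: "i < l" and q: "\<mu> i k' > 0" and p: "\<mu> i k > 0" using i(1) by (auto simp: I_def)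
    let ?c = "(B i + shift i j + real m) / real (\<mu> i k')"
    have eq': "(real (\<mu> i k) / real (\<mu> i k') - real (\<mu> i1 k) / real (\<mu> i1 k')) * x = r i1 - ?c"
      using eq q q1 by (simp add: \<rho>_def r_def field_simps)
    have rat: "r i1 - ?c \<in> \<rat>" unfolding r_def
      by (intro Rats_diff Rats_divide Rats_add B shift_props(2) il i1l Rats_of_nat)
    have ratio: "real (\<mu> i k) / real (\<mu> i k') - real (\<mu> i1 k) / real (\<mu> i1 k') = 0"
    proof (rule ccontr)
      assume nz: "\<not> ?thesis"
      then have "x = (r i1 - ?c) / (real (\<mu> i k) / real (\<mu> i k') - real (\<mu> i1 k) / real (\<mu> i1 k'))"
        using eq' by (simp add: field_simps)
      also have "\<dots> \<in> \<rat>" by (intro Rats_divide[OF rat] Rats_diff Rats_divide Rats_of_nat)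
      finally show False using x by simp
    qed
    then have "real (\<mu> i k) * real (\<mu> i1 k') = real (\<mu> i1 k) * real (\<mu> i k')"
      using q q1 by (simp add: field_simps)
    then have r1: "\<mu> i k * \<mu> i1 k' = \<mu> i1 k * \<mu> i k'"
      by (metis of_nat_eq_iff of_nat_mult)
    have r2: "\<mu> i1 k * \<mu> i0 k' = \<mu> i0 k * \<mu> i1 k'" using i1(1) by (auto simp: I'_def)
    have "(\<mu> i k * \<mu> i0 k') * \<mu> i1 k' = (\<mu> i0 k * \<mu> i k') * \<mu> i1 k'"
      using r1 r2 by (metis mult.assoc mult.commute)
    then have iI': "i \<in> I'" using i(1) q1 by (simp add: I'_def)
    have "?c = r i1" using eq' ratio by simp
    then have "?c \<le> r i" using i1(2)[OF iI'] by simp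
    then have le: "shift i j + real m \<le> shift i (Min (supp i)) + real (\<mu> i k)"
      unfolding r_def using q by (simp add: divide_le_cancel)
    have minle: "Min (supp i) \<le> j" using supp_props(1)[OF il] i(2) by (intro Min_le) auto
    show "n e \<ge> 0"
    proof (cases "m < \<mu> i k")
      case True
      then show ?thesis using \<kappa>_low[OF I'p[OF iI']] by (simp add: n_def e)
    next
      case False
      then have "shift i j \<le> shift i (Min (supp i))" "real m \<le> real (\<mu> i k)"
        using le shift_mono[OF minle, of i] by linarith+
      then have "j = Min (supp i)" "m = \<mu> i k" using minle False by (auto simp: shift_def)
      then show ?thesis using supp_props(3)[OF il] \<kappa>_first[OF p I'p[OF iI']] by (simp add: n_def e)
    qed
  qed
  have "(\<Sum>e\<in>?S. n e) > 0"
    using finE e1 n1 nonneg by (intro sum_pos2[of ?S ?e1]) auto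
  moreover have "(\<Sum>e\<in>?S. n e) = 0"
    using sum_simple_poles_eq_0_imp[OF finE zero, of 0 "\<rho> ?e1"] by simp
  ultimately show False by simp
qed

text \<open>By symmetry in \<open>k\<close> and \<open>k'\<close> all nonzero coefficients of \<open>\<mu>\<^sub>i\<close> are equal, hence equal to their
  greatest common divisor \<open>1\<close>.\<close>

lemma \<mu>_le_1:
  assumes i: "i < l"
  shows "\<mu> i k \<le> 1"
proof (cases "\<mu> i k = 0")
  case False
  have "\<mu> i k' = \<mu> i k" if "\<mu> i k' \<noteq> 0" for k'
  proof (cases "k' = k")
    case False
    then show ?thesis
      using no_increase_of_\<mu>[of k k' i] no_increase_of_\<mu>[of k' k i] i that \<open>\<mu> i k \<noteq> 0\<close> by (metis linorder_neqE_nat not_gr_zero)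
  qed simp
  then have "{\<mu> i k' | k'. \<mu> i k' \<noteq> 0} = {\<mu> i k}" using False by blast
  moreover have "Gcd {\<mu> i k' | k'. \<mu> i k' \<noteq> 0} = 1" using ore_sato i by (auto simp: ore_sato_data_def)
  ultimately show ?thesis by simp
qed simp

end

section \<open>Growth of the zeta integral and the degree of the b-functions\<close>

lemma prod_powi_eq_powi_sum:
  fixes x :: "'a::field"
  assumes "x \<noteq> 0"
  shows "(\<Prod>j\<in>S. x powi f j) = x powi (\<Sum>j\<in>S. f j)"
  using assms by (induction S rule: infinite_finite_induct) (auto simp: power_int_add)

lemma power_le_fact_times_exp:
  fixes y :: real
  assumes "y \<ge> 0"
  shows "y ^ N \<le> fact N * exp y"
proof -
  have "(\<Sum>n\<in>{N}. y ^ n /\<^sub>R fact n) \<le> suminf (\<lambda>n. y ^ n /\<^sub>R fact n)"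
    using assms by (intro sum_le_suminf summable_exp_generic) auto
  then have "y ^ N / fact N \<le> exp y" by (simp add: exp_def divide_inverse mult.commute)
  then show ?thesis by (simp add: field_simps)
qed

lemma power_mult_le_fact_power_times_exp:
  fixes y :: real
  assumes "y \<ge> 0"
  shows "y ^ (N * d) \<le> (real d ^ d) ^ N * fact N ^ d * exp y"
proof (cases "d = 0")
  case False
  have "(y / d) ^ N \<le> fact N * exp (y / d)"
    using assms by (intro power_le_fact_times_exp) auto
  then have "((y / d) ^ N) ^ d \<le> (fact N * exp (y / d)) ^ d"
    using assms by (intro power_mono) auto
  also have "\<dots> = fact N ^ d * exp y"
    using False by (simp add: power_mult_distrib exp_of_nat_mult[symmetric])
  finally have "y ^ (N * d) / real d ^ (N * d) \<le> fact N ^ d * exp y"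
    by (simp add: power_mult[symmetric] power_divide)
  then have "y ^ (N * d) \<le> (fact N ^ d * exp y) * real d ^ (N * d)"
    using False by (simp add: field_simps)
  then show ?thesis by (simp add: power_mult[symmetric] mult_ac)
qed (use assms in auto)

text \<open>Once the ratios exceed \<open>2(|q| + 1)\<close>, the sequence outgrows \<open>(|q| + 1)\<^sup>N\<close> by a factor \<open>2\<^sup>N\<close>. This
  is how the growth rates \<open>N!\<^sup>d\<close> with different \<open>d\<close> will be told apart.\<close>

lemma ratio_at_top_not_geometric:
  fixes w :: "nat \<Rightarrow> real"
  assumes pos: "\<And>N. w N > 0" and ratio: "filterlim (\<lambda>N. w (Suc N) / w N) at_top sequentially"
  shows "\<exists>N\<ge>1. w N > C * q ^ N"
proof (rule ccontr)
  assume "\<not> ?thesis"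
  then have le: "\<And>N. N \<ge> 1 \<Longrightarrow> w N \<le> C * q ^ N" by (meson not_le)
  define Q where "Q = \<bar>q\<bar> + 1"
  have Q: "Q > 0" by (simp add: Q_def)
  have le': "w N \<le> \<bar>C\<bar> * Q ^ N" if "N \<ge> 1" for N
  proof -
    have "w N \<le> \<bar>C * q ^ N\<bar>" using le[OF that] by linarith
    also have "\<dots> = \<bar>C\<bar> * \<bar>q\<bar> ^ N" by (simp add: abs_mult power_abs)
    also have "\<dots> \<le> \<bar>C\<bar> * Q ^ N" by (intro mult_left_mono power_mono) (auto simp: Q_def)
    finally show ?thesis .
  qed
  obtain N0 where N0: "\<And>N. N \<ge> N0 \<Longrightarrow> w (Suc N) / w N \<ge> 2 * Q"
    using ratio unfolding filterlim_at_top eventually_sequentially by blast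
  define N1 where "N1 = Suc N0"
  have ge: "w (N1 + n) \<ge> (2 * Q) ^ n * w N1" for n
  proof (induction n)
    case (Suc n)
    have "w (Suc (N1 + n)) \<ge> 2 * Q * w (N1 + n)"
      using N0[of "N1 + n"] pos[of "N1 + n"] by (simp add: N1_def field_simps)
    moreover have "2 * Q * w (N1 + n) \<ge> 2 * Q * ((2 * Q) ^ n * w N1)"
      using Suc.IH Q by (intro mult_left_mono) auto
    ultimately show ?case by (simp add: mult_ac)
  qed simp
  have "2 ^ n \<le> \<bar>C\<bar> * Q ^ N1 / w N1" for n
  proof -
    have "(2 * Q) ^ n * w N1 \<le> \<bar>C\<bar> * Q ^ (N1 + n)"
      using ge[of n] le'[of "N1 + n"] by (simp add: N1_def)
    then have "2 ^ n * w N1 * Q ^ n \<le> (\<bar>C\<bar> * Q ^ N1) * Q ^ n"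
      by (simp add: power_mult_distrib power_add mult_ac)
    then have "2 ^ n * w N1 \<le> \<bar>C\<bar> * Q ^ N1" using Q by simp
    then show ?thesis using pos[of N1] by (simp add: field_simps)
  qed
  then show False
    using real_arch_pow[of 2 "\<bar>C\<bar> * Q ^ N1 / w N1"] by (simp add: not_less[symmetric])
qed

context multilinear_family
begin

lemma abs_power_update:
  "abs_power P (t(k := t k + 2 * real N)) x = peval (P k) x ^ (2 * N) * abs_power P t x"
proof -
  have "\<bar>u\<bar> powr (s + 2 * real N) = u ^ (2 * N) * \<bar>u\<bar> powr s" for u s :: real
  proof (cases "u = 0")
    case False
    have "\<bar>u\<bar> powr (2 * real N) = \<bar>u\<bar> ^ (2 * N)"
      using powr_realpow[of "\<bar>u\<bar>" "2 * N"] False by simp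
    also have "\<dots> = u ^ (2 * N)" by (simp add: power_even_abs)
    finally show ?thesis by (simp add: powr_add)
  qed simp
  then show ?thesis
    unfolding abs_power_def by (subst (1 2) prod.remove[of UNIV k]) auto
qed

lemma P_upper_bound: "\<exists>M>0. \<forall>x. \<bar>peval (P k) x\<bar> \<le> M * norm x ^ d k"
proof -
  have "\<bar>peval (P k) x\<bar> \<le> ((\<Sum>J | card J = d k. \<bar>a k J\<bar>) + 1) * norm x ^ d k" for x
  proof -
    have "\<bar>\<Prod>j\<in>J. x $ j\<bar> \<le> norm x ^ card J" for J
      unfolding abs_prod using prod_mono[of J "\<lambda>j. \<bar>x $ j\<bar>" "\<lambda>_. norm x"] component_le_norm_cart[of x]
      by simp
    then have "\<bar>peval (P k) x\<bar> \<le> (\<Sum>J | card J = d k. \<bar>a k J\<bar> * norm x ^ d k)"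
      unfolding peval_P by (intro order_trans[OF sum_abs] sum_mono) (auto simp: abs_mult intro!: mult_left_mono, metis)
    then show ?thesis by (simp add: sum_distrib_right[symmetric] distrib_right add_increasing2)
  qed
  moreover have "(\<Sum>J | card J = d k. \<bar>a k J\<bar>) + 1 > 0" by (intro add_nonneg_pos sum_nonneg) auto
  ultimately show ?thesis by blast
qed

text \<open>By homogeneity \<open>P\<^sub>k(x)\<^bsup>2N\<^esup> \<le> M\<^bsup>2N\<^esup> |x|\<^bsup>2N d\<^sub>k\<^esup>\<close>, and a fraction \<open>exp (-|x|\<^sup>2)\<close> of the Gaussian reduces the last power
  to a constant of size \<open>N!\<^bsup>d\<^sub>k\<^esup>\<close> up to a geometric factor. The remaining Gaussian \<open>exp (-(\<pi> - 1)|x|\<^sup>2)\<close>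
  still makes the integral converge.\<close>

lemma zeta_growth_upper:
  assumes t: "\<And>k. 0 \<le> t k"
  shows "\<exists>C q. \<forall>N. real_zeta (t(k := t k + 2 * real N)) \<le> C * q ^ N * fact N ^ d k"
proof -
  obtain M where M: "M > 0" "\<And>x. \<bar>peval (P k) x\<bar> \<le> M * norm x ^ d k"
    using P_upper_bound by blast
  let ?I = "LINT x|lborel. abs_power P t x * exp (- ((pi - 1) * (x \<bullet> x)))"
  have int: "integrable lborel (\<lambda>x. abs_power P t x * exp (- ((pi - 1) * (x \<bullet> x))))"
    using pi_gt3 by (intro integrable_poly_growth_exp poly_growth_abs_power t) auto
  have "real_zeta (t(k := t k + 2 * real N)) \<le> ?I * (M\<^sup>2 * real (d k) ^ d k) ^ N * fact N ^ d k" for N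
  proof -
    let ?c = "(M\<^sup>2 * real (d k) ^ d k) ^ N * fact N ^ d k"
    have "real_zeta (t(k := t k + 2 * real N)) \<le>
      (LINT x|lborel. ?c * (abs_power P t x * exp (- ((pi - 1) * (x \<bullet> x)))))"
      unfolding real_zeta_def
    proof (rule integral_mono)
      show "integrable lborel (\<lambda>x. abs_power P (t(k := t k + 2 * real N)) x * gauss x)"
        using t by (intro real_zeta_integrable) simp
      show "integrable lborel (\<lambda>x. ?c * (abs_power P t x * exp (- ((pi - 1) * (x \<bullet> x)))))"
        using int by simp
      fix x
      have "peval (P k) x ^ (2 * N) = (\<bar>peval (P k) x\<bar>) ^ (2 * N)" by (simp add: power_even_abs)
      also have "\<dots> \<le> (M * norm x ^ d k) ^ (2 * N)" using M(2) by (intro power_mono) auto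
      also have "\<dots> = (M\<^sup>2) ^ N * (x \<bullet> x) ^ (N * d k)"
        by (simp add: power_mult_distrib power_mult[symmetric] power2_norm_eq_inner[symmetric] mult_ac)
      also have "\<dots> \<le> (M\<^sup>2) ^ N * ((real (d k) ^ d k) ^ N * fact N ^ d k * exp (x \<bullet> x))"
        by (intro mult_left_mono power_mult_le_fact_power_times_exp) auto
      finally have "peval (P k) x ^ (2 * N) \<le> ?c * exp (x \<bullet> x)"
        by (simp add: power_mult_distrib mult_ac)
      then have "peval (P k) x ^ (2 * N) * (abs_power P t x * gauss x) \<le> ?c * exp (x \<bullet> x) * (abs_power P t x * gauss x)"
        by (intro mult_right_mono) (auto simp: less_imp_le)
      also have "exp (x \<bullet> x) * gauss x = exp (- ((pi - 1) * (x \<bullet> x)))"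
        by (simp add: gauss_def exp_add[symmetric] algebra_simps)
      then have "?c * exp (x \<bullet> x) * (abs_power P t x * gauss x) = ?c * (abs_power P t x * exp (- ((pi - 1) * (x \<bullet> x))))"
        by (simp add: mult_ac)
      finally show "abs_power P (t(k := t k + 2 * real N)) x * gauss x \<le>
        ?c * (abs_power P t x * exp (- ((pi - 1) * (x \<bullet> x))))"
        by (simp only: abs_power_update mult.assoc)
    qed
    also have "\<dots> = ?I * (M\<^sup>2 * real (d k) ^ d k) ^ N * fact N ^ d k"
      by (subst integral_mult_right_zero) (simp add: mult_ac)
    finally show ?thesis .
  qed
  then show ?thesis by blast
qed

text \<open>Only a ball around \<open>\<surd>N v\<close> is used, where \<open>v\<close> is a point with all \<open>P\<^sub>i(v) \<noteq> 0\<close>. There \<open>|P\<^sub>k|\<close> is at least a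
  constant times \<open>N\<^bsup>d\<^sub>k/2\<^esup>\<close> by homogeneity, and the Gaussian is at least geometrically small: \<open>\<surd>N\<close> is the
  scale at which the integrand concentrates.\<close>

lemma zeta_growth_lower:
  assumes t: "\<And>k. 0 \<le> t k"
  shows "\<exists>C>0. \<exists>q>0. \<forall>N\<ge>1. C * q ^ N * fact N ^ d k \<le> real_zeta (t(k := t k + 2 * real N))"
proof -
  obtain v where v: "\<And>i. peval (P i) v \<noteq> 0" using ex_P_nonzero by blast
  define \<delta> where "\<delta> = min 1 (Min (range (\<lambda>i. \<bar>peval (P i) v\<bar>)) / 2)"
  have \<delta>: "0 < \<delta>" "\<delta> \<le> 1" using v by (auto simp: \<delta>_def)
  have \<delta>v: "\<delta> < \<bar>peval (P i) v\<bar>" for i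
  proof -
    have "Min (range (\<lambda>i. \<bar>peval (P i) v\<bar>)) \<le> \<bar>peval (P i) v\<bar>" by (intro Min_le) auto
    moreover have "0 < \<bar>peval (P i) v\<bar>" using v by simp
    moreover have "\<delta> \<le> Min (range (\<lambda>i. \<bar>peval (P i) v\<bar>)) / 2" unfolding \<delta>_def by (rule min.cobounded2)
    ultimately show ?thesis by linarith
  qed
  have "open (\<Inter>i. {y. \<delta> < \<bar>peval (P i) y\<bar>})"
    by (intro open_INT open_Collect_less continuous_intros continuous_peval ballI) auto
  moreover have "v \<in> (\<Inter>i. {y. \<delta> < \<bar>peval (P i) y\<bar>})" using \<delta>v by auto
  ultimately obtain \<epsilon> where \<epsilon>: "\<epsilon> > 0" "ball v \<epsilon> \<subseteq> (\<Inter>i. {y. \<delta> < \<bar>peval (P i) y\<bar>})"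
    by (meson open_contains_ball)
  define R where "R = norm v + \<epsilon>"
  define C where "C = (\<Prod>i\<in>UNIV. \<delta> powr t i) * measure lborel (ball (0 :: real ^ 'n::{finite,linorder}) \<epsilon>)"
  define q where "q = \<delta>\<^sup>2 * exp (- (pi * R\<^sup>2))"
  have "C * q ^ N * fact N ^ d k \<le> real_zeta (t(k := t k + 2 * real N))" if N: "N \<ge> 1" for N
  proof -
    let ?\<tau> = "sqrt (real N)"
    let ?B = "ball (?\<tau> *\<^sub>R v) \<epsilon>"
    let ?c = "(\<Prod>i\<in>UNIV. \<delta> powr t i) * q ^ N * fact N ^ d k"
    have \<tau>: "?\<tau> \<ge> 1" "?\<tau> > 0" using N by auto
    have meas: "measure lborel ?B = measure lborel (ball (0 :: real ^ 'n::{finite,linorder}) \<epsilon>)"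
      using \<epsilon>(1) by (simp add: content_ball_conv_unit_ball[of \<epsilon> "?\<tau> *\<^sub>R v"] content_ball_conv_unit_ball[of \<epsilon> 0])
    have "C * q ^ N * fact N ^ d k = (LINT x|lborel. ?c * indicator ?B x)"
      by (simp add: C_def meas mult_ac)
    also have "\<dots> \<le> real_zeta (t(k := t k + 2 * real N))"
      unfolding real_zeta_def
    proof (rule integral_mono)
      show "integrable lborel (\<lambda>x. ?c * indicator ?B x)"
        by (intro integrable_mult_right integrable_real_indicator) (auto simp: emeasure_lborel_ball_finite[simplified])
      show "integrable lborel (\<lambda>x. abs_power P (t(k := t k + 2 * real N)) x * gauss x)"
        using t by (intro real_zeta_integrable) simp
      fix x
      show "?c * indicator ?B x \<le> abs_power P (t(k := t k + 2 * real N)) x * gauss x"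
      proof (cases "x \<in> ?B")
        case True
        define y where "y = (1 / ?\<tau>) *\<^sub>R x"
        have x: "x = ?\<tau> *\<^sub>R y" using \<tau> by (simp add: y_def)
        have dist: "?\<tau> * dist v y < \<epsilon>"
          using True \<tau> unfolding x by (simp add: dist_norm scaleR_diff_right[symmetric] del: scaleR_scaleR)
        have "1 * dist v y \<le> ?\<tau> * dist v y" using \<tau> by (intro mult_right_mono) auto
        then have "y \<in> ball v \<epsilon>" using dist by simp
        then have y\<delta>: "\<delta> < \<bar>peval (P i) y\<bar>" for i using \<epsilon>(2) by auto
        have Px: "\<bar>peval (P i) x\<bar> = ?\<tau> ^ d i * \<bar>peval (P i) y\<bar>" for i
          unfolding x peval_P_scaleR using \<tau> by (simp add: abs_mult)
        have ge\<delta>: "\<delta> \<le> \<bar>peval (P i) x\<bar>" for i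
        proof -
          have "1 * \<delta> \<le> ?\<tau> ^ d i * \<bar>peval (P i) y\<bar>"
            using y\<delta>[of i] \<tau> \<delta> by (intro mult_mono one_le_power) auto
          then show ?thesis unfolding Px by simp
        qed
        have 1: "(\<Prod>i\<in>UNIV. \<delta> powr t i) \<le> abs_power P t x"
          unfolding abs_power_def using ge\<delta> \<delta> t by (intro prod_mono conjI powr_mono2) auto
        have 2: "(\<delta>\<^sup>2) ^ N * fact N ^ d k \<le> peval (P k) x ^ (2 * N)"
        proof -
          have "(\<delta>\<^sup>2) ^ N * fact N ^ d k \<le> (\<delta>\<^sup>2) ^ N * (real N ^ N) ^ d k"
            using \<delta> fact_le_power[of N, where 'a = real] by (intro mult_left_mono power_mono) auto
          also have "\<dots> = (?\<tau> ^ d k * \<delta>) ^ (2 * N)"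
          proof -
            have sq: "(?\<tau> ^ d k)\<^sup>2 = real N ^ d k"
              by (metis power_mult mult.commute real_sqrt_pow2 of_nat_0_le_iff)
            have "(?\<tau> ^ d k * \<delta>) ^ (2 * N) = ((?\<tau> ^ d k)\<^sup>2 * \<delta>\<^sup>2) ^ N"
              by (simp only: power_mult power_mult_distrib)
            also have "\<dots> = (\<delta>\<^sup>2) ^ N * (real N ^ N) ^ d k"
              unfolding sq by (simp add: power_mult_distrib power_mult[symmetric] mult.commute)
            finally show ?thesis by simp
          qed
          also have "\<dots> \<le> \<bar>peval (P k) x\<bar> ^ (2 * N)"
            unfolding Px using y\<delta>[of k] \<delta> \<tau> by (intro power_mono mult_left_mono) auto
          also have "\<dots> = peval (P k) x ^ (2 * N)" by (simp add: power_even_abs)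
          finally show ?thesis .
        qed
        have 3: "exp (- (pi * R\<^sup>2)) ^ N \<le> gauss x"
        proof -
          have "norm x \<le> norm (?\<tau> *\<^sub>R v) + norm (x - ?\<tau> *\<^sub>R v)" by (rule norm_triangle_sub)
          also have "\<dots> \<le> ?\<tau> * norm v + ?\<tau> * \<epsilon>"
          proof -
            have "norm (x - ?\<tau> *\<^sub>R v) < \<epsilon>" using True by (simp add: dist_norm norm_minus_commute)
            moreover have "1 * \<epsilon> \<le> ?\<tau> * \<epsilon>" using \<tau>(1) \<epsilon>(1) by (intro mult_right_mono) auto
            moreover have "norm (?\<tau> *\<^sub>R v) = ?\<tau> * norm v" by simp
            ultimately show ?thesis by linarith
          qed
          finally have "norm x \<le> ?\<tau> * R" by (simp add: R_def distrib_left)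
          then have "(norm x)\<^sup>2 \<le> (?\<tau> * R)\<^sup>2" by (intro power_mono) auto
          then have "x \<bullet> x \<le> real N * R\<^sup>2" by (simp add: power2_norm_eq_inner power_mult_distrib)
          then have "pi * (x \<bullet> x) \<le> pi * (real N * R\<^sup>2)" by (intro mult_left_mono) auto
          then show ?thesis by (simp add: gauss_def exp_of_nat_mult[symmetric] mult_ac)
        qed
        have "?c = ((\<Prod>i\<in>UNIV. \<delta> powr t i) * ((\<delta>\<^sup>2) ^ N * fact N ^ d k)) * exp (- (pi * R\<^sup>2)) ^ N"
          by (simp add: q_def power_mult_distrib mult_ac)
        also have "\<dots> \<le> (abs_power P t x * peval (P k) x ^ (2 * N)) * gauss x"
          by (intro mult_mono 1 2 3 mult_nonneg_nonneg prod_nonneg) (auto simp: power_mult)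
        finally show ?thesis using True by (simp only: abs_power_update) (simp add: mult_ac)
      next
        case False
        then show ?thesis by (simp add: less_imp_le)
      qed
    qed
    finally show ?thesis .
  qed
  moreover have "C > 0"
    unfolding C_def using \<delta> \<epsilon>(1) by (intro mult_pos_pos prod_pos content_ball_pos) auto
  moreover have "q > 0" using \<delta> by (simp add: q_def)
  ultimately show ?thesis by blast
qed

end

context ore_sato_family
begin

text \<open>The degree of the \<open>b\<close>-function of the \<open>k\<close>-th unit vector in the variable \<open>s\<^sub>k\<close>, as read off from the Ore--Sato
  expression.\<close>

definition gamma_degree :: "'r \<Rightarrow> int" where
  "gamma_degree k = (\<Sum>i<l. \<Sum>j\<in>supp i. int (\<mu> i k) * z i j)"

lemma \<mu>_cases: "i < l \<Longrightarrow> \<mu> i k = 0 \<or> \<mu> i k = 1"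
  using \<mu>_le_1[of i k] by linarith

lemma \<beta>_eq:
  "\<beta> k t = c k * (\<Prod>i<l. \<Prod>j\<in>supp i. (lin i t + shift i j) powi (int (\<mu> i k) * z i j))"
  unfolding \<beta>_def
proof (intro arg_cong2[where f="(*)"] prod.cong refl)
  fix i j assume "i \<in> {..<l}"
  then have "\<mu> i k = 0 \<or> \<mu> i k = 1" using \<mu>_cases by simp
  then show "(\<Prod>\<nu><\<mu> i k. (lin i t + shift i j + real \<nu>) powi z i j) = (lin i t + shift i j) powi (int (\<mu> i k) * z i j)"
    by auto
qed

lemma powi_gamma_degree:
  assumes "x \<noteq> (0::real)"
  shows "x powi gamma_degree k = (\<Prod>i<l. \<Prod>j\<in>supp i. x powi (int (\<mu> i k) * z i j))"
  using assms by (simp add: gamma_degree_def prod_powi_eq_powi_sum)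

lemma \<beta>_growth:
  assumes t: "\<And>k. 0 \<le> t k"
  shows "\<exists>B>0. (\<lambda>N. \<beta> k (t(k := t k + 2 * real N)) / real N powi gamma_degree k) \<longlonglongrightarrow> B"
proof -
  let ?B = "c k * (\<Prod>i<l. \<Prod>j\<in>supp i. 2 powi (int (\<mu> i k) * z i j))"
  have "(\<lambda>N. c k * (\<Prod>i<l. \<Prod>j\<in>supp i.
      ((lin i t + real (\<mu> i k) * (2 * real N) + shift i j) / real N) powi (int (\<mu> i k) * z i j))) \<longlonglongrightarrow> ?B"
  proof (intro tendsto_mult tendsto_const tendsto_prod)
    fix i j assume i: "i \<in> {..<l}"
    show "(\<lambda>N. ((lin i t + real (\<mu> i k) * (2 * real N) + shift i j) / real N) powi (int (\<mu> i k) * z i j))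
      \<longlonglongrightarrow> 2 powi (int (\<mu> i k) * z i j)"
    proof (cases "\<mu> i k = 0")
      case False
      then have "\<mu> i k = 1" using \<mu>_cases[of i k] i by simp
      moreover have "(\<lambda>N. (lin i t + 2 * real N + shift i j) / real N) \<longlonglongrightarrow> 2"
      proof (rule Lim_transform_eventually)
        show "(\<lambda>N. 2 + (lin i t + shift i j) / real N) \<longlonglongrightarrow> 2"
          using tendsto_add[OF tendsto_const[of 2] lim_const_over_n[of "lin i t + shift i j"]] by simp
        show "\<forall>\<^sub>F N in sequentially. 2 + (lin i t + shift i j) / real N = (lin i t + 2 * real N + shift i j) / real N"
          using eventually_gt_at_top[of 0] by eventually_elim (simp add: field_simps)
      qed
      ultimately show ?thesis by (intro tendsto_power_int) auto
    qed simp
  qed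
  moreover have "\<forall>\<^sub>F N in sequentially. c k * (\<Prod>i<l. \<Prod>j\<in>supp i.
      ((lin i t + real (\<mu> i k) * (2 * real N) + shift i j) / real N) powi (int (\<mu> i k) * z i j)) =
      \<beta> k (t(k := t k + 2 * real N)) / real N powi gamma_degree k"
    using eventually_gt_at_top[of 0]
    by eventually_elim (simp add: \<beta>_eq lin_update powi_gamma_degree power_int_divide_distrib prod_dividef)
  ultimately have "(\<lambda>N. \<beta> k (t(k := t k + 2 * real N)) / real N powi gamma_degree k) \<longlonglongrightarrow> ?B"
    by (rule Lim_transform_eventually)
  moreover have "?B > 0" by (intro mult_pos_pos c_pos prod_pos zero_less_power_int ballI) auto
  ultimately show ?thesis by blast
qed

text \<open>The ratios of consecutive terms of \<open>Z(t + 2N e\<^sub>k) / N!\<^bsup>d\<^sub>k\<^esup>\<close> behave like \<open>N\<close> to the power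
  \<open>gamma_degree k - d k\<close>, but the sequence is bounded above and below by geometric ones.\<close>

lemma gamma_degree_eq_degree: "gamma_degree k = int (d k)"
proof -
  define t where "t = (\<lambda>_::'r. 2 * real CARD('n) + 1)"
  define T where "T N = t(k := t k + 2 * real N)" for N
  have t: "large t" by (simp add: large_def t_def)
  have T: "large (T N)" for N unfolding T_def by (intro large_update t) simp
  have Tpos: "\<And>i. 0 \<le> T N i" for N using T by (rule large_nonneg)
  define w where "w N = real_zeta (T N) / fact N ^ d k" for N
  have w: "w N > 0" for N unfolding w_def using real_zeta_pos[OF Tpos] by simp
  have T_Suc: "T (Suc N) = (T N)(k := T N k + 2)" for N by (auto simp: T_def fun_eq_iff)
  have ratio: "w (Suc N) / w N = \<beta> k (T N) / ((2 * pi) ^ d k * real (Suc N) ^ d k)" for N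
  proof -
    have "(fact (Suc N) :: real) ^ d k = real (Suc N) ^ d k * fact N ^ d k"
      by (simp only: fact_Suc of_nat_mult power_mult_distrib)
    then show ?thesis
      unfolding w_def T_Suc functional_equation[OF T] using real_zeta_pos[of "T N", OF Tpos]
      by (simp del: fact_Suc of_nat_Suc)
  qed
  obtain B where B: "B > 0" "(\<lambda>N. \<beta> k (T N) / real N powi gamma_degree k) \<longlonglongrightarrow> B"
    using \<beta>_growth[of t k, OF large_nonneg[OF t]] unfolding T_def by blast
  let ?g = "\<lambda>N. (\<beta> k (T N) / real N powi gamma_degree k) * (real N / real (Suc N)) ^ d k / (2 * pi) ^ d k"
  have lim1: "(\<lambda>N. ?g N)
      \<longlonglongrightarrow> B * 1 ^ d k / (2 * pi) ^ d k"
  proof (intro tendsto_intros B)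
    show "(\<lambda>N. real N / real (Suc N)) \<longlonglongrightarrow> 1" by real_asymp
  qed auto
  have eq: "w (Suc N) / w N = ?g N * real N powi (gamma_degree k - int (d k))"
    if "N > 0" for N
    unfolding ratio using that by (simp add: power_int_diff power_divide)
  have ev: "\<forall>\<^sub>F N in sequentially. w (Suc N) / w N = ?g N * real N powi (gamma_degree k - int (d k))"
    using eventually_gt_at_top[of 0] by eventually_elim (rule eq)
  have Bpos: "B * 1 ^ d k / (2 * pi) ^ d k > 0" using B by simp
  have powi_top: "filterlim (\<lambda>N. real N powi n) at_top sequentially" if "n > 0" for n :: int
  proof -
    have "filterlim (\<lambda>N. real N ^ nat n) at_top sequentially"
      using that by (intro filterlim_pow_at_top filterlim_real_sequentially) auto
    then show ?thesis using that by (simp add: power_int_def)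
  qed
  show ?thesis
  proof (rule ccontr)
    assume "gamma_degree k \<noteq> int (d k)"
    then consider "gamma_degree k - int (d k) > 0" | "int (d k) - gamma_degree k > 0" by linarith
    then show False
    proof cases
      case 1
      have "filterlim (\<lambda>N. ?g N * real N powi (gamma_degree k - int (d k))) at_top sequentially"
        by (rule filterlim_tendsto_pos_mult_at_top[OF lim1 Bpos powi_top[OF 1]])
      then have "filterlim (\<lambda>N. w (Suc N) / w N) at_top sequentially"
        by (subst filterlim_cong[OF refl refl ev])
      moreover obtain C q where "\<And>N. real_zeta (T N) \<le> C * q ^ N * fact N ^ d k"
        using zeta_growth_upper[of t k, OF large_nonneg[OF t]] unfolding T_def by blast
      then have "w N \<le> C * q ^ N" for N by (simp add: w_def field_simps)
      ultimately show False using ratio_at_top_not_geometric[of w C q] w by (meson not_less)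
    next
      case 2
      define w' where "w' N = 1 / w N" for N
      have eq': "w' (Suc N) / w' N = 1 / ?g N * real N powi (int (d k) - gamma_degree k)"
        if "N > 0" for N
      proof -
        have "w' (Suc N) / w' N = 1 / (w (Suc N) / w N)" by (simp add: w'_def)
        also have "\<dots> = 1 / ?g N * (1 / real N powi (gamma_degree k - int (d k)))"
          unfolding eq[OF that] by simp
        also have "1 / real N powi (gamma_degree k - int (d k)) = real N powi (int (d k) - gamma_degree k)"
          using power_int_minus[of "real N" "gamma_degree k - int (d k)"] by (simp add: divide_inverse)
        finally show ?thesis .
      qed
      have ev': "\<forall>\<^sub>F N in sequentially. w' (Suc N) / w' N = 1 / ?g N * real N powi (int (d k) - gamma_degree k)"
        using eventually_gt_at_top[of 0] by eventually_elim (rule eq')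
      have "filterlim (\<lambda>N. 1 / ?g N * real N powi (int (d k) - gamma_degree k)) at_top sequentially"
        by (rule filterlim_tendsto_pos_mult_at_top[OF tendsto_divide[OF tendsto_const lim1] _ powi_top[OF 2]]) (use B(1) in auto)
      then have "filterlim (\<lambda>N. w' (Suc N) / w' N) at_top sequentially"
        by (subst filterlim_cong[OF refl refl ev'])
      moreover obtain C q where Cq: "C > 0" "q > 0" "\<And>N. N \<ge> 1 \<Longrightarrow> C * q ^ N * fact N ^ d k \<le> real_zeta (T N)"
        using zeta_growth_lower[of t k, OF large_nonneg[OF t]] unfolding T_def by blast
      have "w' N \<le> (1 / C) * (1 / q) ^ N" if "N \<ge> 1" for N
      proof -
        have "C * q ^ N \<le> w N" using Cq(3)[OF that] by (simp add: w_def field_simps)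
        then have "1 / w N \<le> 1 / (C * q ^ N)" using Cq(1,2) by (intro divide_left_mono mult_pos_pos w) auto
        then show ?thesis by (simp add: w'_def power_divide)
      qed
      moreover have "w' N > 0" for N using w[of N] by (simp add: w'_def)
      ultimately show False using ratio_at_top_not_geometric[of w' "1 / C" "1 / q"] by (meson not_less)
    qed
  qed
qed

end

section \<open>Uniqueness of log-convex solutions of the functional equation\<close>

text \<open>The quotient of Gauss's limit formulas for \<open>\<Gamma>(y)\<close> and \<open>\<Gamma>(y + s)\<close>; the finite products there are
  quotients of Gamma values.\<close>

lemma Gamma_shift_asymptotics:
  fixes y s :: real
  assumes y: "y > 0" and s: "s \<ge> 0"
  shows "(\<lambda>N. Gamma (y + s + real (Suc N)) / (Gamma (y + real (Suc N)) * real N powr s)) \<longlonglongrightarrow> 1"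
proof -
  have G: "(\<lambda>N. Gamma_series z N / Gamma z) \<longlonglongrightarrow> 1" if "z > 0" for z :: real
    using tendsto_divide[OF Gamma_series_LIMSEQ[of z] tendsto_const[of "Gamma z"]] Gamma_real_pos[OF that]
    by simp
  have "(\<lambda>N. (Gamma_series y N / Gamma y) / (Gamma_series (y + s) N / Gamma (y + s))) \<longlonglongrightarrow> 1 / 1"
    using y s by (intro tendsto_divide G) auto
  moreover have "\<forall>\<^sub>F N in sequentially. (Gamma_series y N / Gamma y) / (Gamma_series (y + s) N / Gamma (y + s)) =
    Gamma (y + s + real (Suc N)) / (Gamma (y + real (Suc N)) * real N powr s)"
    using eventually_gt_at_top[of 0]
  proof eventually_elim
    case (elim N)
    have GG: "Gamma_series z N / Gamma z = fact N * real N powr z / Gamma (z + real (Suc N))" if "z > 0" for z :: real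
    proof -
      have "z \<notin> \<int>\<^sub>\<le>\<^sub>0" using that by (auto elim!: nonpos_Ints_cases)
      then have "pochhammer z (Suc N) = Gamma (z + real (Suc N)) / Gamma z"
        by (rule pochhammer_Gamma)
      then show ?thesis
        using elim Gamma_real_pos[OF that] by (simp add: Gamma_series_def powr_def del: of_nat_Suc)
    qed
    have "Gamma (y + s + real (Suc N)) > 0" "Gamma (y + real (Suc N)) > 0"
      using y s by (auto intro!: Gamma_real_pos)
    then show ?case
      using elim y s by (subst (1 2) GG) (auto simp: powr_add field_simps simp del: of_nat_Suc)
  qed
  ultimately show ?thesis using Lim_transform_eventually by force
qed

context multilinear_family
begin

text \<open>Hoelder's inequality. With the integrands divided by their integrals it reduces to
  Young's inequality at each point.\<close>

lemma real_zeta_log_convex: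
  assumes t: "\<And>k. 0 \<le> t k" "\<And>k. 0 \<le> u k" and \<theta>: "0 \<le> \<theta>" "\<theta> \<le> 1"
  shows "real_zeta (\<lambda>k. (1 - \<theta>) * t k + \<theta> * u k) \<le> real_zeta t powr (1 - \<theta>) * real_zeta u powr \<theta>"
proof -
  let ?v = "\<lambda>k. (1 - \<theta>) * t k + \<theta> * u k"
  let ?a = "real_zeta t" and ?b = "real_zeta u"
  have v: "0 \<le> ?v k" for k using t \<theta> by (intro add_nonneg_nonneg mult_nonneg_nonneg) auto
  have ab: "?a > 0" "?b > 0" using t by (auto intro: real_zeta_pos)
  have "real_zeta ?v / (?a powr (1 - \<theta>) * ?b powr \<theta>) =
    (LINT x|lborel. abs_power P ?v x * gauss x / (?a powr (1 - \<theta>) * ?b powr \<theta>))"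
    by (simp add: real_zeta_def)
  also have "\<dots> \<le> (LINT x|lborel. (1 - \<theta>) * (abs_power P t x * gauss x / ?a) + \<theta> * (abs_power P u x * gauss x / ?b))"
  proof (rule integral_mono_AE)
    show "integrable lborel (\<lambda>x. abs_power P ?v x * gauss x / (?a powr (1 - \<theta>) * ?b powr \<theta>))"
      by (intro integrable_divide real_zeta_integrable v)
    show "integrable lborel (\<lambda>x. (1 - \<theta>) * (abs_power P t x * gauss x / ?a) + \<theta> * (abs_power P u x * gauss x / ?b))"
      by (intro Bochner_Integration.integrable_add integrable_mult_right integrable_divide real_zeta_integrable t)
    show "AE x in lborel. abs_power P ?v x * gauss x / (?a powr (1 - \<theta>) * ?b powr \<theta>)
        \<le> (1 - \<theta>) * (abs_power P t x * gauss x / ?a) + \<theta> * (abs_power P u x * gauss x / ?b)"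
      using AE_P_nonzero
    proof eventually_elim
      case (elim x)
      have pos: "abs_power P t x > 0" "abs_power P u x > 0" using elim by (auto intro: abs_power_pos)
      have "abs_power P ?v x = abs_power P t x powr (1 - \<theta>) * abs_power P u x powr \<theta>"
        unfolding abs_power_def
        by (simp add: prod_powr_distrib powr_powr powr_add prod.distrib mult.commute)
      then have "abs_power P ?v x / (?a powr (1 - \<theta>) * ?b powr \<theta>) =
          (abs_power P t x / ?a) powr (1 - \<theta>) * (abs_power P u x / ?b) powr \<theta>"
        using ab pos by (simp add: powr_divide)
      also have "\<dots> \<le> (1 - \<theta>) * (abs_power P t x / ?a) + \<theta> * (abs_power P u x / ?b)"
        using \<theta> ab pos by (intro Youngs_inequality_0) auto
      finally have "abs_power P ?v x / (?a powr (1 - \<theta>) * ?b powr \<theta>) * gauss x \<le>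
          ((1 - \<theta>) * (abs_power P t x / ?a) + \<theta> * (abs_power P u x / ?b)) * gauss x"
        by (intro mult_right_mono) (auto simp: less_imp_le)
      then show ?case by (simp add: field_simps)
    qed
  qed
  also have "\<dots> = (1 - \<theta>) * (?a / ?a) + \<theta> * (?b / ?b)"
    unfolding real_zeta_def
    by (subst Bochner_Integration.integral_add)
       (auto intro!: integrable_mult_right integrable_divide real_zeta_integrable t)
  also have "\<dots> = 1" using ab by simp
  finally show ?thesis using ab by (simp add: field_simps)
qed

end

context ore_sato_family
begin

definition gamma_quot :: "nat \<Rightarrow> int \<Rightarrow> ('r \<Rightarrow> real) \<Rightarrow> real" where
  "gamma_quot i j t = Gamma ((lin i t + shift i j) / 2) / Gamma (shift i j / 2)"

text \<open>The right-hand side of the formula at real points.\<close>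

definition gamma_side :: "('r \<Rightarrow> real) \<Rightarrow> real" where
  "gamma_side t = (\<Prod>k\<in>UNIV. (pi powr (- real (d k)) * c k) powr (t k / 2)) *
    (\<Prod>i<l. \<Prod>j\<in>supp i. gamma_quot i j t powi z i j)"

lemma gamma_quot_pos:
  assumes "\<And>k. 0 \<le> t k" "i < l" "j \<in> supp i"
  shows "gamma_quot i j t > 0"
  unfolding gamma_quot_def using lin_nonneg[of t i, OF assms(1)] shift_props(3)[OF assms(2,3)]
  by (intro divide_pos_pos Gamma_real_pos) auto

lemma gamma_side_pos:
  assumes "\<And>k. 0 \<le> t k"
  shows "gamma_side t > 0"
  unfolding gamma_side_def
  by (intro mult_pos_pos prod_pos zero_less_power_int gamma_quot_pos assms) (auto simp: c_pos less_imp_neq[OF c_pos, THEN not_sym])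

lemma gamma_side_update:
  "gamma_side (t(k := t k + \<tau>)) =
   (pi powr (- real (d k)) * c k) powr (\<tau> / 2) * (\<Prod>k\<in>UNIV. (pi powr (- real (d k)) * c k) powr (t k / 2)) *
   (\<Prod>i<l. \<Prod>j\<in>supp i. (Gamma ((lin i t + shift i j) / 2 + real (\<mu> i k) * (\<tau> / 2)) / Gamma (shift i j / 2)) powi z i j)"
proof -
  have "(\<Prod>k'\<in>UNIV. (pi powr (- real (d k')) * c k') powr ((t(k := t k + \<tau>)) k' / 2)) =
    (pi powr (- real (d k)) * c k) powr (\<tau> / 2) * (\<Prod>k\<in>UNIV. (pi powr (- real (d k)) * c k) powr (t k / 2))"
    by (subst (1 2) prod.remove[of UNIV k]) (auto simp: add_divide_distrib powr_add)
  then show ?thesis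
    unfolding gamma_side_def gamma_quot_def lin_update by (simp add: add_divide_distrib add_ac)
qed

text \<open>Where \<open>\<mu>\<^sub>i\<^sub>k = 1\<close> the argument of the Gamma function increases by \<open>1\<close> and the factor
  \<open>(\<mu>\<^sub>i(t) + \<alpha>\<^sub>i + j) / 2\<close> comes out. The halves multiply to \<open>2\<^bsup>-d\<^sub>k\<^esup>\<close> because \<open>d\<^sub>k\<close> is the degree of the
  \<open>b\<close>-function; a coefficient \<open>\<mu>\<^sub>i\<^sub>k \<ge> 2\<close> would produce the wrong factors.\<close>

lemma gamma_side_functional_equation:
  assumes t: "\<And>k. 0 \<le> t k"
  shows "gamma_side (t(k := t k + 2)) = \<beta> k t / (2 * pi) ^ d k * gamma_side t"
proof -
  let ?y = "\<lambda>i j. (lin i t + shift i j) / 2"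
  let ?pw = "\<Prod>i<l. \<Prod>j\<in>supp i. (lin i t + shift i j) powi (int (\<mu> i k) * z i j)"
  let ?gq = "\<Prod>i<l. \<Prod>j\<in>supp i. gamma_quot i j t powi z i j"
  let ?gg = "\<Prod>i<l. \<Prod>j\<in>supp i. (Gamma (?y i j + real (\<mu> i k) * (2 / 2)) / Gamma (shift i j / 2)) powi z i j"
  have fac: "(Gamma (?y i j + real (\<mu> i k) * (2 / 2)) / Gamma (shift i j / 2)) powi z i j =
     (lin i t + shift i j) powi (int (\<mu> i k) * z i j) * gamma_quot i j t powi z i j / 2 powi (int (\<mu> i k) * z i j)"
    if "i < l" "j \<in> supp i" for i j
  proof (cases "\<mu> i k = 0")
    case False
    then have \<mu>: "\<mu> i k = 1" using \<mu>_cases[OF that(1), of k] by simp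
    have y: "?y i j > 0" using lin_nonneg[of t i, OF t] shift_props(3)[OF that] by simp
    then have "Gamma (?y i j + 1) = ?y i j * Gamma (?y i j)"
      using Gamma_plus1[of "?y i j"] nonpos_Ints_nonpos[of "?y i j"] by linarith
    then have g: "Gamma (?y i j + real (\<mu> i k) * (2 / 2)) / Gamma (shift i j / 2) = (lin i t + shift i j) * gamma_quot i j t / 2"
    proof -
      assume "Gamma (?y i j + 1) = ?y i j * Gamma (?y i j)"
      then have "Gamma (?y i j + real (\<mu> i k) * (2 / 2)) = ?y i j * Gamma (?y i j)" by (simp add: \<mu>)
      then show ?thesis by (simp only: gamma_quot_def) simp
    qed
    show ?thesis
      unfolding g by (simp add: \<mu> power_int_mult_distrib power_int_divide_distrib)
  qed (simp add: gamma_quot_def)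
  have "?gg =
    (\<Prod>i<l. \<Prod>j\<in>supp i. (lin i t + shift i j) powi (int (\<mu> i k) * z i j) * gamma_quot i j t powi z i j / 2 powi (int (\<mu> i k) * z i j))"
    by (intro prod.cong refl fac) auto
  also have "\<dots> = ?pw *
    ?gq / (\<Prod>i<l. \<Prod>j\<in>supp i. 2 powi (int (\<mu> i k) * z i j))"
    by (simp only: prod.distrib prod_dividef)
  finally have pr: "?gg =
    ?pw *
    ?gq / (\<Prod>i<l. \<Prod>j\<in>supp i. 2 powi (int (\<mu> i k) * z i j))" .
  have "gamma_side (t(k := t k + 2)) = (pi powr (- real (d k)) * c k) powr (2 / 2) * (\<Prod>k\<in>UNIV. (pi powr (- real (d k)) * c k) powr (t k / 2)) *
    (?pw * ?gq / (\<Prod>i<l. \<Prod>j\<in>supp i. 2 powi (int (\<mu> i k) * z i j)))"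
    unfolding gamma_side_update pr ..
  also have "(\<Prod>i<l. \<Prod>j\<in>supp i. 2 powi (int (\<mu> i k) * z i j)) = (2::real) ^ d k"
    using powi_gamma_degree[of 2 k] by (simp add: gamma_degree_eq_degree)
  also have "(pi powr (- real (d k)) * c k) powr (2 / 2) = c k / pi ^ d k"
    using c_pos[of k] by (simp add: powr_minus powr_realpow divide_inverse)
  finally show ?thesis
    unfolding gamma_side_def[of t] \<beta>_eq power_mult_distrib by (elim trans) (simp add: mult_ac)
qed

text \<open>The base of the exponential function of \<open>\<tau>\<close> to which \<open>\<tau> \<mapsto> gamma_side (t + (\<tau> + 2N) e\<^sub>k)\<close> is asymptotic, up
  to a factor independent of \<open>\<tau>\<close>.\<close>

definition scale :: "'r \<Rightarrow> nat \<Rightarrow> real" where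
  "scale k N = (pi powr (- real (d k)) * c k) powr (1 / 2) * real N powr (real (d k) / 2)"

lemma scale_pos: "N > 0 \<Longrightarrow> scale k N > 0"
  using c_pos[of k] by (simp add: scale_def)

lemma gamma_side_growth:
  assumes t: "\<And>k. 0 \<le> t k" and \<tau>: "\<tau> \<ge> 0"
  shows "(\<lambda>N. gamma_side (t(k := t k + (\<tau> + 2 * real (Suc N)))) / gamma_side (t(k := t k + 2 * real (Suc N))) / scale k N powr \<tau>) \<longlonglongrightarrow> 1"
proof -
  let ?y = "\<lambda>i j. (lin i t + shift i j) / 2"
  let ?g = "\<lambda>N i j. Gamma (?y i j + \<tau> / 2 + real (Suc N)) / (Gamma (?y i j + real (Suc N)) * real N powr (\<tau> / 2))"
  have y: "?y i j > 0" if "i < l" "j \<in> supp i" for i j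
    using lin_nonneg[of t i, OF t] shift_props(3)[OF that] by simp
  have "(\<lambda>N. \<Prod>i<l. \<Prod>j\<in>supp i. ?g N i j powi (int (\<mu> i k) * z i j)) \<longlonglongrightarrow>
      (\<Prod>i<l. \<Prod>j\<in>supp i. 1 powi (int (\<mu> i k) * z i j))"
    using y \<tau> by (intro tendsto_prod tendsto_power_int Gamma_shift_asymptotics) auto
  moreover have "\<forall>\<^sub>F N in sequentially. (\<Prod>i<l. \<Prod>j\<in>supp i. ?g N i j powi (int (\<mu> i k) * z i j)) =
     gamma_side (t(k := t k + (\<tau> + 2 * real (Suc N)))) / gamma_side (t(k := t k + 2 * real (Suc N))) / scale k N powr \<tau>"
    using eventually_gt_at_top[of 0]
  proof eventually_elim
    case (elim N)
    let ?G1 = "\<lambda>i j. Gamma (?y i j + real (\<mu> i k) * ((\<tau> + 2 * real (Suc N)) / 2))"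
    let ?G2 = "\<lambda>i j. Gamma (?y i j + real (\<mu> i k) * (2 * real (Suc N) / 2)) / Gamma (shift i j / 2)"
    let ?a = "pi powr (- real (d k)) * c k"
    have a: "?a > 0" using c_pos by simp
    have fac: "(?G1 i j / Gamma (shift i j / 2)) powi z i j =
      ?G2 i j powi z i j *
      ?g N i j powi (int (\<mu> i k) * z i j) * (real N powr (\<tau> / 2)) powi (int (\<mu> i k) * z i j)"
      if ij: "i < l" "j \<in> supp i" for i j
    proof (cases "\<mu> i k = 0")
      case False
      then have \<mu>: "\<mu> i k = 1" using \<mu>_cases[OF ij(1), of k] by simp
      have pos: "Gamma (?y i j + real (Suc N)) > 0" using y[OF ij] by (intro Gamma_real_pos add_pos_pos) auto
      have N: "real N powr (\<tau> / 2) > 0" using elim by simp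
      have half: "(\<tau> + 2 * real (Suc N)) / 2 = \<tau> / 2 + real (Suc N)" "2 * real (Suc N) / 2 = real (Suc N)"
        by simp_all
      have "?G1 i j = Gamma (?y i j + \<tau> / 2 + real (Suc N))"
        unfolding \<mu> half of_nat_1 mult_1_left add.assoc ..
      also have "\<dots> = Gamma (?y i j + real (Suc N)) * ?g N i j * real N powr (\<tau> / 2)"
        using pos N by (simp del: of_nat_Suc)
      finally have "?G1 i j / Gamma (shift i j / 2) =
        ?G2 i j * ?g N i j * real N powr (\<tau> / 2)"
        unfolding \<mu> half of_nat_1 mult_1_left by simp
      then show ?thesis by (simp only: power_int_mult_distrib \<mu> of_nat_1 mult_1_left)
    qed simp
    let ?P = "\<Prod>k\<in>UNIV. (pi powr (- real (d k)) * c k) powr (t k / 2)"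
    let ?Q = "\<Prod>i<l. \<Prod>j\<in>supp i. ?G2 i j powi z i j"
    let ?E = "\<Prod>i<l. \<Prod>j\<in>supp i. ?g N i j powi (int (\<mu> i k) * z i j)"
    have sc: "scale k N powr \<tau> = (?a powr (1 / 2)) powr \<tau> * (real N powr (real (d k) / 2)) powr \<tau>"
      unfolding scale_def by (rule powr_mult)
    have R1: "gamma_side (t(k := t k + 2 * real (Suc N))) = ?a powr (2 * real (Suc N) / 2) * ?P * ?Q"
      by (rule gamma_side_update)
    have "gamma_side (t(k := t k + (\<tau> + 2 * real (Suc N)))) = ?a powr ((\<tau> + 2 * real (Suc N)) / 2) * ?P *
      (\<Prod>i<l. \<Prod>j\<in>supp i. (?G1 i j / Gamma (shift i j / 2)) powi z i j)"
      by (rule gamma_side_update)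
    also have "(\<Prod>i<l. \<Prod>j\<in>supp i. (?G1 i j / Gamma (shift i j / 2)) powi z i j)
       = (\<Prod>i<l. \<Prod>j\<in>supp i. ?G2 i j powi z i j *
          ?g N i j powi (int (\<mu> i k) * z i j) * (real N powr (\<tau> / 2)) powi (int (\<mu> i k) * z i j))"
      by (intro prod.cong refl fac) auto
    also have "\<dots> = ?Q * ?E * (real N powr (\<tau> / 2)) powi gamma_degree k"
      using elim by (simp add: prod.distrib powi_gamma_degree)
    also have "(real N powr (\<tau> / 2)) powi gamma_degree k = (real N powr (real (d k) / 2)) powr \<tau>"
      using elim by (simp add: gamma_degree_eq_degree powr_powr powr_realpow[symmetric] mult_ac)
    also have "?a powr ((\<tau> + 2 * real (Suc N)) / 2) = (?a powr (1 / 2)) powr \<tau> * ?a powr (2 * real (Suc N) / 2)"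
      using a by (simp add: powr_powr add_divide_distrib powr_add)
    finally have "gamma_side (t(k := t k + (\<tau> + 2 * real (Suc N)))) =
       ?E * scale k N powr \<tau> * gamma_side (t(k := t k + 2 * real (Suc N)))"
      unfolding R1 sc by (simp only: mult_ac)
    moreover have "gamma_side (t(k := t k + 2 * real (Suc N))) > 0"
      by (intro gamma_side_pos) (use t in auto)
    moreover have "scale k N powr \<tau> > 0" using scale_pos[OF elim, of k] by simp
    ultimately show ?case by simp
  qed
  ultimately have "(\<lambda>N. gamma_side (t(k := t k + (\<tau> + 2 * real (Suc N)))) / gamma_side (t(k := t k + 2 * real (Suc N))) / scale k N powr \<tau>)
    \<longlonglongrightarrow> (\<Prod>i<l. \<Prod>j\<in>supp i. 1 powi (int (\<mu> i k) * z i j))"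
    by (rule Lim_transform_eventually)
  then show ?thesis by simp
qed

definition zeta_ratio :: "('r \<Rightarrow> real) \<Rightarrow> real" where "zeta_ratio t = real_zeta t / gamma_side t"

lemma zeta_ratio_pos: "(\<And>k. 0 \<le> t k) \<Longrightarrow> zeta_ratio t > 0"
  by (simp add: zeta_ratio_def gamma_side_pos real_zeta_pos)

lemma zeta_ratio_periodic: "large t \<Longrightarrow> zeta_ratio (t(k := t k + 2 * real N)) = zeta_ratio t"
proof (induction N)
  case (Suc N)
  let ?t = "t(k := t k + 2 * real N)"
  have T: "large ?t" by (rule large_update[OF Suc.prems]) simp
  have "t(k := t k + 2 * real (Suc N)) = ?t(k := ?t k + 2)" by (auto simp: fun_eq_iff)
  then have "zeta_ratio (t(k := t k + 2 * real (Suc N))) = zeta_ratio (?t(k := ?t k + 2))" by simp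
  also have "\<dots> = zeta_ratio ?t"
    unfolding zeta_ratio_def functional_equation[OF T] gamma_side_functional_equation[of ?t, OF large_nonneg[OF T]]
    using \<beta>_pos[of ?t k, OF large_nonneg[OF T]] by simp
  finally have "zeta_ratio (t(k := t k + 2 * real (Suc N))) = zeta_ratio ?t" .
  then show ?case using Suc.IH[OF Suc.prems] by (rule trans)
qed simp

text \<open>The increments are moved by \<open>2(N + 1)\<close>, which does not change \<open>zeta_ratio\<close>. There \<open>gamma_side\<close> is an
  exponential function up to a factor \<open>\<rho>\<close> that tends to \<open>1\<close>, and exponential functions satisfy the
  convexity inequality with equality; so dividing them out of the inequality for \<open>Z\<close> leaves an
  inequality for \<open>zeta_ratio\<close> as \<open>N \<rightarrow> \<infinity>\<close>.\<close>

lemma zeta_ratio_log_convex: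
  assumes t: "large t" and xy: "0 \<le> x" "0 \<le> y" and \<theta>: "0 \<le> \<theta>" "\<theta> \<le> 1"
  shows "zeta_ratio (t(k := t k + ((1 - \<theta>) * x + \<theta> * y))) \<le> zeta_ratio (t(k := t k + x)) powr (1 - \<theta>) * zeta_ratio (t(k := t k + y)) powr \<theta>"
proof -
  let ?m = "(1 - \<theta>) * x + \<theta> * y"
  have m: "?m \<ge> 0" using xy \<theta> by simp
  define T where "T \<tau> N = t(k := t k + (\<tau> + 2 * real (Suc N)))" for \<tau> N
  define \<rho> where "\<rho> \<tau> N = gamma_side (T \<tau> N) / gamma_side (t(k := t k + 2 * real (Suc N))) / scale k N powr \<tau>" for \<tau> N
  let ?f = "\<lambda>\<tau>. zeta_ratio (t(k := t k + \<tau>))"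
  have t0: "\<And>k. 0 \<le> t k" using large_nonneg[OF t] .
  have \<rho>: "\<rho> \<tau> \<longlonglongrightarrow> 1" if "\<tau> \<ge> 0" for \<tau>
    using gamma_side_growth[of t \<tau> k, OF t0 that] unfolding \<rho>_def T_def .
  have T0: "0 \<le> T \<tau> N k'" if "\<tau> \<ge> 0" for \<tau> N k' using t0 that by (simp add: T_def)
  have fpos: "?f \<tau> > 0" if "\<tau> \<ge> 0" for \<tau> using t0 that by (intro zeta_ratio_pos) simp
  have FT: "zeta_ratio (T \<tau> N) = ?f \<tau>" if "\<tau> \<ge> 0" for \<tau> N
  proof -
    have "T \<tau> N = (t(k := t k + \<tau>))(k := (t(k := t k + \<tau>)) k + 2 * real (Suc N))"
      by (simp add: T_def add.assoc)
    then show ?thesis using zeta_ratio_periodic[OF large_update[OF t that], of k k "Suc N"] by simp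
  qed
  have ineq: "?f ?m * \<rho> ?m N \<le> (?f x * \<rho> x N) powr (1 - \<theta>) * (?f y * \<rho> y N) powr \<theta>" if N: "N > 0" for N
  proof -
    let ?S = "gamma_side (t(k := t k + 2 * real (Suc N)))" and ?b = "scale k N"
    have S: "?S > 0" by (intro gamma_side_pos) (use t0 in auto)
    have b: "?b > 0" using scale_pos[OF N] .
    have Z: "real_zeta (T \<tau> N) = (?f \<tau> * \<rho> \<tau> N) * (?S * ?b powr \<tau>)" if "\<tau> \<ge> 0" for \<tau>
    proof -
      have "real_zeta (T \<tau> N) = zeta_ratio (T \<tau> N) * gamma_side (T \<tau> N)"
        using gamma_side_pos[of "T \<tau> N", OF T0[OF that]] by (simp add: zeta_ratio_def)
      also have "gamma_side (T \<tau> N) = \<rho> \<tau> N * (?S * ?b powr \<tau>)" using S b by (simp add: \<rho>_def del: of_nat_Suc)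
      finally show ?thesis using FT[OF that] by (simp add: mult_ac)
    qed
    have \<rho>pos: "\<rho> \<tau> N > 0" if "\<tau> \<ge> 0" for \<tau>
      using gamma_side_pos[of "T \<tau> N", OF T0[OF that]] S b by (simp add: \<rho>_def del: of_nat_Suc)
    have Tm: "T ?m N = (\<lambda>k'. (1 - \<theta>) * T x N k' + \<theta> * T y N k')"
      by (auto simp: T_def fun_eq_iff algebra_simps)
    have "real_zeta (T ?m N) \<le> real_zeta (T x N) powr (1 - \<theta>) * real_zeta (T y N) powr \<theta>"
      unfolding Tm by (rule real_zeta_log_convex) (use T0 xy \<theta> in auto)
    then have "(?f ?m * \<rho> ?m N) * (?S * ?b powr ?m) \<le>
      ((?f x * \<rho> x N) * (?S * ?b powr x)) powr (1 - \<theta>) * ((?f y * \<rho> y N) * (?S * ?b powr y)) powr \<theta>"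
      unfolding Z[OF m] Z[OF xy(1)] Z[OF xy(2)] .
    also have "\<dots> = ((?f x * \<rho> x N) powr (1 - \<theta>) * (?f y * \<rho> y N) powr \<theta>) * (?S * ?b powr ?m)"
    proof -
      have "(?S * ?b powr x) powr (1 - \<theta>) * (?S * ?b powr y) powr \<theta> = (?S powr (1 - \<theta>) * ?S powr \<theta>) * (?b powr ((1 - \<theta>) * x) * ?b powr (\<theta> * y))"
        using S b by (simp add: powr_mult powr_powr mult_ac del: of_nat_Suc)
      also have "\<dots> = ?S * ?b powr ?m" using S by (simp add: powr_add[symmetric] del: of_nat_Suc)
      finally have *: "(?S * ?b powr x) powr (1 - \<theta>) * (?S * ?b powr y) powr \<theta> = ?S * ?b powr ?m" .
      have "((?f x * \<rho> x N) * (?S * ?b powr x)) powr (1 - \<theta>) * ((?f y * \<rho> y N) * (?S * ?b powr y)) powr \<theta> =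
        ((?f x * \<rho> x N) powr (1 - \<theta>) * (?f y * \<rho> y N) powr \<theta>) * ((?S * ?b powr x) powr (1 - \<theta>) * (?S * ?b powr y) powr \<theta>)"
        using fpos[OF xy(1)] fpos[OF xy(2)] \<rho>pos[OF xy(1)] \<rho>pos[OF xy(2)] S b
        by (subst (1 2) powr_mult) (auto simp: mult_ac less_imp_le)
      then show ?thesis unfolding * .
    qed
    finally show ?thesis
      by (rule mult_right_le_imp_le) (intro mult_pos_pos S, use b in simp)
  qed
  have "(\<lambda>N. ?f ?m * \<rho> ?m N) \<longlonglongrightarrow> ?f ?m * 1"
    by (intro tendsto_intros \<rho> m)
  moreover have "(\<lambda>N. (?f x * \<rho> x N) powr (1 - \<theta>) * (?f y * \<rho> y N) powr \<theta>) \<longlonglongrightarrow>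
      (?f x * 1) powr (1 - \<theta>) * (?f y * 1) powr \<theta>"
    using fpos[OF xy(1)] fpos[OF xy(2)] by (intro tendsto_intros \<rho> xy) auto
  ultimately have "?f ?m * 1 \<le> (?f x * 1) powr (1 - \<theta>) * (?f y * 1) powr \<theta>"
    by (rule LIMSEQ_le) (use ineq in \<open>auto intro!: exI[of _ 1]\<close>)
  then show ?thesis by simp
qed

text \<open>A periodic log-convex function is constant. The upper bound is convexity between \<open>0\<close> and \<open>2\<close>;
  the lower bound is convexity at \<open>2\<close>, between \<open>\<tau>\<close> and \<open>4\<close>.\<close>

lemma zeta_ratio_const_period:
  assumes t: "large t" and \<tau>: "0 \<le> \<tau>" "\<tau> \<le> 2"
  shows "zeta_ratio (t(k := t k + \<tau>)) = zeta_ratio t"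
proof -
  let ?f = "\<lambda>\<tau>. zeta_ratio (t(k := t k + \<tau>))"
  have f0: "?f 0 = zeta_ratio t" by simp
  have f2: "?f 2 = zeta_ratio t" using zeta_ratio_periodic[OF t, of k 1] by simp
  have f4: "?f 4 = zeta_ratio t" using zeta_ratio_periodic[OF t, of k 2] by simp
  have pos: "zeta_ratio t > 0" using large_nonneg[OF t] by (rule zeta_ratio_pos)
  have fpos: "?f \<tau> > 0" using large_nonneg[OF t] \<tau> by (intro zeta_ratio_pos) simp
  have le: "?f \<tau> \<le> zeta_ratio t"
  proof -
    have "?f ((1 - \<tau> / 2) * 0 + (\<tau> / 2) * 2) \<le> ?f 0 powr (1 - \<tau> / 2) * ?f 2 powr (\<tau> / 2)"
      by (rule zeta_ratio_log_convex[OF t]) (use \<tau> in auto)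
    then have "?f \<tau> \<le> zeta_ratio t powr (1 - \<tau> / 2) * zeta_ratio t powr (\<tau> / 2)" unfolding f2 by simp
    also have "\<dots> = zeta_ratio t" using pos by (simp add: powr_add[symmetric])
    finally show ?thesis .
  qed
  have ge: "zeta_ratio t \<le> ?f \<tau>"
  proof (cases "\<tau> = 2")
    case False
    define \<theta> where "\<theta> = (2 - \<tau>) / (4 - \<tau>)"
    have \<theta>: "0 \<le> \<theta>" "\<theta> < 1" using \<tau> False by (auto simp: \<theta>_def field_simps)
    have comb: "(1 - \<theta>) * \<tau> + \<theta> * 4 = 2"
    proof -
      have "\<theta> * (4 - \<tau>) = 2 - \<tau>" using \<tau> by (simp add: \<theta>_def)
      then show ?thesis by (simp add: algebra_simps)
    qed
    have "?f ((1 - \<theta>) * \<tau> + \<theta> * 4) \<le> ?f \<tau> powr (1 - \<theta>) * ?f 4 powr \<theta>"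
      by (rule zeta_ratio_log_convex[OF t]) (use \<tau> \<theta> in auto)
    then have "zeta_ratio t \<le> ?f \<tau> powr (1 - \<theta>) * zeta_ratio t powr \<theta>" unfolding comb f2 f4 .
    moreover have "zeta_ratio t = zeta_ratio t powr (1 - \<theta>) * zeta_ratio t powr \<theta>" using pos by (simp add: powr_add[symmetric])
    ultimately have "zeta_ratio t powr (1 - \<theta>) * zeta_ratio t powr \<theta> \<le> ?f \<tau> powr (1 - \<theta>) * zeta_ratio t powr \<theta>" by simp
    then have "zeta_ratio t powr (1 - \<theta>) \<le> ?f \<tau> powr (1 - \<theta>)" using pos by simp
    then show ?thesis using powr_less_mono2[of "1 - \<theta>" "?f \<tau>" "zeta_ratio t"] \<theta> fpos by linarith
  qed (use f2 in simp)
  show ?thesis using le ge by simp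
qed

lemma zeta_ratio_const_direction:
  assumes t: "large t" and \<tau>: "0 \<le> \<tau>"
  shows "zeta_ratio (t(k := t k + \<tau>)) = zeta_ratio t"
proof -
  define N where "N = nat \<lfloor>\<tau> / 2\<rfloor>"
  define \<sigma> where "\<sigma> = \<tau> - 2 * real N"
  have "real N = of_int \<lfloor>\<tau> / 2\<rfloor>" using \<tau> by (simp add: N_def)
  then have \<sigma>: "0 \<le> \<sigma>" "\<sigma> \<le> 2"
    unfolding \<sigma>_def by linarith+
  let ?t = "t(k := t k + \<sigma>)"
  have "t(k := t k + \<tau>) = ?t(k := ?t k + 2 * real N)" by (simp add: \<sigma>_def)
  then have "zeta_ratio (t(k := t k + \<tau>)) = zeta_ratio ?t" using zeta_ratio_periodic[OF large_update[OF t \<sigma>(1)], of k k N] by simp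
  then show ?thesis using zeta_ratio_const_period[OF t \<sigma>] by simp
qed

lemma zeta_ratio_const_le:
  assumes t: "large t" and le: "\<And>k. t k \<le> u k"
  shows "zeta_ratio u = zeta_ratio t"
proof -
  have "zeta_ratio (\<lambda>k. if k \<in> S then u k else t k) = zeta_ratio t" if "finite S" for S
    using that
  proof (induction S rule: finite_induct)
    case (insert k S)
    let ?t = "\<lambda>k. if k \<in> S then u k else t k"
    have eq: "(\<lambda>k'. if k' \<in> insert k S then u k' else t k') = ?t(k := ?t k + (u k - t k))"
      using insert.hyps by (auto simp: fun_eq_iff)
    have "large ?t" using t le unfolding large_def by (auto intro: less_le_trans)
    then have "zeta_ratio (?t(k := ?t k + (u k - t k))) = zeta_ratio ?t"
      by (rule zeta_ratio_const_direction) (use le[of k] in simp)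
    then show ?case unfolding eq using insert.IH by (rule trans)
  qed simp
  from this[of UNIV] show ?thesis by simp
qed

lemma real_zeta_eq_const_R:
  obtains C where "\<And>t. large t \<Longrightarrow> real_zeta t = C * gamma_side t"
proof
  let ?t0 = "\<lambda>_::'r. 2 * real CARD('n) + 1"
  fix t assume t: "large t"
  have "zeta_ratio (\<lambda>k. max (t k) (?t0 k)) = zeta_ratio t" by (rule zeta_ratio_const_le[OF t]) simp
  moreover have "zeta_ratio (\<lambda>k. max (t k) (?t0 k)) = zeta_ratio ?t0"
    by (rule zeta_ratio_const_le) (auto simp: large_def)
  ultimately have "zeta_ratio t = zeta_ratio ?t0" by simp
  then show "real_zeta t = zeta_ratio ?t0 * gamma_side t"
    using gamma_side_pos[of t, OF large_nonneg[OF t]] by (simp add: zeta_ratio_def field_simps)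
qed

end

section \<open>Holomorphy of the zeta integral along complex lines\<close>

lemma mv_holomorphic_on_const: "mv_holomorphic_on (\<lambda>s. c) D"
  unfolding mv_holomorphic_on_def by (intro ballI exI[of _ "\<lambda>_. 0"]) auto

lemma mv_holomorphic_on_nth: "mv_holomorphic_on (\<lambda>s. s $ k) D"
  unfolding mv_holomorphic_on_def
  by (intro ballI exI[of _ "\<lambda>v. v $ k"] conjI bounded_linear_imp_has_derivative) auto

lemma mv_holomorphic_on_linform: "mv_holomorphic_on (linform \<mu>) D"
  unfolding mv_holomorphic_on_def
proof (intro ballI exI[of _ "linform \<mu>"] conjI allI)
  show "linform \<mu> (a *s v) = a * linform \<mu> v" for a v
    by (simp add: linform_def sum_distrib_left mult_ac)
  have "bounded_linear (linform \<mu>)"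
    unfolding linform_def[abs_def]
    by (intro bounded_linear_sum bounded_linear_const_mult bounded_linear_vec_nth)
  then show "(linform \<mu> has_derivative linform \<mu>) (at s)" for s
    by (rule bounded_linear_imp_has_derivative)
qed

lemma mv_holomorphic_on_mult:
  assumes "mv_holomorphic_on f D" "mv_holomorphic_on g D"
  shows "mv_holomorphic_on (\<lambda>s. f s * g s) D"
  unfolding mv_holomorphic_on_def
proof
  fix s assume s: "s \<in> D"
  obtain f' where f': "(f has_derivative f') (at s)" "\<And>a v. f' (a *s v) = a * f' v"
    using assms(1) s unfolding mv_holomorphic_on_def by blast
  obtain g' where g': "(g has_derivative g') (at s)" "\<And>a v. g' (a *s v) = a * g' v"
    using assms(2) s unfolding mv_holomorphic_on_def by blast
  show "\<exists>h'. ((\<lambda>s. f s * g s) has_derivative h') (at s) \<and> (\<forall>a v. h' (a *s v) = a * h' v)"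
    using has_derivative_mult[OF f'(1) g'(1)] f'(2) g'(2)
    by (intro exI conjI allI) (assumption, simp add: algebra_simps)
qed

lemma mv_holomorphic_on_prod:
  assumes "\<And>i. i \<in> I \<Longrightarrow> mv_holomorphic_on (f i) D"
  shows "mv_holomorphic_on (\<lambda>s. \<Prod>i\<in>I. f i s) D"
  using assms
  by (induction I rule: infinite_finite_induct)
     (auto intro: mv_holomorphic_on_const mv_holomorphic_on_mult)

lemma mv_holomorphic_on_compose:
  assumes "mv_holomorphic_on f D" "\<And>s. s \<in> D \<Longrightarrow> \<phi> field_differentiable (at (f s))"
  shows "mv_holomorphic_on (\<lambda>s. \<phi> (f s)) D"
  unfolding mv_holomorphic_on_def
proof
  fix s assume s: "s \<in> D"
  obtain f' where f': "(f has_derivative f') (at s)" "\<And>a v. f' (a *s v) = a * f' v"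
    using assms(1) s unfolding mv_holomorphic_on_def by blast
  obtain c where c: "(\<phi> has_field_derivative c) (at (f s))"
    using assms(2)[OF s] by (auto simp: field_differentiable_def)
  show "\<exists>h'. ((\<lambda>s. \<phi> (f s)) has_derivative h') (at s) \<and> (\<forall>a v. h' (a *s v) = a * h' v)"
    using has_derivative_compose[OF f'(1) c[unfolded has_field_derivative_def]] f'(2)
    by (intro exI conjI allI) (assumption, simp add: algebra_simps)
qed

text \<open>The identity theorem is needed only in one variable: two points of the domain are joined by a
  complex line, whose intersection with the domain is convex.\<close>

lemma mv_holomorphic_on_line:
  assumes "mv_holomorphic_on f D"
  shows "(\<lambda>w. f (a + w *s v)) holomorphic_on {w. a + w *s v \<in> D}"
  unfolding holomorphic_on_def
proof
  fix w assume "w \<in> {w. a + w *s v \<in> D}"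
  then have w: "a + w *s v \<in> D" by simp
  obtain f' where f': "(f has_derivative f') (at (a + w *s v))" "\<And>a v. f' (a *s v) = a * f' v"
    using assms w unfolding mv_holomorphic_on_def by blast
  have "bounded_linear (\<lambda>w::complex. w *s v)"
    by (rule linear_conv_bounded_linear[THEN iffD1])
       (auto intro!: linearI simp: vec_eq_iff distrib_right)
  then have "((\<lambda>w. a + w *s v) has_derivative (\<lambda>h. h *s v)) (at w)"
    using has_derivative_add[OF has_derivative_const bounded_linear_imp_has_derivative] by fastforce
  from has_derivative_compose[OF this f'(1)]
  have "((\<lambda>w. f (a + w *s v)) has_field_derivative f' v) (at w)"
    unfolding has_field_derivative_def f'(2) mult.commute[of "f' v"] .
  then show "(\<lambda>w. f (a + w *s v)) field_differentiable at w within {w. a + w *s v \<in> D}"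
    using field_differentiable_at_within field_differentiable_def by blast
qed

lemma norm_exp_minus_one_le: "norm (exp z - 1) \<le> norm z * exp (norm z)" for z :: complex
  using Taylor_exp_field[of z 0] by (simp add: mult.commute)

lemma open_right_line: "open {w. a + w *s v \<in> right_domain}"
  and convex_right_line: "convex {w. a + w *s v \<in> right_domain}"
proof -
  have eq: "{w. a + w *s v \<in> right_domain} = (\<Inter>k. {w. 0 < Re (a $ k + w * v $ k)})"
    by (auto simp: right_domain_def)
  show "open {w. a + w *s v \<in> right_domain}"
    unfolding eq by (intro open_INT open_Collect_less continuous_intros ballI) auto
  show "convex {w. a + w *s v \<in> right_domain}"
    unfolding eq
  proof (rule convex_INT)
    fix k
    show "convex {w. 0 < Re (a $ k + w * v $ k)}"
    proof (rule convexI)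
      fix x y :: complex and p q :: real
      assume *: "x \<in> {w. 0 < Re (a $ k + w * v $ k)}" "y \<in> {w. 0 < Re (a $ k + w * v $ k)}"
        and pq: "0 \<le> p" "0 \<le> q" "p + q = 1"
      have "a $ k + (p *\<^sub>R x + q *\<^sub>R y) * v $ k = (p + q) *\<^sub>R a $ k + (p *\<^sub>R x + q *\<^sub>R y) * v $ k"
        using pq by simp
      also have "\<dots> = p *\<^sub>R (a $ k + x * v $ k) + q *\<^sub>R (a $ k + y * v $ k)"
        by (simp add: algebra_simps)
      finally have "Re (a $ k + (p *\<^sub>R x + q *\<^sub>R y) * v $ k) =
        p * Re (a $ k + x * v $ k) + q * Re (a $ k + y * v $ k)" by simp
      moreover have "0 < p * Re (a $ k + x * v $ k) + q * Re (a $ k + y * v $ k)"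
        using * pq by (cases "p = 0") (auto intro: add_pos_nonneg)
      ultimately show "p *\<^sub>R x + q *\<^sub>R y \<in> {w. 0 < Re (a $ k + w * v $ k)}" by simp
    qed
  qed
qed

lemma measurable_cpowr_abs: "(\<lambda>u::real. complex_of_real \<bar>u\<bar> powr s) \<in> borel_measurable borel"
proof -
  have "(\<lambda>u::real. complex_of_real \<bar>u\<bar> powr s) = (\<lambda>u. if u = 0 then 0 else exp (s * complex_of_real (ln \<bar>u\<bar>)))"
    by (auto simp: powr_def Ln_of_real)
  also have "\<dots> \<in> borel_measurable borel" by measurable
  finally show ?thesis .
qed

context multilinear_family
begin

lemma measurable_zeta_integrand: "zeta_integrand P s \<in> borel_measurable borel"
  unfolding zeta_integrand_def[abs_def]
  by (intro borel_measurable_times borel_measurable_prod measurable_compose[OF peval_measurable measurable_cpowr_abs])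
     measurable

lemma norm_zeta_integrand: "norm (zeta_integrand P s x) = abs_power P (\<lambda>k. Re (s $ k)) x * gauss x"
proof -
  have "norm (complex_of_real \<bar>u\<bar> powr s) = \<bar>u\<bar> powr Re s" for u :: real and s
    by (cases "u = 0") (auto simp: norm_powr_real_powr)
  then show ?thesis
    unfolding zeta_integrand_def abs_power_def gauss_def norm_mult norm_of_real
    by (simp add: prod_norm[symmetric])
qed

lemma integrable_zeta_integrand:
  assumes "s \<in> right_domain"
  shows "integrable lborel (zeta_integrand P s)"
proof (rule Bochner_Integration.integrable_bound)
  show "integrable lborel (\<lambda>x. abs_power P (\<lambda>k. Re (s $ k)) x * gauss x)"
    using assms by (intro real_zeta_integrable) (auto simp: right_domain_def less_imp_le)
qed (auto simp: norm_zeta_integrand measurable_zeta_integrand)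

lemma zeta_integrand_of_real:
  "zeta_integrand P (\<chi> k. of_real (t k)) x = of_real (abs_power P t x * gauss x)"
  unfolding zeta_integrand_def abs_power_def gauss_def
  by (simp add: powr_of_real)

lemma zeta_R_of_real: "zeta_R P (\<chi> k. of_real (t k)) = of_real (real_zeta t)"
  unfolding zeta_R_def zeta_integrand_of_real real_zeta_def by (rule integral_complex_of_real)

text \<open>Along the line the integrand is multiplied by \<open>exp (h \<ell>(x))\<close>, where
  \<open>\<ell>(x) = \<Sum>k. v\<^sub>k ln |P\<^sub>k(x)|\<close>. For \<open>|h| < \<delta>\<close> the difference quotient is bounded by \<open>exp (2\<delta>|\<ell>(x)|) / \<delta>\<close>,
  which is a product of powers of \<open>|P\<^sub>k|\<^bsup>\<plusminus>1\<^esup>\<close> with exponents at most \<open>\<eta>\<close>. As \<open>\<eta>\<close> does not exceed any of the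
  exponents \<open>Re s\<^sub>k\<close>, the singularities at the zeros of \<open>P\<^sub>k\<close> are absorbed and a dominating function
  of polynomial growth times the Gaussian remains.\<close>

lemma zeta_R_holomorphic_line:
  "(\<lambda>w. zeta_R P (q0 + w *s v)) holomorphic_on {w. q0 + w *s v \<in> right_domain}"
  unfolding holomorphic_on_def
proof
  fix w0 assume "w0 \<in> {w. q0 + w *s v \<in> right_domain}"
  then have w0: "q0 + w0 *s v \<in> right_domain" by simp
  define \<sigma> where "\<sigma> k = Re ((q0 + w0 *s v) $ k)" for k
  have \<sigma>: "\<sigma> k > 0" for k using w0 by (simp add: right_domain_def \<sigma>_def)
  define \<eta> where "\<eta> = Min (range \<sigma>)"
  have \<eta>: "\<eta> > 0" "\<And>k. \<eta> \<le> \<sigma> k" using \<sigma> by (auto simp: \<eta>_def)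
  define V where "V = Max (range (\<lambda>k. norm (v $ k))) + 1"
  have V: "V > 0" "\<And>k. norm (v $ k) \<le> V"
  proof -
    have *: "norm (v $ k) \<le> Max (range (\<lambda>k. norm (v $ k)))" for k by (intro Max_ge) auto
    show "norm (v $ k) \<le> V" for k using *[of k] unfolding V_def by linarith
    show "V > 0" using *[of undefined] norm_ge_zero[of "v $ undefined"] unfolding V_def by linarith
  qed
  define \<delta> where "\<delta> = \<eta> / (2 * V)"
  have \<delta>: "\<delta> > 0" "2 * \<delta> * V = \<eta>" using \<eta> V by (auto simp: \<delta>_def)
  let ?l = "\<lambda>x. \<Sum>k\<in>UNIV. v $ k * of_real (ln \<bar>peval (P k) x\<bar>)"
  let ?f = "\<lambda>w x. zeta_integrand P (q0 + w *s v) x"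
  have expand: "?f (w0 + h) x = ?f w0 x * exp (h * ?l x)" if "\<And>k. peval (P k) x \<noteq> 0" for h x
  proof -
    have "complex_of_real \<bar>peval (P k) x\<bar> powr ((q0 + (w0 + h) *s v) $ k) =
      complex_of_real \<bar>peval (P k) x\<bar> powr ((q0 + w0 *s v) $ k) * exp (h * (v $ k * of_real (ln \<bar>peval (P k) x\<bar>)))" for k
      using that[of k] by (simp add: powr_def Ln_of_real exp_add[symmetric] algebra_simps)
    then show ?thesis
      unfolding zeta_integrand_def
      by (simp add: prod.distrib sum_distrib_left exp_sum del: vector_add_component vector_smult_component)
  qed
  obtain N :: nat where N: "\<And>k. \<sigma> k + \<eta> \<le> real N"
  proof -
    have "\<sigma> k + \<eta> \<le> real (nat \<lceil>Max (range \<sigma>) + \<eta>\<rceil>)" for k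
    proof -
      have "\<sigma> k \<le> Max (range \<sigma>)" by (intro Max_ge) auto
      then show ?thesis by linarith
    qed
    then show ?thesis using that by blast
  qed
  define W where "W x = (1 / \<delta>) * (\<Prod>k\<in>(UNIV :: 'r set). 2) * (\<Prod>k\<in>UNIV. (1 + \<bar>peval (P k) x\<bar>) ^ N)" for x
  have W_int: "integrable lborel (\<lambda>x. W x * gauss x)"
    unfolding W_def by (intro integrable_poly_growth poly_growth_mult poly_growth_const poly_growth_power_bound) measurable
  have key: "norm (?f w0 x) * (exp (2 * \<delta> * norm (?l x)) / \<delta>) \<le> W x * gauss x" if nz: "\<And>k. peval (P k) x \<noteq> 0" for x
  proof -
    let ?u = "\<lambda>k. \<bar>peval (P k) x\<bar>"
    have "2 * \<delta> * norm (?l x) \<le> 2 * \<delta> * (\<Sum>k\<in>UNIV. V * \<bar>ln (?u k)\<bar>)"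
    proof -
      have "norm (?l x) \<le> (\<Sum>k\<in>UNIV. norm (v $ k * of_real (ln (?u k))))" by (rule norm_sum)
      also have "\<dots> \<le> (\<Sum>k\<in>UNIV. V * \<bar>ln (?u k)\<bar>)"
        using V(2) by (intro sum_mono) (auto simp: norm_mult intro!: mult_right_mono)
      finally show ?thesis using \<delta>(1) by simp
    qed
    also have "\<dots> = (\<Sum>k\<in>UNIV. \<eta> * \<bar>ln (?u k)\<bar>)"
      using \<delta>(2) by (simp add: sum_distrib_left mult.assoc[symmetric])
    finally have "exp (2 * \<delta> * norm (?l x)) \<le> (\<Prod>k\<in>UNIV. exp (\<eta> * \<bar>ln (?u k)\<bar>))"
      by (simp add: exp_sum[symmetric])
    then have "abs_power P \<sigma> x * exp (2 * \<delta> * norm (?l x)) \<le> abs_power P \<sigma> x * (\<Prod>k\<in>UNIV. exp (\<eta> * \<bar>ln (?u k)\<bar>))"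
      by (intro mult_left_mono) auto
    also have "\<dots> = (\<Prod>k\<in>UNIV. ?u k powr \<sigma> k * exp (\<eta> * \<bar>ln (?u k)\<bar>))"
      by (simp add: abs_power_def prod.distrib)
    also have "\<dots> \<le> (\<Prod>k\<in>UNIV. 2 * (1 + ?u k) ^ N)"
    proof (intro prod_mono conjI)
      fix k
      have u: "?u k > 0" using nz by simp
      have "exp (\<eta> * \<bar>ln (?u k)\<bar>) \<le> ?u k powr \<eta> + ?u k powr (- \<eta>)"
        using u nz[of k] by (cases "ln (?u k) \<ge> 0") (auto simp: powr_def)
      then have "?u k powr \<sigma> k * exp (\<eta> * \<bar>ln (?u k)\<bar>) \<le> ?u k powr \<sigma> k * (?u k powr \<eta> + ?u k powr (- \<eta>))"
        by (intro mult_left_mono) auto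
      also have "\<dots> = ?u k powr (\<sigma> k + \<eta>) + ?u k powr (\<sigma> k - \<eta>)"
        using u by (simp add: powr_add[symmetric] distrib_left)
      also have "\<dots> \<le> (1 + ?u k) ^ N + (1 + ?u k) ^ N"
        using N[of k] \<eta> \<eta>(2)[of k] \<sigma>[of k] by (intro add_mono powr_le_one_plus_power) auto
      finally show "?u k powr \<sigma> k * exp (\<eta> * \<bar>ln (?u k)\<bar>) \<le> 2 * (1 + ?u k) ^ N" by simp
    qed auto
    also have "\<dots> = \<delta> * W x" using \<delta>(1) by (simp add: W_def prod.distrib del: prod_constant)
    finally have "abs_power P \<sigma> x * exp (2 * \<delta> * norm (?l x)) \<le> \<delta> * W x" .
    then have "abs_power P \<sigma> x * exp (2 * \<delta> * norm (?l x)) * gauss x \<le> \<delta> * W x * gauss x"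
      by (intro mult_right_mono) (auto simp: less_imp_le)
    moreover have "norm (?f w0 x) = abs_power P \<sigma> x * gauss x"
      unfolding norm_zeta_integrand by (simp add: \<sigma>_def[abs_def])
    ultimately show ?thesis using \<delta>(1) by (simp add: field_simps)
  qed
  have meas_l: "?l \<in> borel_measurable borel" by measurable
  have near: "q0 + (w0 + h) *s v \<in> right_domain" if "norm h < \<delta>" for h
    unfolding right_domain_def
  proof safe
    fix k
    have "norm (h * v $ k) \<le> \<delta> * V"
      using that V(2)[of k] \<delta>(1) by (simp add: norm_mult mult_mono)
    also have "\<dots> < \<eta>" using \<delta>(2) \<eta>(1) by linarith
    finally have "\<bar>Re (h * v $ k)\<bar> < \<eta>" using abs_Re_le_cmod[of "h * v $ k"] by linarith
    moreover have "Re ((q0 + (w0 + h) *s v) $ k) = \<sigma> k + Re (h * v $ k)"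
      by (simp add: \<sigma>_def algebra_simps)
    ultimately show "0 < Re ((q0 + (w0 + h) *s v) $ k)" using \<eta>(2)[of k] by linarith
  qed
  let ?Z = "\<lambda>w. zeta_R P (q0 + w *s v)"
  have "((\<lambda>h. (?Z (w0 + h) - ?Z w0) / h) \<longlongrightarrow>
      (LINT x|lborel. ?f w0 x * ?l x)) (at 0 within ball 0 \<delta>)"
    unfolding tendsto_at_iff_sequentially
  proof (intro allI impI)
    fix X :: "nat \<Rightarrow> complex"
    assume X: "\<forall>i. X i \<in> ball 0 \<delta> - {0}" and X0: "X \<longlonglongrightarrow> 0"
    have Xi: "X i \<noteq> 0" "norm (X i) < \<delta>" for i using X by auto
    have lim: "(\<lambda>i. LINT x|lborel. (?f (w0 + X i) x - ?f w0 x) / X i) \<longlonglongrightarrow> (LINT x|lborel. ?f w0 x * ?l x)"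
    proof (rule integral_dominated_convergence[where w = "\<lambda>x. W x * gauss x"])
      show "(\<lambda>x. ?f w0 x * ?l x) \<in> borel_measurable lborel"
        using measurable_zeta_integrand meas_l by simp
      show "(\<lambda>x. (?f (w0 + X i) x - ?f w0 x) / X i) \<in> borel_measurable lborel" for i
        using measurable_zeta_integrand by simp
      show "AE x in lborel. (\<lambda>i. (?f (w0 + X i) x - ?f w0 x) / X i) \<longlonglongrightarrow> ?f w0 x * ?l x"
        using AE_P_nonzero
      proof eventually_elim
        case (elim x)
        have "((\<lambda>h. exp (h * ?l x)) has_field_derivative ?l x) (at 0)"
          by (auto intro!: derivative_eq_intros)
        then have "((\<lambda>h. (exp (h * ?l x) - 1) / h) \<longlongrightarrow> ?l x) (at 0)"
          by (simp add: has_field_derivative_iff)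
        moreover have "filterlim X (at 0) sequentially"
          using X0 Xi(1) by (auto simp: filterlim_at)
        ultimately have "(\<lambda>i. (exp (X i * ?l x) - 1) / X i) \<longlonglongrightarrow> ?l x"
          by (rule filterlim_compose)
        then have lim: "(\<lambda>i. ?f w0 x * ((exp (X i * ?l x) - 1) / X i)) \<longlonglongrightarrow> ?f w0 x * ?l x"
          by (intro tendsto_mult tendsto_const)
        have eq: "?f w0 x * ((exp (X i * ?l x) - 1) / X i) = (?f (w0 + X i) x - ?f w0 x) / X i" for i
          using expand[of x "X i"] elim by (simp add: algebra_simps diff_divide_distrib)
        show ?case using lim unfolding eq .
      qed
      show "AE x in lborel. norm ((?f (w0 + X i) x - ?f w0 x) / X i) \<le> W x * gauss x" for i
        using AE_P_nonzero
      proof eventually_elim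
        case (elim x)
        have "norm ((?f (w0 + X i) x - ?f w0 x) / X i) = norm (?f w0 x) * (norm (exp (X i * ?l x) - 1) / norm (X i))"
        proof -
          have "(?f (w0 + X i) x - ?f w0 x) / X i = ?f w0 x * ((exp (X i * ?l x) - 1) / X i)"
            using expand[of x "X i"] elim by (simp add: algebra_simps diff_divide_distrib)
          then show ?thesis by (simp only: norm_mult norm_divide)
        qed
        also have "\<dots> \<le> norm (?f w0 x) * (exp (2 * \<delta> * norm (?l x)) / \<delta>)"
        proof (intro mult_left_mono)
          have "norm (exp (X i * ?l x) - 1) / norm (X i) \<le> norm (?l x) * exp (norm (X i) * norm (?l x))"
            using norm_exp_minus_one_le[of "X i * ?l x"] Xi(1)[of i] by (simp add: norm_mult field_simps)
          also have "\<dots> \<le> (exp (\<delta> * norm (?l x)) / \<delta>) * exp (\<delta> * norm (?l x))"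
          proof (intro mult_mono)
            have "\<delta> * norm (?l x) \<le> exp (\<delta> * norm (?l x))" using exp_ge_add_one_self[of "\<delta> * norm (?l x)"] by linarith
            then show "norm (?l x) \<le> exp (\<delta> * norm (?l x)) / \<delta>" using \<delta>(1) by (simp add: field_simps)
            show "exp (norm (X i) * norm (?l x)) \<le> exp (\<delta> * norm (?l x))"
              using Xi(2)[of i] by (simp add: mult_right_mono)
          qed (use \<delta>(1) in auto)
          also have "\<dots> = exp (2 * \<delta> * norm (?l x)) / \<delta>"
            by (simp add: exp_add[symmetric])
          finally show "norm (exp (X i * ?l x) - 1) / norm (X i) \<le> exp (2 * \<delta> * norm (?l x)) / \<delta>" .
        qed simp
        also have "\<dots> \<le> W x * gauss x" by (rule key) (use elim in blast)
        finally show ?case .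
      qed
    qed (rule W_int)
    have eq: "(LINT x|lborel. (?f (w0 + X i) x - ?f w0 x) / X i) =
      (?Z (w0 + X i) - ?Z w0) / X i" for i
      unfolding zeta_R_def integral_divide_zero
        Bochner_Integration.integral_diff[OF integrable_zeta_integrand[OF near[OF Xi(2)]] integrable_zeta_integrand[OF w0]] ..
    show "((\<lambda>h. (?Z (w0 + h) - ?Z w0) / h) \<circ> X) \<longlonglongrightarrow> (LINT x|lborel. ?f w0 x * ?l x)"
      using lim unfolding eq o_def .
  qed
  moreover have "at (0::complex) within ball 0 \<delta> = at 0" using \<delta>(1) by (intro at_within_open) auto
  ultimately have "((\<lambda>h. (?Z (w0 + h) - ?Z w0) / h) \<longlongrightarrow>
      (LINT x|lborel. ?f w0 x * ?l x)) (at 0)"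
    by (simp only:)
  then have "((\<lambda>w. zeta_R P (q0 + w *s v)) has_field_derivative (LINT x|lborel. ?f w0 x * ?l x)) (at w0)"
    unfolding DERIV_def .
  then show "(\<lambda>w. zeta_R P (q0 + w *s v)) field_differentiable at w0 within {w. q0 + w *s v \<in> right_domain}"
    using field_differentiable_at_within field_differentiable_def by blast
qed

lemma real_zeta_tendsto_1: "(\<lambda>n. real_zeta (\<lambda>_. 1 / real (Suc n))) \<longlonglongrightarrow> 1"
proof -
  have "(\<lambda>n. LINT x|lborel. abs_power P (\<lambda>_. 1 / real (Suc n)) x * gauss x) \<longlonglongrightarrow> (LINT x|lborel. gauss (x :: real ^ 'n::{finite,linorder}))"
  proof (rule integral_dominated_convergence)
    show "integrable lborel (\<lambda>x. (\<Prod>k\<in>UNIV. (1 + \<bar>peval (P k) x\<bar>) ^ 1) * gauss x)"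
      by (intro integrable_poly_growth poly_growth_power_bound) measurable
    show "AE x in lborel. (\<lambda>n. abs_power P (\<lambda>_. 1 / real (Suc n)) x * gauss x) \<longlonglongrightarrow> gauss x"
      using AE_P_nonzero
    proof eventually_elim
      case (elim x)
      have "(\<lambda>n. 1 / real (Suc n)) \<longlonglongrightarrow> 0" using LIMSEQ_Suc[OF lim_1_over_n] by simp
      then have "(\<lambda>n. abs_power P (\<lambda>_. 1 / real (Suc n)) x * gauss x) \<longlonglongrightarrow> (\<Prod>k\<in>UNIV. \<bar>peval (P k) x\<bar> powr 0) * gauss x"
        unfolding abs_power_def using elim by (intro tendsto_intros) auto
      then show ?case using elim by simp
    qed
    show "AE x in lborel. norm (abs_power P (\<lambda>_. 1 / real (Suc n)) x * gauss x) \<le> (\<Prod>k\<in>UNIV. (1 + \<bar>peval (P k) x\<bar>) ^ 1) * gauss x" for n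
    proof (rule AE_I2)
      fix x
      have "abs_power P (\<lambda>_. 1 / real (Suc n)) x \<le> (\<Prod>k\<in>UNIV. (1 + \<bar>peval (P k) x\<bar>) ^ 1)"
        by (rule abs_power_bound) auto
      then show "norm (abs_power P (\<lambda>_. 1 / real (Suc n)) x * gauss x) \<le> (\<Prod>k\<in>UNIV. (1 + \<bar>peval (P k) x\<bar>) ^ 1) * gauss x"
        by (simp add: abs_mult mult_right_mono less_imp_le)
    qed
  qed measurable
  then show ?thesis unfolding real_zeta_def integral_gauss .
qed

end

section \<open>Continuation to the complex domain\<close>

lemma mv_holomorphic_on_transform:
  assumes "mv_holomorphic_on f D" "open D" "\<And>s. s \<in> D \<Longrightarrow> f s = g s"
  shows "mv_holomorphic_on g D"
  unfolding mv_holomorphic_on_def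
proof
  fix s assume s: "s \<in> D"
  obtain f' where f': "(f has_derivative f') (at s)" "\<And>a v. f' (a *s v) = a * f' v"
    using assms(1) s unfolding mv_holomorphic_on_def by blast
  have "(g has_derivative f') (at s)"
    by (rule has_derivative_transform_within_open[OF f'(1) assms(2) s assms(3)])
  then show "\<exists>h'. (g has_derivative h') (at s) \<and> (\<forall>a v. h' (a *s v) = a * h' v)"
    using f'(2) by blast
qed

lemma mv_holomorphic_on_power:
  assumes "mv_holomorphic_on f D"
  shows "mv_holomorphic_on (\<lambda>s. f s ^ n) D"
  using mv_holomorphic_on_prod[of "{..<n}" "\<lambda>_. f" D] assms by simp

lemma open_right_domain: "open (right_domain :: (complex ^ 'r::finite) set)"
proof -
  have eq: "right_domain = (\<Inter>k. {s :: complex ^ 'r. 0 < Re (s $ k)})" by (auto simp: right_domain_def)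
  show ?thesis unfolding eq by (intro open_INT open_Collect_less continuous_intros ballI) auto
qed

context ore_sato_family
begin

definition rhs :: "complex ^ 'r \<Rightarrow> complex" where
  "rhs s = (\<Prod>k\<in>UNIV. complex_of_real (pi powr (- real (d k)) * c k) powr (s $ k / 2)) *
        (\<Prod>i<l. \<Prod>j | z i j \<noteq> 0.
          (Gamma ((linform (\<mu> i) s + \<alpha> i + of_int j) / 2) /
           Gamma ((\<alpha> i + of_int j) / 2)) powi z i j)"

definition arg :: "nat \<Rightarrow> int \<Rightarrow> complex ^ 'r \<Rightarrow> complex" where
  "arg i j s = linform (\<mu> i) s / 2 + of_real (shift i j / 2)"

text \<open>Numerator and denominator of \<open>rhs\<close> as entire functions: Gamma factors with a positive exponent are
  moved to the denominator as powers of the entire function \<open>1/\<Gamma>\<close>, where truncated subtraction in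
  \<open>nat\<close> selects the factors that belong to each part.\<close>

definition numer :: "complex ^ 'r \<Rightarrow> complex" where
  "numer s = (\<Prod>k\<in>UNIV. exp (s $ k / 2 * of_real (ln (pi powr (- real (d k)) * c k)))) *
    (\<Prod>i<l. \<Prod>j\<in>supp i. rGamma (of_real (shift i j / 2)) powi z i j * rGamma (arg i j s) ^ nat (- z i j))"

definition denom :: "complex ^ 'r \<Rightarrow> complex" where
  "denom s = (\<Prod>i<l. \<Prod>j\<in>supp i. rGamma (arg i j s) ^ nat (z i j))"

text \<open>Valid at the poles as well, since \<open>Gamma\<close> and \<open>inverse 0\<close> both have the value \<open>0\<close> there.\<close>

lemma rhs_eq: "rhs s = numer s / denom s"
proof -
  have g: "(Gamma ((linform (\<mu> i) s + \<alpha> i + of_int j) / 2) / Gamma ((\<alpha> i + of_int j) / 2)) powi z i j =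
     rGamma (of_real (shift i j / 2)) powi z i j * rGamma (arg i j s) ^ nat (- z i j) / rGamma (arg i j s) ^ nat (z i j)"
    if "i < l" for i j
  proof -
    have e1: "(linform (\<mu> i) s + \<alpha> i + of_int j) / 2 = arg i j s"
      unfolding add.assoc shift_props(1)[OF that, of j] by (simp add: arg_def add_divide_distrib)
    have e2: "(\<alpha> i + of_int j) / 2 = of_real (shift i j / 2)"
      unfolding shift_props(1)[OF that, of j] by simp
    have "Gamma (arg i j s) / Gamma (of_real (shift i j / 2)) = rGamma (of_real (shift i j / 2)) * inverse (rGamma (arg i j s))"
      by (simp only: rGamma_inverse_Gamma divide_inverse inverse_inverse_eq mult.commute)
    moreover have "(x * inverse y) powi n = x powi n * y ^ nat (- n) / y ^ nat n" for x y :: complex and n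
      unfolding power_int_mult_distrib by (cases "n \<ge> 0") (auto simp: power_int_def divide_inverse power_inverse)
    ultimately show ?thesis unfolding e1 e2 by simp
  qed
  have e: "complex_of_real (pi powr (- real (d k)) * c k) powr (s $ k / 2) =
    exp (s $ k / 2 * of_real (ln (pi powr (- real (d k)) * c k)))" for k
    using c_pos[of k] by (simp add: powr_def Ln_of_real del: of_real_mult)
  have "rhs s = (\<Prod>k\<in>UNIV. exp (s $ k / 2 * of_real (ln (pi powr (- real (d k)) * c k)))) *
    (\<Prod>i<l. \<Prod>j\<in>supp i. rGamma (of_real (shift i j / 2)) powi z i j * rGamma (arg i j s) ^ nat (- z i j) /
      rGamma (arg i j s) ^ nat (z i j))"
    unfolding rhs_def by (intro arg_cong2[where f = "(*)"] prod.cong refl e g) auto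
  also have "\<dots> = numer s / denom s"
    by (simp only: numer_def denom_def prod_dividef times_divide_eq_right)
  finally show ?thesis .
qed

lemma mv_holomorphic_arg: "mv_holomorphic_on (\<lambda>s. rGamma (arg i j s)) E"
proof -
  have "mv_holomorphic_on (\<lambda>s. (\<lambda>u. rGamma (u / 2 + of_real (shift i j / 2))) (linform (\<mu> i) s)) E"
    by (rule mv_holomorphic_on_compose[OF mv_holomorphic_on_linform])
       (auto simp: field_differentiable_def intro!: derivative_eq_intros exI)
  then show ?thesis by (simp add: arg_def)
qed

lemma mv_holomorphic_denom: "mv_holomorphic_on denom E"
  unfolding denom_def[abs_def]
  by (intro mv_holomorphic_on_prod mv_holomorphic_on_power mv_holomorphic_arg)

lemma mv_holomorphic_numer: "mv_holomorphic_on numer E"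
proof -
  have "mv_holomorphic_on (\<lambda>s. (\<lambda>u. exp (u / 2 * of_real (ln (pi powr (- real (d k)) * c k)))) (s $ k)) E" for k
    by (rule mv_holomorphic_on_compose[OF mv_holomorphic_on_nth])
       (auto simp: field_differentiable_def intro!: derivative_eq_intros exI)
  then show ?thesis
    unfolding numer_def[abs_def]
    by (intro mv_holomorphic_on_mult mv_holomorphic_on_prod mv_holomorphic_on_power mv_holomorphic_arg mv_holomorphic_on_const)
qed

lemma Re_linform: "Re (linform (\<mu> i) s) = lin i (\<lambda>k. Re (s $ k))"
  by (simp add: linform_def lin_def)

lemma denom_nonzero:
  assumes "s \<in> right_domain"
  shows "denom s \<noteq> 0"
proof -
  have "rGamma (arg i j s) \<noteq> 0" if "i < l" "j \<in> supp i" for i j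
  proof -
    have "Re (arg i j s) > 0"
      using shift_props(3)[OF that] lin_nonneg[of "\<lambda>k. Re (s $ k)" i] assms
      by (simp add: arg_def Re_linform right_domain_def less_imp_le add_nonneg_pos)
    then have "arg i j s \<notin> \<int>\<^sub>\<le>\<^sub>0" by (auto elim!: nonpos_Ints_cases)
    then show ?thesis by (simp add: rGamma_eq_zero_iff)
  qed
  then show ?thesis by (simp add: denom_def supp_props(1))
qed

lemma mv_holomorphic_rhs: "mv_holomorphic_on rhs right_domain"
proof -
  have "mv_holomorphic_on (\<lambda>s. inverse (denom s)) right_domain"
    by (rule mv_holomorphic_on_compose[OF mv_holomorphic_denom])
       (use denom_nonzero in \<open>auto simp: field_differentiable_def intro!: DERIV_inverse exI\<close>)
  then have "mv_holomorphic_on (\<lambda>s. numer s * inverse (denom s)) right_domain"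
    by (rule mv_holomorphic_on_mult[OF mv_holomorphic_numer])
  then show ?thesis by (simp add: rhs_eq[abs_def] divide_inverse)
qed

text \<open>The denominator does not vanish identically near any point \<open>s\<^sub>0\<close>: on the real ray from \<open>s\<^sub>0\<close> in the
  direction \<open>(1, \<dots>, 1)\<close> the real part of each \<open>\<mu>\<^sub>i\<close> is strictly increasing, so the arguments of the Gamma functions hit
  poles only for countably many parameters.\<close>

lemma mv_meromorphic_rhs: "mv_meromorphic rhs"
  unfolding mv_meromorphic_def
proof (rule allI, rule exI[of _ UNIV], rule exI[of _ numer], rule exI[of _ denom], intro conjI allI impI ballI)
  show "mv_holomorphic_on numer UNIV" "mv_holomorphic_on denom UNIV"
    by (rule mv_holomorphic_numer mv_holomorphic_denom)+
  fix U :: "(complex ^ 'r) set"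
  assume "open U \<and> U \<noteq> {} \<and> U \<subseteq> UNIV"
  then obtain s0 \<epsilon> where U: "s0 \<in> U" "\<epsilon> > 0" "ball s0 \<epsilon> \<subseteq> U"
    by (meson all_not_in_conv open_contains_ball)
  define one :: "complex ^ 'r" where "one = (\<chi> k. 1)"
  define \<delta> where "\<delta> = \<epsilon> / (norm one + 1)"
  have \<delta>: "\<delta> > 0" "\<delta> * norm one < \<epsilon>"
  proof -
    have n: "norm one + 1 > 0" by (simp add: add_nonneg_pos)
    show "\<delta> > 0" using U(2) n by (simp add: \<delta>_def)
    have "\<epsilon> * norm one < \<epsilon> * (norm one + 1)" using U(2) by simp
    then show "\<delta> * norm one < \<epsilon>" using n by (simp add: \<delta>_def field_simps)
  qed
  define B where "B i = (\<Sum>k\<in>UNIV. real (\<mu> i k))" for i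
  have B: "B i > 0" if "i < l" for i
  proof -
    have "\<exists>k. \<mu> i k \<noteq> 0" using ore_sato that unfolding ore_sato_data_def by blast
    then obtain k where "\<mu> i k \<noteq> 0" by blast
    then show ?thesis unfolding B_def by (intro sum_pos2[of UNIV k]) auto
  qed
  let ?r = "\<lambda>(i, j, m). (- 2 * real m - shift i j - Re (linform (\<mu> i) s0)) / B i"
  have "countable (range ?r)" by simp
  define X where "X = {0<..<\<delta>} - range ?r"
  from \<open>countable (range ?r)\<close> have "uncountable X"
    unfolding X_def using \<delta>(1) by (intro uncountable_minus_countable) (auto simp: uncountable_open_interval)
  then have "X \<noteq> {}" using countable_empty by blast
  then obtain \<tau> where "\<tau> \<in> X" by blast
  then have \<tau>: "0 < \<tau>" "\<tau> < \<delta>" "\<tau> \<notin> range ?r" unfolding X_def by simp_all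
  define s where "s = s0 + \<tau> *\<^sub>R one"
  have "norm (\<tau> *\<^sub>R one) < \<epsilon>"
  proof -
    have "norm (\<tau> *\<^sub>R one) \<le> \<delta> * norm one" using \<tau> by (simp add: mult_right_mono)
    then show ?thesis using \<delta>(2) by simp
  qed
  then have "s \<in> U" using U(3) by (auto simp: s_def dist_norm)
  moreover have "rGamma (arg i j s) \<noteq> 0" if i: "i < l" for i j
  proof
    assume "rGamma (arg i j s) = 0"
    then obtain m :: nat where "arg i j s = - of_nat m"
      by (auto simp: rGamma_eq_zero_iff elim!: nonpos_Ints_cases')
    then have "Re (arg i j s) = - real m" by simp
    moreover have "Re (linform (\<mu> i) s) = Re (linform (\<mu> i) s0) + \<tau> * B i"
      by (simp add: Re_linform lin_def s_def one_def B_def sum.distrib sum_distrib_left algebra_simps)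
    ultimately have "\<tau> * B i = - 2 * real m - shift i j - Re (linform (\<mu> i) s0)"
      by (simp add: arg_def) argo
    then have "\<tau> = ?r (i, j, m)" using B[OF i] by (simp add: field_simps)
    then show False using \<tau>(3) by blast
  qed
  then have "denom s \<noteq> 0" by (simp add: denom_def supp_props(1))
  ultimately show "\<exists>s\<in>U. denom s \<noteq> 0" by blast
qed (auto simp: rhs_eq)

lemma rhs_of_real:
  assumes "\<And>k. 0 \<le> t k"
  shows "rhs (\<chi> k. of_real (t k)) = of_real (gamma_side t)"
proof -
  have g: "Gamma ((linform (\<mu> i) (\<chi> k. of_real (t k)) + \<alpha> i + of_int j) / 2) / Gamma ((\<alpha> i + of_int j) / 2) =
      of_real (gamma_quot i j t)" if "i < l" for i j
  proof -
    have "(linform (\<mu> i) (\<chi> k. of_real (t k)) + \<alpha> i + of_int j) / 2 = of_real ((lin i t + shift i j) / 2)"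
      "(\<alpha> i + of_int j) / 2 = of_real (shift i j / 2)"
      unfolding add.assoc shift_props(1)[OF that, of j] linform_of_real by simp_all
    then show ?thesis by (simp only: Gamma_complex_of_real gamma_quot_def) (rule of_real_divide[symmetric])
  qed
  have e: "complex_of_real (pi powr (- real (d k)) * c k) powr ((\<chi> k. of_real (t k)) $ k / 2) =
      of_real ((pi powr (- real (d k)) * c k) powr (t k / 2))" for k
    using powr_of_real[of "pi powr (- real (d k)) * c k" "t k / 2"] c_pos[of k] by simp
  have "rhs (\<chi> k. of_real (t k)) = (\<Prod>k\<in>UNIV. of_real ((pi powr (- real (d k)) * c k) powr (t k / 2))) *
    (\<Prod>i<l. \<Prod>j\<in>supp i. of_real (gamma_quot i j t) powi z i j)"
    unfolding rhs_def by (intro arg_cong2[where f = "(*)"] arg_cong2[where f = "(powi)"] prod.cong refl e g) auto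
  then show ?thesis by (simp add: gamma_side_def)
qed

lemma gamma_side_tendsto_1: "(\<lambda>n. gamma_side (\<lambda>_. 1 / real (Suc n))) \<longlonglongrightarrow> 1"
proof -
  have lim: "(\<lambda>n. 1 / real (Suc n)) \<longlonglongrightarrow> 0" using LIMSEQ_Suc[OF lim_1_over_n] by simp
  have p: "(\<lambda>n. (pi powr (- real (d k)) * c k) powr (1 / real (Suc n) / 2)) \<longlonglongrightarrow> 1" for k
  proof -
    have "pi powr (- real (d k)) * c k \<noteq> 0" using c_pos[of k] by simp
    then show ?thesis
      using tendsto_powr[OF tendsto_const[of "pi powr (- real (d k)) * c k"] tendsto_divide[OF lim tendsto_const[of 2]]]
      by simp
  qed
  have g: "(\<lambda>n. gamma_quot i j (\<lambda>_. 1 / real (Suc n)) powi z i j) \<longlonglongrightarrow> 1 powi z i j"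
    if ij: "i < l" "j \<in> supp i" for i j
  proof (rule tendsto_power_int)
    have shift: "shift i j / 2 > 0" using shift_props(3)[OF ij] by simp
    then have nz: "shift i j / 2 \<notin> \<int>\<^sub>\<le>\<^sub>0" using nonpos_Ints_nonpos[of "shift i j / 2"] by linarith
    have G: "Gamma (shift i j / 2) \<noteq> 0" using Gamma_real_pos[OF shift] by linarith
    have "(\<lambda>n. (lin i (\<lambda>_. 1 / real (Suc n)) + shift i j) / 2) \<longlonglongrightarrow> ((\<Sum>k\<in>UNIV. real (\<mu> i k) * 0) + shift i j) / 2"
      unfolding lin_def by (intro tendsto_divide tendsto_add tendsto_sum tendsto_mult tendsto_const lim) auto
    then have "(\<lambda>n. (lin i (\<lambda>_. 1 / real (Suc n)) + shift i j) / 2) \<longlonglongrightarrow> shift i j / 2" by simp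
    then have "(\<lambda>n. Gamma ((lin i (\<lambda>_. 1 / real (Suc n)) + shift i j) / 2)) \<longlonglongrightarrow> Gamma (shift i j / 2)"
      using nz by (rule tendsto_Gamma)
    from tendsto_divide[OF this tendsto_const G]
    show "(\<lambda>n. gamma_quot i j (\<lambda>_. 1 / real (Suc n))) \<longlonglongrightarrow> 1"
      unfolding gamma_quot_def using G by simp
  qed simp
  have "(\<lambda>n. gamma_side (\<lambda>_. 1 / real (Suc n))) \<longlonglongrightarrow> (\<Prod>k\<in>(UNIV :: 'r set). 1) * (\<Prod>i<l. \<Prod>j\<in>supp i. 1 powi z i j)"
    unfolding gamma_side_def by (intro tendsto_mult tendsto_prod p g) auto
  then show ?thesis by simp
qed

lemma line_identity:
  fixes s0 v :: "complex ^ 'r"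
  assumes w12: "w1 < w2"
    and eq: "\<And>w. w1 < w \<Longrightarrow> w < w2 \<Longrightarrow> s0 + of_real w *s v \<in> right_domain \<and>
      zeta_R P (s0 + of_real w *s v) = C * rhs (s0 + of_real w *s v)"
    and w: "s0 + w *s v \<in> right_domain"
  shows "zeta_R P (s0 + w *s v) = C * rhs (s0 + w *s v)"
proof -
  let ?S = "{w. s0 + w *s v \<in> right_domain}"
  let ?U = "complex_of_real ` {w1<..<w2}"
  let ?m = "complex_of_real ((w1 + w2) / 2)"
  have "zeta_R P (s0 + w *s v) - C * rhs (s0 + w *s v) = 0"
  proof (rule analytic_continuation[where f = "\<lambda>w. zeta_R P (s0 + w *s v) - C * rhs (s0 + w *s v)" and w = w and S = ?S and U = ?U and \<xi> = ?m])
    show "(\<lambda>w. zeta_R P (s0 + w *s v) - C * rhs (s0 + w *s v)) holomorphic_on ?S"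
      by (intro holomorphic_intros zeta_R_holomorphic_line mv_holomorphic_on_line mv_holomorphic_rhs)
    show "open ?S" by (rule open_right_line)
    show "connected ?S" by (intro convex_connected convex_right_line)
    show "?U \<subseteq> ?S" using eq by auto
    show "?m \<in> ?S" using eq[of "(w1 + w2) / 2"] w12 by simp
    show "?m islimpt ?U"
      unfolding islimpt_approachable
    proof (intro allI impI)
      fix e :: real assume e: "e > 0"
      define \<epsilon> where "\<epsilon> = min (e / 2) ((w2 - w1) / 4)"
      have \<epsilon>: "\<epsilon> > 0" "\<epsilon> < e" "\<epsilon> < (w2 - w1) / 2" using e w12 by (auto simp: \<epsilon>_def min_def)
      have "(w1 + w2) / 2 + \<epsilon> \<in> {w1<..<w2}" using \<epsilon> by (auto simp: field_simps)
      moreover have "complex_of_real ((w1 + w2) / 2 + \<epsilon>) \<noteq> ?m" using \<epsilon>(1) unfolding of_real_eq_iff by linarith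
      moreover have "dist (complex_of_real ((w1 + w2) / 2 + \<epsilon>)) ?m < e"
        using \<epsilon> by (simp only: dist_of_real) (simp add: dist_real_def)
      ultimately show "\<exists>x'\<in>?U. x' \<noteq> ?m \<and> dist x' ?m < e" by blast
    qed
    show "zeta_R P (s0 + u *s v) - C * rhs (s0 + u *s v) = 0" if "u \<in> ?U" for u
      using that eq by auto
  qed (use w in simp)
  then show ?thesis by simp
qed

text \<open>Two continuations: from large real points to all positive real points along the direction
  \<open>(1, \<dots>, 1)\<close>, where the limit \<open>t \<rightarrow> 0\<close> identifies the constant, and then from real points to
  \<open>s = x + \<i>y\<close> along the line \<open>x + w y\<close>, which is real for small real \<open>w\<close> and passes through \<open>s\<close>
  at \<open>w = \<i>\<close>.\<close>

lemma zeta_R_eq_rhs: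
  assumes s: "s \<in> right_domain"
  shows "zeta_R P s = rhs s"
proof -
  obtain C where C: "\<And>t. large t \<Longrightarrow> real_zeta t = C * gamma_side t" by (rule real_zeta_eq_const_R) (rule that)
  have real_line: "real_zeta t = C * gamma_side t" if t: "\<And>k. t k > 0" for t
  proof -
    let ?K = "2 * real CARD('n) + 1"
    let ?s = "\<chi> k. complex_of_real (t k)" and ?v = "\<chi> k::'r. complex_of_real ?K"
    have pt: "?s + of_real w *s ?v = (\<chi> k. of_real (t k + w * ?K))" for w :: real
      by (simp add: vec_eq_iff)
    have "zeta_R P (?s + 0 *s ?v) = of_real C * rhs (?s + 0 *s ?v)"
    proof (rule line_identity[of 1 2])
      fix w :: real assume w: "1 < w" "w < 2"
      have big: "t k + w * ?K > ?K" for k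
      proof -
        have "?K \<le> w * ?K" using mult_right_mono[of 1 w ?K] w by simp
        also have "\<dots> < t k + w * ?K" using t[of k] by simp
        finally show ?thesis .
      qed
      have lg: "large (\<lambda>k. t k + w * ?K)" unfolding large_def using big by (smt (verit))
      show "?s + of_real w *s ?v \<in> right_domain \<and> zeta_R P (?s + of_real w *s ?v) = of_real C * rhs (?s + of_real w *s ?v)"
      proof
        show "?s + of_real w *s ?v \<in> right_domain"
          unfolding pt right_domain_def using less_trans[OF _ big] by simp
        show "zeta_R P (?s + of_real w *s ?v) = of_real C * rhs (?s + of_real w *s ?v)"
          unfolding pt zeta_R_of_real rhs_of_real[OF large_nonneg[OF lg]] C[OF lg] by simp
      qed
    next
      show "?s + 0 *s ?v \<in> right_domain" using t by (simp add: right_domain_def)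
    qed simp
    then have "complex_of_real (real_zeta t) = of_real (C * gamma_side t)"
      using zeta_R_of_real[of t] rhs_of_real[of t, OF less_imp_le[OF t]] by simp
    then show ?thesis by (simp only: of_real_eq_iff)
  qed
  have "(\<lambda>n. real_zeta (\<lambda>_. 1 / real (Suc n))) \<longlonglongrightarrow> C * 1"
  proof -
    have "real_zeta (\<lambda>_. 1 / real (Suc n)) = C * gamma_side (\<lambda>_. 1 / real (Suc n))" for n
      by (rule real_line) simp
    then show ?thesis by (simp only:) (intro tendsto_mult tendsto_const gamma_side_tendsto_1)
  qed
  then have "C = 1" using LIMSEQ_unique[OF real_zeta_tendsto_1] by simp
  define x where "x = (\<chi> k. complex_of_real (Re (s $ k)))"
  define y where "y = (\<chi> k. complex_of_real (Im (s $ k)))"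
  have sxy: "s = x + \<i> *s y" by (simp add: x_def y_def vec_eq_iff complex_eq)
  define \<sigma> where "\<sigma> = Min (range (\<lambda>k. Re (s $ k)))"
  have \<sigma>: "\<sigma> > 0" "\<And>k. \<sigma> \<le> Re (s $ k)" using s by (auto simp: \<sigma>_def right_domain_def)
  define Y where "Y = Max (range (\<lambda>k. \<bar>Im (s $ k)\<bar>)) + 1"
  have Y: "Y > 0" "\<And>k. \<bar>Im (s $ k)\<bar> \<le> Y"
  proof -
    have *: "\<bar>Im (s $ k)\<bar> \<le> Max (range (\<lambda>k. \<bar>Im (s $ k)\<bar>))" for k by (intro Max_ge) auto
    show "\<bar>Im (s $ k)\<bar> \<le> Y" for k using *[of k] unfolding Y_def by linarith
    show "Y > 0" using *[of undefined] unfolding Y_def by linarith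
  qed
  have "zeta_R P (x + \<i> *s y) = 1 * rhs (x + \<i> *s y)"
  proof (rule line_identity[of 0 "\<sigma> / Y"])
    show "0 < \<sigma> / Y" using \<sigma> Y by simp
    fix w :: real assume w: "0 < w" "w < \<sigma> / Y"
    let ?t = "\<lambda>k. Re (s $ k) + w * Im (s $ k)"
    have pt: "x + of_real w *s y = (\<chi> k. of_real (?t k))" by (simp add: x_def y_def vec_eq_iff)
    have t: "?t k > 0" for k
    proof -
      have "\<bar>w * Im (s $ k)\<bar> \<le> w * Y" using w Y(2)[of k] by (simp add: abs_mult)
      also have "\<dots> < \<sigma>" using w Y(1) by (simp add: field_simps)
      finally show ?thesis using \<sigma>(2)[of k] by linarith
    qed
    show "x + of_real w *s y \<in> right_domain \<and> zeta_R P (x + of_real w *s y) = 1 * rhs (x + of_real w *s y)"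
    proof
      show "x + of_real w *s y \<in> right_domain" unfolding pt right_domain_def using t by simp
      show "zeta_R P (x + of_real w *s y) = 1 * rhs (x + of_real w *s y)"
        unfolding pt zeta_R_of_real rhs_of_real[OF less_imp_le[OF t]] real_line[OF t] \<open>C = 1\<close> by simp
    qed
  next
    show "x + \<i> *s y \<in> right_domain" using s sxy by simp
  qed
  then show ?thesis using sxy by simp
qed

end

theorem theorem4p3:
  fixes G :: "(complex ^ 'm ^ 'm::finite) set"
    and \<rho> :: "complex ^ 'm ^ 'm \<Rightarrow> complex ^ 'n::{finite,linorder} ^ 'n::{finite,linorder}"
    and S :: "(complex ^ 'n::{finite,linorder}) set"
    and P :: "'r::finite \<Rightarrow> ('n, real) mpoly"
    and d :: "'r \<Rightarrow> nat"
    and b :: "('r \<Rightarrow> nat) \<Rightarrow> ('r, complex) mpoly"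
    and c :: "'r \<Rightarrow> real"
    and l :: nat
    and \<mu> :: "nat \<Rightarrow> 'r \<Rightarrow> nat"
    and \<alpha> :: "nat \<Rightarrow> complex"
    and z :: "nat \<Rightarrow> int \<Rightarrow> int"
  assumes "reductive_pv_over_R G \<rho> S"
    and "basic_relative_invariants S P"
    and "\<And>k. d k = total_degree (P k)"
    and "b_functions P b"
    and "ore_sato_data b c l \<mu> \<alpha> z"
    and "\<And>k. \<exists>a :: 'n set \<Rightarrow> real. P k = (\<Sum>J | card J = d k. squarefree_monom J (a J))"
  shows "(\<forall>s\<in>right_domain. integrable lborel (zeta_integrand P s)) \<and>
    mv_holomorphic_on (zeta_R P) right_domain \<and>
    (\<exists>Z. mv_meromorphic Z \<and> (\<forall>s\<in>right_domain. Z s = zeta_R P s) \<and>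
      (\<forall>s. Z s = (\<Prod>k\<in>UNIV. complex_of_real (pi powr (- real (d k)) * c k) powr (s $ k / 2)) *
        (\<Prod>i<l. \<Prod>j | z i j \<noteq> 0.
          (Gamma ((linform (\<mu> i) s + \<alpha> i + of_int j) / 2) /
           Gamma ((\<alpha> i + of_int j) / 2)) powi z i j)))"
proof -
  have "\<forall>k. \<exists>a :: 'n set \<Rightarrow> real. P k = (\<Sum>J | card J = d k. squarefree_monom J (a J))"
    using assms(6) by (rule allI)
  from choice[OF this] obtain a where a: "\<forall>k. P k = (\<Sum>J | card J = d k. squarefree_monom J (a k J))" ..
  have nz: "P k \<noteq> 0" for k
  proof -
    have "irreducible (P k)" using assms(2) unfolding basic_relative_invariants_def by blast
    then show ?thesis unfolding irreducible_def by (rule conjunct1)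
  qed
  interpret ore_sato_family P d a b c l \<mu> \<alpha> z
  proof
    show "P k = (\<Sum>J | card J = d k. squarefree_monom J (a k J))" for k using a by (rule spec)
  qed (rule nz assms(4) assms(5))+
  show ?thesis
  proof (intro conjI ballI exI[of _ rhs] allI)
    show "integrable lborel (zeta_integrand P s)" if "s \<in> right_domain" for s
      using that by (rule integrable_zeta_integrand)
    show "mv_holomorphic_on (zeta_R P) right_domain"
      by (rule mv_holomorphic_on_transform[OF mv_holomorphic_rhs open_right_domain zeta_R_eq_rhs[symmetric]])
    show "mv_meromorphic rhs" by (rule mv_meromorphic_rhs)
    show "rhs s = zeta_R P s" if "s \<in> right_domain" for s
      using that by (rule zeta_R_eq_rhs[symmetric])
  qed (rule rhs_def)
qed

end
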